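(* Let $0<\beta<1$, let $\mathbb N_0$ be the canonical measure, started at $0$, of the one-dimensional super-Brownian motion with $(1+\beta)$-stable branching mechanism, and let $(L^x)_{x\in\mathbb R}$ be the total local time under $\mathbb N_0$. Put $$\alpha=\frac{2}{2+\beta},\qquad c_\beta=\Big(\frac{\sqrt{\beta+2}}{2}\Big)^\alpha.$$ Then $$\mathbb N_0\big(1-e^{-\lambda L^0}\big)=c_\beta\lambda^\alpha,\qquad \lambda>0,$$ and $$\mathbb N_0(L^0\in d\ell)=\frac{c_\beta\alpha}{\Gamma(1-\alpha)}\,\ell^{-1-\alpha}\,d\ell,\qquad \ell>0.$$ In particular, $L^0>0$, $\mathbb N_0$-a.e.
   Context: Fix $0<\beta<1$. $M_F$ is the space of finite measures on $\mathbb R$ with the weak topology, and $\mu(f)=\int f\,d\mu$ (for a function $F$ on the canonical space, $\mathbb N_0(F)=\int F\,d\mathbb N_0$). The super-Brownian motion $X=(X_t)_{t\ge0}$ with $(1+\beta)$-stable branching started from $X_0\in M_F$ (law $\mathbb P_{X_0}$, expectation $\mathbb E_{X_0}$) is the $M_F$-valued (càdlàg) strong Markov process with $$\mathbb E_{X_0}\Big[\exp\Big\{-X_t(\phi)-\int_0^tX_s(f)\,ds\Big\}\Big]=\exp\{-X_0(V_t)\}$$ for nonnegative bounded Borel $\phi,f$, where $V_t$ is the unique nonnegative solution of $V_t=P_t\phi+\int_0^tP_s(f-V_{t-s}^{1+\beta})\,ds$ (the mild form of $\partial_tV=\frac12\Delta V-V^{1+\beta}+f$, $V_0=\phi$), and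 $(P_t)$ is the Brownian semigroup (generator $\frac12\Delta$). Canonical measure: $\mathbb N_{x}$ is the $\sigma$-finite measure on nonzero $M_F$-valued paths $(X_t)_{t>0}$ (the canonical cluster measure, equivalently the excursion measure of the associated Lévy snake started from $x$) such that, if $\Xi$ is a Poisson point measure with intensity $\int_{\mathbb R}\mathbb N_{x}(\cdot)X_0(dx)$, then $X_t=\int\nu_t\,\Xi(d\nu)$, $t>0$, is a super-Brownian motion with law $\mathbb P_{X_0}$. Under $\mathbb N_x$ the total occupation measure $\int_0^\infty X_t(\cdot)\,dt$ is finite and nonzero, and has a continuous density $y\mapsto L^y$, the total local time, i.e. $\int_0^\infty X_t(\phi)\,dt=\int_{\mathbb R}\phi(y)L^y\,dy$ for nonnegative measurable $\phi$, $\mathbb N_x$-a.e.; the total local time under $\mathbb P_{X_0}$ is the sum over the atoms of $\Xi$ of the cluster local times. *)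

theory Defs
  imports "HOL-Probability.Probability"
begin

section \<open>Finite measures on the line and paths of such measures\<close>

definition weak_topology :: "real measure topology" where
  "weak_topology = topology_generated_by
     {{\<mu>. finite_measure \<mu> \<and> sets \<mu> = sets borel \<and> (\<integral>x. g x \<partial>\<mu>) \<in> U} | g U.
        continuous_on UNIV g \<and> bounded (range g) \<and> open (U :: real set)}"

text \<open>Its space is the set \<open>M\<^sub>F\<close> of finite Borel measures, its \<open>\<sigma>\<close>-algebra the
  Borel \<open>\<sigma>\<close>-algebra of the weak topology.\<close>

definition MF :: "real measure measure" where
  "MF = sigma (topspace weak_topology) {U. openin weak_topology U}"

type_synonym path = "real \<Rightarrow> real measure"

definition cadlag_on :: "real set \<Rightarrow> path \<Rightarrow> bool" where
  "cadlag_on I w \<longleftrightarrow>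
     (\<forall>t\<in>I. limitin weak_topology w (w t) (at_right t)) \<and>
     (\<forall>t>0. \<exists>\<mu>. limitin weak_topology w \<mu> (at_left t))"

text \<open>Canonical path spaces with the coordinate \<open>\<sigma>\<close>-algebras: time set \<open>[0, \<infinity>)\<close> for
  super-Brownian motion, \<open>(0, \<infinity>)\<close> and nonzero paths for clusters.\<close>

definition path_space :: "path measure" where
  "path_space = restrict_space (\<Pi>\<^sub>M t\<in>{0..}. MF) {w. cadlag_on {0..} w}"

definition cluster_space :: "path measure" where
  "cluster_space = restrict_space (\<Pi>\<^sub>M t\<in>{0<..}. MF)
     {w. cadlag_on {0<..} w \<and> (\<exists>t>0. w t \<noteq> null_measure borel)}"

definition path_filtration :: "real \<Rightarrow> path measure" where
  "path_filtration t = sigma (space path_space)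
     {{w \<in> space path_space. w s \<in> B} | s B. 0 \<le> s \<and> s \<le> t \<and> B \<in> sets MF}"

definition path_shift :: "real \<Rightarrow> path \<Rightarrow> path" where
  "path_shift s w = (\<lambda>t\<in>{0..}. w (s + t))"


section \<open>Super-Brownian motion with stable branching\<close>

definition heat_semigroup :: "real \<Rightarrow> (real \<Rightarrow> real) \<Rightarrow> real \<Rightarrow> real" where
  "heat_semigroup t g x =
     (if t = 0 then g x else \<integral>y. normal_density x (sqrt t) y * g y \<partial>lborel)"

text \<open>Local boundedness in time is built in so that the Bochner integrals in the mild equation
  exist; a nonnegative solution for which they do satisfies \<open>0 \<le> V\<^sub>t \<le> P\<^sub>t \<phi> + \<integral>\<^sub>0\<^sup>t P\<^sub>s f ds\<close>
  anyway. Values \<open>V t x\<close> with \<open>t < 0\<close> are irrelevant.\<close>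

definition mild_solution ::
    "real \<Rightarrow> (real \<Rightarrow> real) \<Rightarrow> (real \<Rightarrow> real) \<Rightarrow> (real \<Rightarrow> real \<Rightarrow> real) \<Rightarrow> bool" where
  "mild_solution \<beta> \<phi> f V \<longleftrightarrow>
     (\<lambda>(t, x). V t x) \<in> borel_measurable borel \<and>
     (\<forall>t\<ge>0. \<forall>x. V t x \<ge> 0) \<and>
     (\<forall>T. \<exists>C. \<forall>t\<in>{0..T}. \<forall>x. V t x \<le> C) \<and>
     (\<forall>t\<ge>0. \<forall>x. V t x = heat_semigroup t \<phi> x +
        (LINT s:{0..t}|lborel. heat_semigroup s (\<lambda>y. f y - V (t - s) y powr (1 + \<beta>)) x))"

definition bounded_nonneg_borel :: "(real \<Rightarrow> real) \<Rightarrow> bool" where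
  "bounded_nonneg_borel g \<longleftrightarrow>
     g \<in> borel_measurable borel \<and> bounded (range g) \<and> (\<forall>x. g x \<ge> 0)"

text \<open>Finite stopping times suffice: a possibly infinite \<open>T\<close> is recovered on \<open>{T < \<infinity>}\<close>
  from the times \<open>min T n\<close>.\<close>

definition strong_Markov :: "(real measure \<Rightarrow> path measure) \<Rightarrow> bool" where
  "strong_Markov P \<longleftrightarrow>
     P \<in> MF \<rightarrow>\<^sub>M prob_algebra path_space \<and>
     (\<forall>\<mu>\<in>space MF. AE w in P \<mu>. w 0 = \<mu>) \<and>
     (\<forall>\<mu>\<in>space MF. \<forall>T A B.
        stopping_time path_filtration T \<and> (\<forall>w\<in>space path_space. T w \<ge> 0) \<and>
        A \<in> sets (filtration.pre_sigma (space path_space) path_filtration T) \<and>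
        B \<in> sets path_space \<longrightarrow>
        emeasure (P \<mu>) {w\<in>A. path_shift (T w) w \<in> B} =
          (\<integral>\<^sup>+w\<in>A. emeasure (P (w (T w))) B \<partial>P \<mu>))"

text \<open>\<open>P \<mu>\<close> is the law, on \<^const>\<open>path_space\<close>, of the process started from \<open>\<mu>\<close>.\<close>

definition super_Brownian_motion :: "real \<Rightarrow> (real measure \<Rightarrow> path measure) \<Rightarrow> bool" where
  "super_Brownian_motion \<beta> P \<longleftrightarrow>
     strong_Markov P \<and>
     (\<forall>\<mu>\<in>space MF. \<forall>\<phi> f V. \<forall>t\<ge>0.
        bounded_nonneg_borel \<phi> \<and> bounded_nonneg_borel f \<and> mild_solution \<beta> \<phi> f V \<longrightarrow>
        (\<integral>w. exp (- (\<integral>x. \<phi> x \<partial>w t) - (LINT s:{0..t}|lborel. (\<integral>x. f x \<partial>w s))) \<partial>P \<mu>) =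
          exp (- (\<integral>x. V t x \<partial>\<mu>)))"


section \<open>Canonical measure and total local time\<close>

definition poisson_point_measure ::
    "'w measure \<Rightarrow> ('w \<Rightarrow> 'a measure) \<Rightarrow> 'a measure \<Rightarrow> bool" where
  "poisson_point_measure Q \<Xi> I \<longleftrightarrow>
     prob_space Q \<and>
     (\<forall>\<omega>\<in>space Q. \<exists>(J :: nat set) p. p \<in> J \<rightarrow> space I \<and> \<Xi> \<omega> = distr (count_space J) I p) \<and>
     (\<forall>A\<in>sets I. (\<lambda>\<omega>. emeasure (\<Xi> \<omega>) A) \<in> borel_measurable Q) \<and>
     (\<forall>A\<in>sets I. emeasure I A < \<infinity> \<longrightarrow>
        (\<forall>k. measure Q {\<omega>\<in>space Q. emeasure (\<Xi> \<omega>) A = of_nat k} =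
           measure I A ^ k / fact k * exp (- measure I A))) \<and>
     (\<forall>A\<in>sets I. emeasure I A = \<infinity> \<longrightarrow> (AE \<omega> in Q. emeasure (\<Xi> \<omega>) A = \<infinity>)) \<and>
     (\<forall>(A :: nat \<Rightarrow> 'a set) J. finite J \<and> A ` J \<subseteq> sets I \<and> disjoint_family_on A J \<longrightarrow>
        prob_space.indep_vars Q (\<lambda>_. borel) (\<lambda>i \<omega>. emeasure (\<Xi> \<omega>) (A i)) J)"

text \<open>The measure \<open>\<integral> k x (\<cdot>) M(dx)\<close> on the measurable space \<open>S\<close>. The Giry monad of the library
  covers only subprobability kernels.\<close>

definition mixture :: "'b measure \<Rightarrow> ('a \<Rightarrow> 'b measure) \<Rightarrow> 'a measure \<Rightarrow> 'b measure" where
  "mixture S k M = measure_of (space S) (sets S) (\<lambda>A. \<integral>\<^sup>+x. emeasure (k x) A \<partial>M)"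

text \<open>The law of a Poisson point measure is determined by its intensity, so it does not matter
  which type carries the underlying probability spaces. The existence clause holds for every
  \<open>\<sigma>\<close>-finite intensity and only says that the clause after it is not void. The path \<open>X\<close> starts
  from \<open>X\<^sub>0\<close> and agrees with the superposition of the clusters on \<open>(0, \<infinity>)\<close> up to a null set, off
  which the superposition is cadlag.\<close>

definition canonical_measure ::
    "(real measure \<Rightarrow> path measure) \<Rightarrow> (real \<Rightarrow> path measure) \<Rightarrow> bool" where
  "canonical_measure P N \<longleftrightarrow>
     (\<forall>x. sets (N x) = sets cluster_space \<and> sigma_finite_measure (N x)) \<and>
     (\<forall>A\<in>sets cluster_space. (\<lambda>x. emeasure (N x) A) \<in> borel_measurable borel) \<and>
     (\<forall>X\<^sub>0\<in>space MF.
        (\<exists>(Q :: path measure measure) \<Xi>.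
           poisson_point_measure Q \<Xi> (mixture cluster_space N X\<^sub>0)) \<and>
        (\<forall>(Q :: path measure measure) \<Xi>.
           poisson_point_measure Q \<Xi> (mixture cluster_space N X\<^sub>0) \<longrightarrow>
           (\<exists>X \<in> Q \<rightarrow>\<^sub>M path_space. distr Q path_space X = P X\<^sub>0 \<and>
              (AE \<omega> in Q. \<forall>t>0. X \<omega> t = mixture borel (\<lambda>\<nu>. \<nu> t) (\<Xi> \<omega>)))))"

definition total_local_time :: "path measure \<Rightarrow> (real \<Rightarrow> path \<Rightarrow> real) \<Rightarrow> bool" where
  "total_local_time M L \<longleftrightarrow>
     (\<forall>y. L y \<in> borel_measurable M) \<and>
     (AE w in M.
        continuous_on UNIV (\<lambda>y. L y w) \<and> (\<forall>y. L y w \<ge> 0) \<and>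
        (\<forall>\<phi> \<in> borel_measurable borel.
           (\<integral>\<^sup>+t\<in>{0<..}. (\<integral>\<^sup>+y. \<phi> y \<partial>w t) \<partial>lborel) = (\<integral>\<^sup>+y. \<phi> y * ennreal (L y w) \<partial>lborel)))"

end

theory Submission
  imports Defs "HOL-Real_Asymp.Real_Asymp"
begin

text \<open>If \<open>V\<close> is a bounded stationary solution of \<open>V'' / 2 = V powr (1 + \<beta>) - f\<close> with \<open>f \<ge> 0\<close>, the
  Laplace functionals of super-Brownian motion and of Poisson point measures give
  \<open>N\<^sub>0 (1 - exp (- \<integral> f y * L\<^sup>y dy)) = V 0\<close>; the contribution of the terminal time vanishes since
  clusters die out. Capping the explicit solution \<open>A * (\<bar>x\<bar> + k) powr (- 2 / \<beta>)\<close> of the equation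
  without source by parabolas near the origin produces sources \<open>f\<close> close to
  \<open>r * indicator {- e<..<e} / (2 * e)\<close>, for which \<open>V 0\<close> tends to \<open>c * r powr \<alpha>\<close> as \<open>e\<close> tends to \<open>0\<close>.

  Since \<open>N\<^sub>0\<close> is infinite, Fatou's lemma only yields \<open>G r \<le> c * r powr \<alpha>\<close> for the Laplace exponent
  \<open>G\<close> of \<open>L\<^sup>0\<close>. Caps with two scales show that the defect \<open>l r = c * r powr \<alpha> - G r\<close> satisfies
  \<open>2 * l r \<le> l (2 * r)\<close>, so \<open>l r \<le> l (2 ^ n * r) / 2 ^ n\<close>, which tends to \<open>0\<close> because \<open>\<alpha> < 1\<close>.

  The law follows from the uniqueness of Laplace exponents, a consequence of the Weierstrass
  theorem in the variable \<open>exp (- l)\<close>. For \<open>L\<^sup>0 > 0\<close>, adding \<open>\<bar>x\<bar> / (1 + \<bar>x\<bar>)\<close> to the solution gives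
  an extra source that is positive on the whole line, at a cost
  \<open>c * (r + 1) powr \<alpha> - c * r powr \<alpha>\<close> that vanishes as \<open>r\<close> tends to infinity.\<close>

section \<open>Integrals against finite measures and along paths\<close>

text \<open>A point source of mass r at 0 forces slope -r at 0+: integrating V''/2 = V^(1+\<beta>) -
  r \<delta> across 0 gives a jump of -2r in V', split evenly by symmetry. Among the translates A
  (|x| + k)^(-2/\<beta>) the slope determines k, and then V(0) is proportional to r to the power
  (2/\<beta>) / (2/\<beta> + 1) = \<alpha>; this is where \<alpha> and the constant c come from.

  A point source is not a bounded function, so it is reached through windows of width e. Passing to
  the limit under an infinite measure is the obstacle: part of the integral of 1 - exp(-r occ) might
  escape as e tends to 0. The cure is the identity (1 - a)(1 - b) + (1 - a b) = (1 - a) + (1 - b),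
  with a and b taken at two scales. The product is dominated by one factor of finite integral, so
  its limit is exact; the single terms are bounded from below and the joint term from above by
  explicit caps.\<close>

lemma topspace_weak_topology:
  "topspace weak_topology = {\<mu>. finite_measure \<mu> \<and> sets \<mu> = sets borel}"
proof (intro equalityI subsetI)
  fix \<mu> :: "real measure"
  assume \<mu>: "\<mu> \<in> {\<mu>. finite_measure \<mu> \<and> sets \<mu> = sets borel}"
  show "\<mu> \<in> topspace weak_topology"
    unfolding weak_topology_def topology_generated_by_topspace
    by (rule UnionI[of "{\<mu>. finite_measure \<mu> \<and> sets \<mu> = sets borel \<and> (\<integral>x. (0::real) \<partial>\<mu>) \<in> UNIV}"],
        intro CollectI exI[of _ "\<lambda>_::real. 0::real"] exI[of _ "UNIV::real set"])
       (use \<mu> in \<open>auto simp: bounded_def\<close>)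
qed (auto simp: weak_topology_def topology_generated_by_topspace)

lemma space_MF: "space MF = {\<mu>. finite_measure \<mu> \<and> sets \<mu> = sets borel}"
  unfolding MF_def using topspace_weak_topology by (simp add: space_measure_of_conv)

lemma sets_MF: "sets MF = sigma_sets (topspace weak_topology) {U. openin weak_topology U}"
  unfolding MF_def by (intro sets_measure_of) (auto dest: openin_subset)

lemma openin_weak_topology_vimage:
  fixes g :: "real \<Rightarrow> real"
  assumes "continuous_on UNIV g" "bounded (range g)" "open U"
  shows "openin weak_topology {\<mu>. finite_measure \<mu> \<and> sets \<mu> = sets borel \<and> (\<integral>x. g x \<partial>\<mu>) \<in> U}"
  unfolding weak_topology_def using assms
  by (intro topology_generated_by_Basis CollectI exI[of _ g] exI[of _ U]) simp_all

lemma measurable_integral_MF: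
  fixes g :: "real \<Rightarrow> real"
  assumes "continuous_on UNIV g" "bounded (range g)"
  shows "(\<lambda>\<mu>. \<integral>x. g x \<partial>\<mu>) \<in> borel_measurable MF"
proof (rule borel_measurableI)
  fix U :: "real set" assume U: "open U"
  have "(\<lambda>\<mu>. \<integral>x. g x \<partial>\<mu>) -` U \<inter> space MF
      = {\<mu>. finite_measure \<mu> \<and> sets \<mu> = sets borel \<and> (\<integral>x. g x \<partial>\<mu>) \<in> U}"
    by (auto simp: space_MF)
  then show "(\<lambda>\<mu>. \<integral>x. g x \<partial>\<mu>) -` U \<inter> space MF \<in> sets MF"
    using openin_weak_topology_vimage[OF assms U] by (auto simp: sets_MF)
qed

lemma limitin_weak_topologyD:
  fixes g :: "real \<Rightarrow> real"
  assumes "limitin weak_topology w \<mu> F" "continuous_on UNIV g" "bounded (range g)"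
  shows "((\<lambda>s. \<integral>x. g x \<partial>w s) \<longlongrightarrow> (\<integral>x. g x \<partial>\<mu>)) F"
proof (rule topological_tendstoI)
  fix U assume U: "open U" "(\<integral>x. g x \<partial>\<mu>) \<in> U"
  have \<mu>: "\<mu> \<in> topspace weak_topology"
    using assms(1) by (simp add: limitin_def)
  then have "\<forall>\<^sub>F s in F. w s \<in> {\<mu>. finite_measure \<mu> \<and> sets \<mu> = sets borel \<and> (\<integral>x. g x \<partial>\<mu>) \<in> U}"
    using assms(1) openin_weak_topology_vimage[OF assms(2,3) U(1)] U(2)
    by (auto simp: limitin_def topspace_weak_topology)
  then show "\<forall>\<^sub>F s in F. (\<integral>x. g x \<partial>w s) \<in> U"
    by eventually_elim auto
qed

lemma measurable_eqI:
  assumes "f \<in> M \<rightarrow>\<^sub>M N" "\<And>x. x \<in> space M \<Longrightarrow> g x = f x"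
  shows "g \<in> M \<rightarrow>\<^sub>M N"
  using assms by (simp cong: measurable_cong)

text \<open>The weak topology only supplies integrals of bounded continuous functions. Ramps
  decreasing to the indicator of a half line reach \<open>{..a}\<close>; these half lines are stable
  under intersection and generate the Borel sets, so a Dynkin induction finishes. Finiteness of the
  measures is what allows complements.\<close>

lemma measurable_emeasure_of_integral:
  fixes \<kappa> :: "'a \<Rightarrow> real measure"
  assumes \<kappa>: "\<And>x. x \<in> space M \<Longrightarrow> finite_measure (\<kappa> x) \<and> sets (\<kappa> x) = sets borel"
    and int: "\<And>g :: real \<Rightarrow> real. continuous_on UNIV g \<Longrightarrow> bounded (range g) \<Longrightarrow>
      (\<lambda>x. \<integral>y. g y \<partial>\<kappa> x) \<in> borel_measurable M"
    and A: "A \<in> sets borel"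
  shows "(\<lambda>x. emeasure (\<kappa> x) A) \<in> borel_measurable M"
proof -
  have fin: "emeasure (\<kappa> x) B < \<infinity>" if "x \<in> space M" for x B
    using \<kappa>[OF that] finite_measure.emeasure_finite[of "\<kappa> x" B] by (simp add: top.not_eq_extremum)
  define G where "G = range (\<lambda>a::real. {..a})"
  have univ: "(\<lambda>x. emeasure (\<kappa> x) UNIV) \<in> borel_measurable M"
  proof -
    have "(\<lambda>x. ennreal (\<integral>y. 1 \<partial>\<kappa> x)) \<in> borel_measurable M"
      using int[of "\<lambda>_. 1"] by (intro measurable_compose[OF _ measurable_ennreal]) simp
    moreover have "ennreal (\<integral>y. 1 \<partial>\<kappa> x) = emeasure (\<kappa> x) UNIV" if "x \<in> space M" for x
      using \<kappa>[OF that] sets_eq_imp_space_eq[of "\<kappa> x" borel]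
      by (simp add: finite_measure.emeasure_eq_measure)
    ultimately show ?thesis by (elim measurable_eqI) simp
  qed
  have "Int_stable G" "G \<subseteq> Pow UNIV" "A \<in> sigma_sets UNIV G"
    using A by (auto simp: G_def Int_stable_def borel_eq_atMost)
  then show ?thesis
  proof (induction rule: sigma_sets_induct_disjoint)
    case (basic A)
    then obtain a where a: "A = {..a}" by (auto simp: G_def)
    \<comment> \<open>A ramp equal to 1 up to \<open>a\<close>, falling with slope
      \<open>- n\<close>, and 0 from \<open>a + 1 / n\<close> on.\<close>
    define g where "g n y = max 0 (min 1 (1 - real n * (y - a)))" for n :: nat and y :: real
  let ?I = "\<lambda>n x. \<integral>y. g n y \<partial>\<kappa> x"
    have g01: "0 \<le> g n y" "g n y \<le> 1" for n y by (auto simp: g_def)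
    have "(\<lambda>x. ?I n x) \<in> borel_measurable M" for n
      unfolding g_def by (intro int continuous_intros) (auto simp: bounded_iff intro!: exI[of _ 1])
    then have *: "(\<lambda>x. lim (\<lambda>n. ?I n x)) \<in> borel_measurable M"
      by measurable
    have lim: "(\<lambda>n. ?I n x) \<longlonglongrightarrow> measure (\<kappa> x) {..a}" if x: "x \<in> space M" for x
    proof -
      interpret finite_measure "\<kappa> x" using \<kappa>[OF x] by simp
      have s[simp, measurable_cong]: "sets (\<kappa> x) = sets borel" using \<kappa>[OF x] by simp
      have "(\<lambda>n. ?I n x) \<longlonglongrightarrow> (\<integral>y. indicator {..a} y \<partial>\<kappa> x)"
      proof (rule integral_dominated_convergence[where w="\<lambda>_. 1"])
        show "AE y in \<kappa> x. (\<lambda>n. g n y) \<longlonglongrightarrow> indicator {..a} y"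
        proof (rule AE_I2)
          fix y
          show "(\<lambda>n. g n y) \<longlonglongrightarrow> indicator {..a} y"
          proof (cases "y \<le> a")
            case True
            then have "g n y = 1" for n
              by (auto simp: g_def mult_nonneg_nonpos)
            then show ?thesis using True by simp
          next
            case False
            then obtain N :: nat where N: "1 / (y - a) < N"
              using reals_Archimedean2 by blast
            have "g n y = 0" if "n \<ge> N" for n
            proof -
              have "1 < real N * (y - a)" using N False by (simp add: field_simps)
              also have "\<dots> \<le> real n * (y - a)" using that False by (intro mult_right_mono) auto
              finally show ?thesis by (simp add: g_def)
            qed
            then have "eventually (\<lambda>n. g n y = 0) sequentially"
              by (auto simp: eventually_sequentially)
            then show ?thesis using False by (simp add: tendsto_eventually)
          qed
        qed
      qed (auto simp: g01 g_def)
      then show ?thesis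
        by (simp add: sets_eq_imp_space_eq[OF s])
    qed
    have "(\<lambda>x. ennreal (lim (\<lambda>n. ?I n x))) \<in> borel_measurable M"
      using * by measurable
    moreover have "ennreal (lim (\<lambda>n. ?I n x)) = emeasure (\<kappa> x) A" if "x \<in> space M" for x
      using limI[OF lim[OF that]] \<kappa>[OF that] by (simp add: a finite_measure.emeasure_eq_measure)
    ultimately show ?case by (elim measurable_eqI) simp
  next
    case empty
    show ?case by simp
  next
    case (compl A)
    have A': "A \<in> sets borel" using compl(1) by (simp add: G_def borel_eq_atMost)
    have "emeasure (\<kappa> x) (UNIV - A) = emeasure (\<kappa> x) UNIV - emeasure (\<kappa> x) A" if x: "x \<in> space M" for x
      using \<kappa>[OF x] fin[OF x, of A] A' sets_eq_imp_space_eq[of "\<kappa> x" borel]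
      by (metis emeasure_compl infinity_ennreal_def less_irrefl space_borel)
    then show ?case
      by (rule measurable_eqI[OF borel_measurable_minus_ennreal[OF univ compl(2)]])
  next
    case (union A)
    have A': "range A \<subseteq> sets borel" using union(2) by (simp add: G_def borel_eq_atMost)
    have "emeasure (\<kappa> x) (\<Union>i. A i) = (\<Sum>i. emeasure (\<kappa> x) (A i))" if "x \<in> space M" for x
      using \<kappa>[OF that] A' union(1) by (subst suminf_emeasure) auto
    then show ?case
      by (rule measurable_eqI[OF borel_measurable_suminf_order[OF union(3)]])
  qed
qed

lemma measurable_nn_integral_of_emeasure:
  assumes sets: "\<And>x. x \<in> space M \<Longrightarrow> sets (\<kappa> x) = sets B"
    and A: "\<And>A. A \<in> sets B \<Longrightarrow> (\<lambda>x. emeasure (\<kappa> x) A) \<in> borel_measurable M"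
    and f: "f \<in> borel_measurable B"
  shows "(\<lambda>x. \<integral>\<^sup>+y. f y \<partial>\<kappa> x) \<in> borel_measurable M"
  using f
proof (induction rule: borel_measurable_induct)
  case (cong f g)
  have "(\<integral>\<^sup>+y. f y \<partial>\<kappa> x) = (\<integral>\<^sup>+y. g y \<partial>\<kappa> x)" if "x \<in> space M" for x
    using cong(3) sets_eq_imp_space_eq[OF sets[OF that]] by (intro nn_integral_cong) auto
  then show ?case by (intro measurable_eqI[OF cong(4)]) simp
next
  case (set A)
  have "(\<integral>\<^sup>+y. indicator A y \<partial>\<kappa> x) = emeasure (\<kappa> x) A" if "x \<in> space M" for x
    using set sets[OF that] by simp
  then show ?case by (rule measurable_eqI[OF A[OF set]])
next
  case (mult u c)
  have "(\<integral>\<^sup>+y. c * u y \<partial>\<kappa> x) = c * (\<integral>\<^sup>+y. u y \<partial>\<kappa> x)" if "x \<in> space M" for x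
    using mult(2) by (intro nn_integral_cmult) (simp only: measurable_cong_sets[OF sets[OF that] refl])
  then show ?case by (rule measurable_eqI[OF borel_measurable_times_ennreal[OF borel_measurable_const mult(4)]])
next
  case (add u v)
  have "(\<integral>\<^sup>+y. v y + u y \<partial>\<kappa> x) = (\<integral>\<^sup>+y. v y \<partial>\<kappa> x) + (\<integral>\<^sup>+y. u y \<partial>\<kappa> x)" if "x \<in> space M" for x
    by (intro nn_integral_add; (unfold measurable_cong_sets[OF sets[OF that] refl])?; fact)
  then show ?case by (rule measurable_eqI[OF borel_measurable_add[OF add.IH(2) add.IH(1)]])
next
  case (seq U)
  have "(\<integral>\<^sup>+y. (SUP i. U i) y \<partial>\<kappa> x) = (SUP i. \<integral>\<^sup>+y. U i y \<partial>\<kappa> x)" if "x \<in> space M" for x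
    using seq(1,3) unfolding SUP_apply
    by (intro nn_integral_monotone_convergence_SUP) (simp_all only: measurable_cong_sets[OF sets[OF that] refl])
  moreover have "(\<lambda>x. SUP i. \<integral>\<^sup>+y. U i y \<partial>\<kappa> x) \<in> borel_measurable M"
    using seq.IH by (intro borel_measurable_SUP) auto
  ultimately show ?case by (elim measurable_eqI) simp
qed

text \<open>Both path spaces are of the following form; time \<open>0\<close> is excluded from joint
  measurability because cluster paths are not defined there.\<close>

locale measure_paths =
  fixes K :: "path measure" and I :: "real set" and S :: "path set"
  assumes K: "K = restrict_space (\<Pi>\<^sub>M t\<in>I. MF) S"
    and I: "{0<..} \<subseteq> I" "I \<subseteq> {0..}"
    and S: "\<And>w. w \<in> S \<Longrightarrow> cadlag_on I w"
begin

lemma path_in_MF: "w \<in> space K \<Longrightarrow> t \<in> I \<Longrightarrow> w t \<in> space MF"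
  by (auto simp: K space_restrict_space space_PiM)

lemma path_finite_measure: "w \<in> space K \<Longrightarrow> t \<in> I \<Longrightarrow> finite_measure (w t)"
  and path_sets: "w \<in> space K \<Longrightarrow> t \<in> I \<Longrightarrow> sets (w t) = sets borel"
  using path_in_MF by (auto simp: space_MF)

lemma path_cadlag: "w \<in> space K \<Longrightarrow> cadlag_on I w"
  using S by (auto simp: K space_restrict_space)

lemma measurable_path_eval: "t \<in> I \<Longrightarrow> (\<lambda>w. w t) \<in> K \<rightarrow>\<^sub>M MF"
  unfolding K by (intro measurable_restrict_space1 measurable_component_singleton)

lemma path_integral_right_limit:
  fixes g :: "real \<Rightarrow> real"
  assumes "w \<in> space K" "t \<in> I" "continuous_on UNIV g" "bounded (range g)"
  shows "((\<lambda>s. \<integral>x. g x \<partial>w s) \<longlongrightarrow> (\<integral>x. g x \<partial>w t)) (at_right t)"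
  using path_cadlag[OF assms(1)] assms(2-) by (intro limitin_weak_topologyD) (auto simp: cadlag_on_def)

text \<open>Right continuity makes the integral at time s a limit of the integrals at grid times
  just after s; for each grid the map is a countable case distinction between measurable coordinate
  maps.\<close>

lemma measurable_joint_integral:
  fixes g :: "real \<Rightarrow> real"
  assumes "continuous_on UNIV g" "bounded (range g)"
  shows "(\<lambda>z. if 0 < fst z then \<integral>x. g x \<partial>(snd z) (fst z) else 0) \<in> borel_measurable (borel \<Otimes>\<^sub>M K)"
proof -
  let ?M = "(borel :: real measure) \<Otimes>\<^sub>M K"
  \<comment> \<open>Rounding down and adding one grid step keeps \<open>u n s\<close> strictly
    larger than s, so it approaches s within \<open>at_right s\<close> and is a positive time, where
    cluster paths are defined.\<close>
  define u where "u n s = (real (nat \<lfloor>real (Suc n) * s\<rfloor>) + 1) / real (Suc n)" for n :: nat and s :: real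
  define G where "G n z = (if 0 < fst z then \<integral>x. g x \<partial>(snd z) (u n (fst z)) else 0)" for n and z :: "real \<times> path"
  have "(\<lambda>z. \<integral>x. g x \<partial>(snd z) (u n (fst z))) \<in> borel_measurable ?M" for n
    unfolding u_def
  proof (rule measurable_compose_countable[where f="\<lambda>i z. \<integral>x. g x \<partial>(snd z) ((real i + 1) / real (Suc n))"])
    fix i :: nat
    have "(real i + 1) / real (Suc n) \<in> I"
      using I(1) by (auto intro!: set_mp[OF I(1)] divide_pos_pos)
    then have "(\<lambda>w. \<integral>x. g x \<partial>w ((real i + 1) / real (Suc n))) \<in> borel_measurable K"
      by (rule measurable_compose[OF measurable_path_eval measurable_integral_MF[OF assms]])
    then show "(\<lambda>z. \<integral>x. g x \<partial>(snd z) ((real i + 1) / real (Suc n))) \<in> borel_measurable ?M"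
      by (rule measurable_compose[OF measurable_snd])
  qed measurable
  then have "G n \<in> borel_measurable ?M" for n
    unfolding G_def by measurable
  moreover have "(\<lambda>n. G n z) \<longlonglongrightarrow> (if 0 < fst z then \<integral>x. g x \<partial>(snd z) (fst z) else 0)"
    if z: "z \<in> space ?M" for z
  proof (cases "0 < fst z")
    case True
    define s where "s = fst z"
    have s: "s > 0" and w: "snd z \<in> space K"
      using z True by (auto simp: space_pair_measure s_def)
    have b: "s < u n s" "u n s \<le> s + 1 / real (Suc n)" for n
    proof -
      have *: "real (nat \<lfloor>real (Suc n) * s\<rfloor>) = of_int \<lfloor>real (Suc n) * s\<rfloor>"
        using s by (simp add: mult_nonneg_nonneg)
      have "real (Suc n) * s < u n s * real (Suc n)" "u n s * real (Suc n) \<le> real (Suc n) * s + 1"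
        unfolding u_def * by (simp_all del: of_nat_Suc)
      then show "s < u n s"
        by (subst (asm) mult.commute) (simp only: mult_less_cancel_right_pos of_nat_0_less_iff zero_less_Suc)
      show "u n s \<le> s + 1 / real (Suc n)"
        using \<open>u n s * real (Suc n) \<le> real (Suc n) * s + 1\<close> by (simp add: field_simps)
    qed
    have "(\<lambda>n. u n s) \<longlonglongrightarrow> s"
    proof (rule tendsto_sandwich[where f="\<lambda>_. s" and h="\<lambda>n. s + 1 / real (Suc n)"])
      show "(\<lambda>n. s + 1 / real (Suc n)) \<longlonglongrightarrow> s"
        using tendsto_add[OF tendsto_const[of s] LIMSEQ_inverse_real_of_nat]
        by (simp add: inverse_eq_divide)
    qed (use b in \<open>auto intro!: always_eventually less_imp_le\<close>)
    then have "filterlim (\<lambda>n. u n s) (at_right s) sequentially"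
      using b(1) by (auto simp: filterlim_at intro!: always_eventually less_imp_neq[THEN not_sym])
    then have "(\<lambda>n. \<integral>x. g x \<partial>(snd z) (u n s)) \<longlonglongrightarrow> (\<integral>x. g x \<partial>(snd z) s)"
      using path_integral_right_limit[OF w subsetD[OF I(1)] assms] s
      by (intro filterlim_compose[where g="\<lambda>s. \<integral>x. g x \<partial>(snd z) s" and f="\<lambda>n. u n s"]) simp_all
    then show ?thesis using True by (simp add: G_def s_def)
  qed (simp add: G_def)
  ultimately show ?thesis
    by (rule borel_measurable_LIMSEQ_real[rotated])
qed

lemma measurable_joint_nn_integral:
  assumes "f \<in> borel_measurable borel" "T \<in> sets borel" "T \<subseteq> {0<..}"
  shows "(\<lambda>(s, w). (\<integral>\<^sup>+x. f x \<partial>w s) * indicator T s) \<in> borel_measurable (lborel \<Otimes>\<^sub>M K)"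
proof -
  \<comment> \<open>Putting the null measure at nonpositive times gives a finite kernel on the whole
    product space; the indicator of \<open>T\<close> hides the change.\<close>
  define \<kappa> where "\<kappa> z = (if 0 < fst z then snd z (fst z) else null_measure borel)" for z :: "real \<times> path"
  let ?M = "(borel :: real measure) \<Otimes>\<^sub>M K"
  have "finite_measure (\<kappa> z) \<and> sets (\<kappa> z) = sets borel" if "z \<in> space ?M" for z
    using that path_finite_measure[of "snd z" "fst z"] path_sets[of "snd z" "fst z"] I(1)
    by (cases "0 < fst z") (auto simp: space_pair_measure \<kappa>_def intro: finite_measureI)
  moreover have "(\<lambda>z. \<integral>x. g x \<partial>\<kappa> z) \<in> borel_measurable ?M"
    if "continuous_on UNIV g" "bounded (range g)" for g :: "real \<Rightarrow> real"
    using measurable_joint_integral[OF that] unfolding \<kappa>_def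
    by (rule measurable_cong[THEN iffD1, rotated]) auto
  ultimately have "(\<lambda>z. \<integral>\<^sup>+x. f x \<partial>\<kappa> z) \<in> borel_measurable ?M"
    using assms(1)
    by (intro measurable_nn_integral_of_emeasure[where B=borel] measurable_emeasure_of_integral) auto
  then have "(\<lambda>z. (\<integral>\<^sup>+x. f x \<partial>\<kappa> z) * indicator T (fst z)) \<in> borel_measurable ?M"
    using assms(2) by measurable
  also have "(\<lambda>z. (\<integral>\<^sup>+x. f x \<partial>\<kappa> z) * indicator T (fst z)) = (\<lambda>(s, w). (\<integral>\<^sup>+x. f x \<partial>w s) * indicator T s)"
    using assms(3) by (auto simp: fun_eq_iff \<kappa>_def indicator_def)
  finally show ?thesis
    by (simp cong: measurable_cong_sets sets_pair_measure_cong)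
qed

lemma measurable_nn_integral_eval:
  assumes "t \<in> I" "f \<in> borel_measurable borel"
  shows "(\<lambda>w. \<integral>\<^sup>+x. f x \<partial>w t) \<in> borel_measurable K"
  using assms path_finite_measure path_sets measurable_compose[OF measurable_path_eval measurable_integral_MF]
  by (intro measurable_nn_integral_of_emeasure[where B=borel] measurable_emeasure_of_integral) auto

lemma measurable_time_integral:
  assumes "f \<in> borel_measurable borel" "T \<in> sets borel" "T \<subseteq> {0<..}"
  shows "(\<lambda>w. \<integral>\<^sup>+s\<in>T. (\<integral>\<^sup>+x. f x \<partial>w s) \<partial>lborel) \<in> borel_measurable K"
proof -
  have "(\<lambda>(w, s). (\<integral>\<^sup>+x. f x \<partial>w s) * indicator T s) \<in> borel_measurable (K \<Otimes>\<^sub>M lborel)"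
    using measurable_joint_nn_integral[OF assms] by (subst measurable_pair_swap_iff) (simp add: case_prod_unfold)
  from sigma_finite_measure.borel_measurable_nn_integral[OF sigma_finite_lborel this]
  show ?thesis by simp
qed

lemma measurable_in_time:
  assumes "w \<in> space K" "f \<in> borel_measurable borel" "T \<in> sets borel" "T \<subseteq> {0<..}"
  shows "(\<lambda>s. (\<integral>\<^sup>+x. f x \<partial>w s) * indicator T s) \<in> borel_measurable lborel"
  using measurable_compose[OF measurable_Pair2'[OF assms(1), of lborel] measurable_joint_nn_integral[OF assms(2-)]]
  by simp

text \<open>Near each time the mass is bounded on the right by right continuity and on the left by
  the left limit; compactness of [0, t] makes the bound uniform. \<open>0 \<in> I\<close> supplies
  right continuity at time 0.\<close>

lemma path_mass_bounded:
  assumes "w \<in> space K" "0 \<in> I"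
  shows "\<exists>C. \<forall>s\<in>{0..t}. measure (w s) UNIV \<le> C"
proof -
  define m where "m s = measure (w s) UNIV" for s
  have m: "m s = (\<integral>x. 1 \<partial>w s)" if "s \<in> I" for s
    using path_sets[OF assms(1) that] sets_eq_imp_space_eq[of "w s" borel] by (simp add: m_def)
  have I': "I = {0..}"
  proof (intro equalityI I(2) subsetI)
    fix x :: real assume "x \<in> {0..}"
    then show "x \<in> I" using I(1) assms(2) by (cases "x = 0") auto
  qed
  have "\<exists>U C. open U \<and> s \<in> U \<and> (\<forall>u\<in>U \<inter> {0..}. m u \<le> C)" if s: "s \<in> {0..t}" for s
  proof -
    have "\<forall>\<^sub>F u in at_right s. (\<integral>x. 1 \<partial>w u) < m s + 1"
      using path_integral_right_limit[OF assms(1), of s "\<lambda>_. 1"] s I' m[of s]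
      by (intro order_tendstoD(2)) (auto simp: bounded_def)
    then obtain b where b: "b > s" "\<And>u. u > s \<Longrightarrow> u < b \<Longrightarrow> (\<integral>x. 1 \<partial>w u) < m s + 1"
      unfolding eventually_at_right_field by blast
    then have b: "b > s" "\<And>u. u \<in> {s<..<b} \<Longrightarrow> m u < m s + 1"
      using s I' m by auto
    have "\<exists>a C. a < s \<and> (\<forall>u\<in>{a<..<s} \<inter> {0..}. m u \<le> C)"
    proof (cases "s = 0")
      case True
      then show ?thesis by (intro exI[of _ "-1"]) auto
    next
      case False
      then have "s > 0" using s by auto
      then obtain \<mu> where "limitin weak_topology w \<mu> (at_left s)"
        using path_cadlag[OF assms(1)] by (auto simp: cadlag_on_def)
      then have "((\<lambda>u. \<integral>x. 1 \<partial>w u) \<longlongrightarrow> (\<integral>x. (1::real) \<partial>\<mu>)) (at_left s)"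
        by (rule limitin_weak_topologyD) (auto simp: bounded_def)
      then have "\<forall>\<^sub>F u in at_left s. (\<integral>x. 1 \<partial>w u) < (\<integral>x. (1::real) \<partial>\<mu>) + 1"
        by (intro order_tendstoD(2)) auto
      then obtain a where "a < s" "\<And>u. a < u \<Longrightarrow> u < s \<Longrightarrow> (\<integral>x. 1 \<partial>w u) < (\<integral>x. (1::real) \<partial>\<mu>) + 1"
        unfolding eventually_at_left_field by blast
      then show ?thesis using m I' by (intro exI[of _ a] exI[of _ "(\<integral>x. (1::real) \<partial>\<mu>) + 1"]) (auto intro: less_imp_le)
    qed
    then obtain a C where a: "a < s" "\<And>u. u\<in>{a<..<s} \<inter> {0..} \<Longrightarrow> m u \<le> C" by blast
    have "m u \<le> max C (m s + 1)" if "u \<in> {a<..<b} \<inter> {0..}" for u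
    proof (cases u s rule: linorder_cases)
      case less
      then show ?thesis using a(2)[of u] that by auto
    next
      case greater
      then show ?thesis using b(2)[of u] that by auto
    qed auto
    then show ?thesis using a(1) b(1)
      by (intro exI[of _ "{a<..<b}"] exI[of _ "max C (m s + 1)"]) auto
  qed
  then obtain U C where U: "\<And>s. s \<in> {0..t} \<Longrightarrow> open (U s) \<and> s \<in> U s \<and> (\<forall>u\<in>U s \<inter> {0..}. m u \<le> C s)"
    by metis
  obtain F where F: "F \<subseteq> {0..t}" "finite F" "{0..t} \<subseteq> (\<Union>s\<in>F. U s)"
    using compactE_image[OF compact_Icc, of "{0..t}" U] U by (metis UN_I subsetI)
  have "m u \<le> Max (C ` F)" if u: "u \<in> {0..t}" for u
  proof -
    obtain s where "s \<in> F" "u \<in> U s" using F u by auto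
    then have "m u \<le> C s" using U F u by auto
    also have "C s \<le> Max (C ` F)" using F \<open>s \<in> F\<close> by auto
    finally show ?thesis .
  qed
  then show ?thesis unfolding m_def by blast
qed

end

section \<open>The Laplace functional of a Poisson point measure\<close>

text \<open>The function exp(-x) continued by 0 at infinity, so that Laplace functionals make sense
  for occupation integrals and superpositions whose finiteness is not known in advance.\<close>

definition nexp :: "ennreal \<Rightarrow> real" where
  "nexp x = (if x = \<top> then 0 else exp (- enn2real x))"

lemma nexp_ennreal: "0 \<le> x \<Longrightarrow> nexp (ennreal x) = exp (- x)"
  and nexp_0 [simp]: "nexp 0 = 1"
  and nexp_top [simp]: "nexp \<top> = 0"
  by (simp_all add: nexp_def)

lemma nexp_nonneg [simp]: "0 \<le> nexp x"
  and nexp_le_1 [simp]: "nexp x \<le> 1"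
  by (simp_all add: nexp_def)

lemma nexp_add: "nexp (x + y) = nexp x * nexp y"
  by (cases x; cases y) (auto simp: nexp_ennreal simp flip: ennreal_plus exp_add)

lemma nexp_inj: "nexp x = nexp y \<Longrightarrow> x = y"
  by (cases x; cases y) (auto simp: nexp_ennreal)

lemma nexp_mono: "x \<le> y \<Longrightarrow> nexp y \<le> nexp x"
  by (cases x; cases y) (auto simp: nexp_ennreal top_unique)

lemma tendsto_nexp [tendsto_intros]:
  assumes "(f \<longlongrightarrow> x) F"
  shows "((\<lambda>i. nexp (f i)) \<longlongrightarrow> nexp x) F"
proof (cases "x = \<top>")
  case True
  show ?thesis
  proof (rule tendstoI)
    fix e :: real assume e: "0 < e"
    define K where "K = max 0 (- ln e)"
    have "ennreal K < x" using True by simp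
    then have "\<forall>\<^sub>F i in F. ennreal K < f i"
      using assms by (simp add: order_tendstoD)
    then show "\<forall>\<^sub>F i in F. dist (nexp (f i)) (nexp x) < e"
    proof eventually_elim
      case (elim i)
      have "nexp (f i) < e"
      proof (cases "f i")
        case (real r)
        have "0 \<le> K" by (simp add: K_def)
        then have "K < r" using elim real by (simp add: ennreal_less_iff)
        then have "- r < ln e" by (simp add: K_def)
        then have "exp (- r) < exp (ln e)" by simp
        then show ?thesis using e real by (simp add: nexp_ennreal)
      qed (use e in simp)
      then show ?case using True by (simp add: dist_real_def)
    qed
  qed
next
  case False
  have "\<forall>\<^sub>F i in F. f i < \<top>"
    using assms False by (simp add: order_tendstoD(2) top.not_eq_extremum)
  then have "\<forall>\<^sub>F i in F. exp (- enn2real (f i)) = nexp (f i)"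
    by eventually_elim (simp add: nexp_def)
  moreover have "((\<lambda>i. exp (- enn2real (f i))) \<longlongrightarrow> nexp x) F"
    using False assms unfolding nexp_def by (auto intro!: tendsto_intros simp: top.not_eq_extremum)
  ultimately show ?thesis by (rule Lim_transform_eventually[rotated])
qed

lemma borel_measurable_nexp [measurable]: "nexp \<in> borel_measurable borel"
proof (rule borel_measurable_continuous_onI)
  show "continuous_on UNIV nexp"
    unfolding continuous_on_def by (auto intro: tendsto_nexp tendsto_ident_at)
qed

lemma poisson_point_measure_atoms:
  assumes "poisson_point_measure Q \<Xi> I" "\<omega> \<in> space Q"
  obtains J :: "nat set" and p where "p \<in> J \<rightarrow> space I" "\<Xi> \<omega> = distr (count_space J) I p"
proof -
  have "\<forall>\<omega>\<in>space Q. \<exists>(J :: nat set) p. p \<in> J \<rightarrow> space I \<and> \<Xi> \<omega> = distr (count_space J) I p"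
    using assms(1) unfolding poisson_point_measure_def by (elim conjE)
  from bspec[OF this assms(2)] show thesis by (elim exE conjE) (rule that)
qed

lemma poisson_point_measure_measurable:
  assumes "poisson_point_measure Q \<Xi> I" "A \<in> sets I"
  shows "(\<lambda>\<omega>. emeasure (\<Xi> \<omega>) A) \<in> borel_measurable Q"
  using assms by (simp add: poisson_point_measure_def)

lemma poisson_point_measure_indep:
  fixes A :: "nat \<Rightarrow> 'a set"
  assumes "poisson_point_measure Q \<Xi> I" "finite J" "A ` J \<subseteq> sets I" "disjoint_family_on A J"
  shows "prob_space.indep_vars Q (\<lambda>_. borel) (\<lambda>i \<omega>. emeasure (\<Xi> \<omega>) (A i)) J"
proof -
  have "\<forall>(A :: nat \<Rightarrow> 'a set) J. finite J \<and> A ` J \<subseteq> sets I \<and> disjoint_family_on A J \<longrightarrow>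
      prob_space.indep_vars Q (\<lambda>_. borel) (\<lambda>i \<omega>. emeasure (\<Xi> \<omega>) (A i)) J"
    using assms(1) unfolding poisson_point_measure_def by (elim conjE)
  then show ?thesis using assms(2-) by simp
qed

lemma poisson_point_measure_sets:
  assumes "poisson_point_measure Q \<Xi> I" "\<omega> \<in> space Q"
  shows "sets (\<Xi> \<omega>) = sets I"
proof -
  obtain J :: "nat set" and p where "\<Xi> \<omega> = distr (count_space J) I p"
    using assms by (rule poisson_point_measure_atoms)
  then show ?thesis by simp
qed

lemma poisson_point_measure_integer:
  assumes "poisson_point_measure Q \<Xi> I" "\<omega> \<in> space Q" "A \<in> sets I"
  shows "emeasure (\<Xi> \<omega>) A = \<top> \<or> (\<exists>k. emeasure (\<Xi> \<omega>) A = of_nat k)"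
proof -
  obtain J :: "nat set" and p where p: "p \<in> J \<rightarrow> space I" "\<Xi> \<omega> = distr (count_space J) I p"
    using assms(1,2) by (rule poisson_point_measure_atoms)
  have "emeasure (\<Xi> \<omega>) A = emeasure (count_space J) (p -` A \<inter> J)"
    unfolding p(2) using assms(3) p(1) by (subst emeasure_distr) auto
  then show ?thesis
    by (cases "finite (p -` A \<inter> J)") (auto simp: emeasure_count_space)
qed

lemma poisson_point_measure_nn_integral:
  assumes "poisson_point_measure Q \<Xi> I" "\<omega> \<in> space Q"
  obtains J :: "nat set" and p where "p \<in> J \<rightarrow> space I"
    and "\<And>f. f \<in> borel_measurable I \<Longrightarrow> (\<integral>\<^sup>+x. f x \<partial>\<Xi> \<omega>) = (\<integral>\<^sup>+j. f (p j) \<partial>count_space J)"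
proof -
  obtain J :: "nat set" and p where p: "p \<in> J \<rightarrow> space I" "\<Xi> \<omega> = distr (count_space J) I p"
    using assms(1,2) by (rule poisson_point_measure_atoms)
  show thesis
    using p(1) by (intro that[OF p(1)]) (simp add: p(2) nn_integral_distr)
qed

text \<open>For finite intensity m this sums exp(-y k) against the Poisson weights, which gives
  exp(- m (1 - exp(-y))). For infinite intensity the count is almost surely infinite and both sides
  are 0.\<close>

lemma poisson_laplace_set:
  assumes ppm: "poisson_point_measure Q \<Xi> I" and A: "A \<in> sets I" and y: "0 < y"
  shows "(\<integral>\<omega>. nexp (ennreal y * emeasure (\<Xi> \<omega>) A) \<partial>Q) = nexp (ennreal (1 - exp (- y)) * emeasure I A)"
proof -
  let ?X = "\<lambda>z. nexp (ennreal y * emeasure (\<Xi> z) A)"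
  interpret prob_space Q using ppm by (simp add: poisson_point_measure_def)
  have [measurable]: "(\<lambda>\<omega>. emeasure (\<Xi> \<omega>) A) \<in> borel_measurable Q"
    using ppm A by (simp add: poisson_point_measure_def)
  show ?thesis
  proof (cases "emeasure I A = \<infinity>")
    case True
    then have "AE \<omega> in Q. emeasure (\<Xi> \<omega>) A = \<infinity>"
      using ppm A by (simp add: poisson_point_measure_def)
    then have "AE \<omega> in Q. ?X \<omega> = 0"
      by eventually_elim (use y in \<open>simp add: ennreal_mult_top\<close>)
    then have "(\<integral>\<omega>. ?X \<omega> \<partial>Q) = 0"
      by (subst integral_cong_AE[where g="\<lambda>_. 0"]) auto
    then show ?thesis using True y by (simp add: ennreal_mult_top)
  next
    case False
    define m where "m = measure I A"
    have m: "emeasure I A = ennreal m" "0 \<le> m"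
      using False by (auto simp: m_def emeasure_eq_ennreal_measure)
    have prob: "prob {\<omega>\<in>space Q. emeasure (\<Xi> \<omega>) A = of_nat k} = m ^ k / fact k * exp (- m)" for k
      using ppm A False by (auto simp: poisson_point_measure_def m_def top.not_eq_extremum)
    let ?B = "\<lambda>k. {\<omega>\<in>space Q. emeasure (\<Xi> \<omega>) A = of_nat k}"
  let ?Y = "\<lambda>k. \<integral>\<omega>. exp (- y * real k) * indicator (?B k) \<omega> \<partial>Q"
    have "(\<lambda>k. ?Y k) sums
        (\<integral>\<omega>. ?X \<omega> \<partial>Q)"
    proof -
      have pt: "(\<lambda>k. exp (- y * real k) * indicator (?B k) \<omega>) sums ?X \<omega>"
        if w: "\<omega> \<in> space Q" for \<omega>
        using poisson_point_measure_integer[OF ppm w A]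
      proof
        assume top: "emeasure (\<Xi> \<omega>) A = \<top>"
        then have "(\<lambda>k. exp (- y * real k) * indicator (?B k) \<omega>) = (\<lambda>k. 0)" by auto
        then show ?thesis using top y by (simp add: ennreal_mult_top)
      next
        assume "\<exists>k. emeasure (\<Xi> \<omega>) A = of_nat k"
        then obtain k where k: "emeasure (\<Xi> \<omega>) A = of_nat k" by blast
        have "(\<lambda>j. exp (- y * real j) * indicator (?B j) \<omega>) = (\<lambda>j. if j = k then exp (- y * real j) else 0)"
          using w k by (auto simp: fun_eq_iff indicator_def)
        moreover have "nexp (ennreal y * of_nat k) = exp (- y * real k)"
          using y by (simp add: nexp_ennreal ennreal_of_nat_eq_real_of_nat flip: ennreal_mult)
        ultimately show ?thesis using k sums_single[of k "\<lambda>j. exp (- y * real j)"] by simp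
      qed
      have ps: "summable (\<lambda>k. prob (?B k))"
        unfolding prob by (intro summable_mult2) (use summable_exp[of m] in \<open>simp add: field_simps\<close>)
      have sm: "summable (\<lambda>k. exp (- y * real k) * prob (?B k))"
        using y by (intro summable_comparison_test[OF _ ps]) (auto intro!: exI[of _ 0] mult_left_le_one_le simp: abs_mult)
      have "(\<lambda>k. ?Y k) sums
          (\<integral>\<omega>. (\<Sum>k. exp (- y * real k) * indicator (?B k) \<omega>) \<partial>Q)"
      proof (rule sums_integral)
        show "integrable Q (\<lambda>\<omega>. exp (- y * real k) * indicator (?B k) \<omega> :: real)" for k
          by (intro integrable_mult_right integrable_real_indicator) (auto simp: less_top[symmetric])
        show "AE \<omega> in Q. summable (\<lambda>k. norm (exp (- y * real k) * indicator (?B k) \<omega> :: real))"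
          using sums_summable[OF pt] by (intro AE_I2) (simp add: abs_mult)
        show "summable (\<lambda>k. \<integral>\<omega>. norm (exp (- y * real k) * indicator (?B k) \<omega> :: real) \<partial>Q)"
          using sm by (simp add: abs_mult)
      qed
      also have "(\<integral>\<omega>. (\<Sum>k. exp (- y * real k) * indicator (?B k) \<omega>) \<partial>Q) =
          (\<integral>\<omega>. ?X \<omega> \<partial>Q)"
        using sums_unique[OF pt] by (intro Bochner_Integration.integral_cong) auto
      finally show ?thesis .
    qed
    \<comment> \<open>The factor exp(-y k) is absorbed into the k-th power, which leaves the
      exponential series at m exp(-y).\<close>
    also have "(\<lambda>k. ?Y k) =
        (\<lambda>k. exp (- m) * ((m * exp (- y)) ^ k /\<^sub>R fact k))"
      by (simp add: prob fun_eq_iff power_mult_distrib field_simps exp_of_nat_mult[symmetric] mult_exp_exp)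
    finally have "(\<lambda>k. exp (- m) * ((m * exp (- y)) ^ k /\<^sub>R fact k)) sums
      (\<integral>\<omega>. ?X \<omega> \<partial>Q)" .
    moreover have "(\<lambda>k. exp (- m) * ((m * exp (- y)) ^ k /\<^sub>R fact k)) sums (exp (- m) * exp (m * exp (- y)))"
      by (intro sums_mult exp_converges)
    ultimately have "(\<integral>\<omega>. ?X \<omega> \<partial>Q) = exp (- m) * exp (m * exp (- y))"
      by (rule sums_unique2)
    also have "\<dots> = nexp (ennreal (1 - exp (- y)) * emeasure I A)"
    proof -
      have "ennreal (1 - exp (- y)) * emeasure I A = ennreal ((1 - exp (- y)) * m)"
        using m y by (simp add: ennreal_mult)
      moreover have "0 \<le> (1 - exp (- y)) * m" using m y by simp
      ultimately show ?thesis by (simp add: nexp_ennreal algebra_simps flip: exp_add)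
    qed
    finally show ?thesis .
  qed
qed

lemma nexp_sum: "finite J \<Longrightarrow> nexp (\<Sum>i\<in>J. f i) = (\<Prod>i\<in>J. nexp (f i))"
  by (induction J rule: finite_induct) (auto simp: nexp_add)

text \<open>The nonzero level sets of \<open>F\<close> are disjoint, so their point counts are
  independent and the Laplace transform factorizes into instances of
  \<open>poisson_laplace_set\<close>.\<close>

lemma poisson_laplace_simple:
  assumes ppm: "poisson_point_measure Q \<Xi> I" and F: "simple_function I F" "\<And>x. F x < \<top>"
  shows "(\<integral>\<omega>. nexp (\<integral>\<^sup>+x. F x \<partial>\<Xi> \<omega>) \<partial>Q) = nexp (\<integral>\<^sup>+x. ennreal (1 - nexp (F x)) \<partial>I)"
proof -
  interpret prob_space Q using ppm by (simp add: poisson_point_measure_def)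
  \<comment> \<open>The value 0 contributes nothing and is removed, because
    \<open>poisson_laplace_set\<close> asks for a positive factor.\<close>
  define Y where "Y = F ` space I - {0}"
  have finY: "finite Y" using F(1) by (simp add: Y_def simple_function_def)
  obtain h :: "nat \<Rightarrow> ennreal" where h: "bij_betw h {..<card Y} Y"
    using ex_bij_betw_nat_finite[OF finY] by (auto simp: lessThan_atLeast0)
  define J where "J = {..<card Y}"
  have h': "inj_on h J" "h ` J = Y" using h by (auto simp: J_def bij_betw_def)
  define A where "A i = (if i \<in> J then F -` {h i} \<inter> space I else {})" for i
  have A: "A i \<in> sets I" for i
    using F(1) by (auto simp: A_def simple_functionD)
  have disj: "disjoint_family_on A J"
    using h'(1) by (auto simp: disjoint_family_on_def A_def inj_on_def)
  define y where "y i = enn2real (h i)" for i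
  have y: "h i = ennreal (y i)" "0 < y i" if "i \<in> J" for i
  proof -
    have "h i \<in> Y" using h'(2) that by blast
    then obtain x where x: "h i = F x" "F x \<noteq> 0" by (auto simp: Y_def)
    then show "h i = ennreal (y i)" "0 < y i"
      using F(2)[of x] by (auto simp: y_def enn2real_positive_iff zero_less_iff_neq_zero)
  qed
  \<comment> \<open>Kept general in \<open>G\<close> because it serves twice: with the identity on
    the side of \<open>\<Xi>\<close>, and with 1 - \<open>nexp\<close> on the side of the
    intensity.\<close>
  have dec: "G (F x) = (\<Sum>i\<in>J. G (ennreal (y i)) * indicator (A i) x)"
    if x: "x \<in> space I" and "G 0 = 0" for x and G :: "ennreal \<Rightarrow> ennreal"
  proof (cases "F x = 0")
    case True
    have "x \<notin> A i" if "i \<in> J" for i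
      using True y[OF that] by (auto simp: A_def that)
    then show ?thesis using True \<open>G 0 = 0\<close> by simp
  next
    case False
    then have "F x \<in> Y" using x by (auto simp: Y_def)
    then obtain i where i: "i \<in> J" "h i = F x" using h'(2) by (metis imageE)
    have "(\<Sum>j\<in>J. G (ennreal (y j)) * indicator (A j) x) = (\<Sum>j\<in>J. if j = i then G (ennreal (y j)) else 0)"
      using i h'(1) x by (intro sum.cong refl) (auto simp: A_def indicator_def inj_on_def)
    also have "\<dots> = G (F x)" using i y(1)[OF i(1)] by (simp add: J_def)
    finally show ?thesis by simp
  qed
  have int: "(\<integral>\<^sup>+x. G (F x) \<partial>M) = (\<Sum>i\<in>J. G (ennreal (y i)) * emeasure M (A i))"
    if "sets M = sets I" "G 0 = 0" for M and G :: "ennreal \<Rightarrow> ennreal"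
  proof -
    have "(\<integral>\<^sup>+x. G (F x) \<partial>M) = (\<integral>\<^sup>+x. (\<Sum>i\<in>J. G (ennreal (y i)) * indicator (A i) x) \<partial>M)"
      using dec[of _ G] that sets_eq_imp_space_eq[OF that(1)] by (intro nn_integral_cong) auto
    also have "\<dots> = (\<Sum>i\<in>J. \<integral>\<^sup>+x. G (ennreal (y i)) * indicator (A i) x \<partial>M)"
      using A that(1) by (intro nn_integral_sum) auto
    also have "\<dots> = (\<Sum>i\<in>J. G (ennreal (y i)) * emeasure M (A i))"
      using A that(1) by (intro sum.cong refl nn_integral_cmult_indicator) auto
    finally show ?thesis .
  qed
  have "(\<integral>\<omega>. nexp (\<integral>\<^sup>+x. F x \<partial>\<Xi> \<omega>) \<partial>Q) = (\<integral>\<omega>. (\<Prod>i\<in>J. nexp (ennreal (y i) * emeasure (\<Xi> \<omega>) (A i))) \<partial>Q)"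
    using int[OF poisson_point_measure_sets[OF ppm], of _ "\<lambda>x. x"]
    by (intro Bochner_Integration.integral_cong) (auto simp: nexp_sum J_def)
  also have "\<dots> = (\<Prod>i\<in>J. \<integral>\<omega>. nexp (ennreal (y i) * emeasure (\<Xi> \<omega>) (A i)) \<partial>Q)"
  proof (rule indep_vars_lebesgue_integral)
    have "indep_vars (\<lambda>_. borel) (\<lambda>i \<omega>. emeasure (\<Xi> \<omega>) (A i)) J"
      using A disj by (intro poisson_point_measure_indep[OF ppm]) (auto simp: J_def)
    from indep_vars_compose2[OF this, of "\<lambda>i z. nexp (ennreal (y i) * z)" "\<lambda>_. borel"]
    show "indep_vars (\<lambda>_. borel) (\<lambda>i \<omega>. nexp (ennreal (y i) * emeasure (\<Xi> \<omega>) (A i))) J"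
      by simp
    fix i
    have [measurable]: "(\<lambda>\<omega>. emeasure (\<Xi> \<omega>) (A i)) \<in> borel_measurable Q"
      using ppm A by (simp add: poisson_point_measure_def)
    show "integrable Q (\<lambda>\<omega>. nexp (ennreal (y i) * emeasure (\<Xi> \<omega>) (A i)))"
      by (intro integrable_const_bound[where B=1]) auto
  qed (simp add: J_def)
  also have "\<dots> = (\<Prod>i\<in>J. nexp (ennreal (1 - exp (- y i)) * emeasure I (A i)))"
    using y A by (intro prod.cong refl poisson_laplace_set[OF ppm]) auto
  also have "\<dots> = nexp (\<Sum>i\<in>J. ennreal (1 - nexp (ennreal (y i))) * emeasure I (A i))"
    using y by (auto simp: nexp_sum J_def nexp_ennreal less_imp_le intro!: prod.cong)
  also have "\<dots> = nexp (\<integral>\<^sup>+x. ennreal (1 - nexp (F x)) \<partial>I)"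
    by (subst int[of I "\<lambda>x. ennreal (1 - nexp x)"]) auto
  finally show ?thesis .
qed

text \<open>Finite-valued simple functions increase to \<open>F\<close>. The left side passes to the
  limit by dominated convergence, \<open>nexp\<close> being at most 1 on a probability space; the
  right side by monotone convergence, which tolerates an infinite intensity.\<close>

lemma poisson_laplace_functional:
  assumes ppm: "poisson_point_measure Q \<Xi> I" and F: "F \<in> borel_measurable I"
  shows "(\<integral>\<omega>. nexp (\<integral>\<^sup>+x. F x \<partial>\<Xi> \<omega>) \<partial>Q) = nexp (\<integral>\<^sup>+x. ennreal (1 - nexp (F x)) \<partial>I)"
proof -
  let ?X = "\<lambda>z. \<integral>\<^sup>+x. F x \<partial>\<Xi> z"
  interpret prob_space Q using ppm by (simp add: poisson_point_measure_def)
  obtain f where f: "\<And>i. simple_function I (f i)" "incseq f" "\<And>i x. f i x < \<top>"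
    and sup: "\<And>x. (SUP i. f i x) = F x"
    using borel_measurable_implies_simple_function_sequence'[OF F] by metis
  have inc: "incseq (\<lambda>i. f i x)" for x using f(2) by (auto simp: incseq_def le_fun_def)
  have lim: "(\<lambda>i. f i x) \<longlonglongrightarrow> F x" for x using LIMSEQ_SUP[OF inc] sup by metis
  have meas_nn: "(\<lambda>\<omega>. \<integral>\<^sup>+x. g x \<partial>\<Xi> \<omega>) \<in> borel_measurable Q" if "g \<in> borel_measurable I" for g
    using poisson_point_measure_sets[OF ppm] poisson_point_measure_measurable[OF ppm] that
    by (rule measurable_nn_integral_of_emeasure)
  have "(\<lambda>i. \<integral>\<omega>. nexp (\<integral>\<^sup>+x. f i x \<partial>\<Xi> \<omega>) \<partial>Q) \<longlonglongrightarrow> (\<integral>\<omega>. nexp (?X \<omega>) \<partial>Q)"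
  proof (rule integral_dominated_convergence[where w="\<lambda>_. 1"])
    show "(\<lambda>\<omega>. nexp (\<integral>\<^sup>+x. f i x \<partial>\<Xi> \<omega>)) \<in> borel_measurable Q" for i
      using meas_nn[OF borel_measurable_simple_function[OF f(1)]] by measurable
    show "(\<lambda>\<omega>. nexp (?X \<omega>)) \<in> borel_measurable Q"
      using meas_nn[OF F] by measurable
    show "AE \<omega> in Q. (\<lambda>i. nexp (\<integral>\<^sup>+x. f i x \<partial>\<Xi> \<omega>)) \<longlonglongrightarrow> nexp (?X \<omega>)"
    proof (intro AE_I2 tendsto_nexp nn_integral_LIMSEQ)
      fix \<omega> i assume "\<omega> \<in> space Q"
      then show "f i \<in> borel_measurable (\<Xi> \<omega>)"
        using borel_measurable_simple_function[OF f(1)] measurable_cong_sets[OF poisson_point_measure_sets[OF ppm] refl] by blast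
    qed (use f(2) lim in auto)
  qed auto
  moreover have "(\<lambda>i. nexp (\<integral>\<^sup>+x. ennreal (1 - nexp (f i x)) \<partial>I)) \<longlonglongrightarrow> nexp (\<integral>\<^sup>+x. ennreal (1 - nexp (F x)) \<partial>I)"
  proof (intro tendsto_nexp nn_integral_LIMSEQ)
    show "incseq (\<lambda>i x. ennreal (1 - nexp (f i x)))"
      using f(2) by (auto simp: incseq_def le_fun_def intro!: ennreal_leI nexp_mono)
    show "(\<lambda>x. ennreal (1 - nexp (f i x))) \<in> borel_measurable I" for i
      using borel_measurable_simple_function[OF f(1)] by measurable
    show "(\<lambda>i. ennreal (1 - nexp (f i x))) \<longlonglongrightarrow> ennreal (1 - nexp (F x))" for x
      by (intro tendsto_intros lim)
  qed
  ultimately show ?thesis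
    unfolding poisson_laplace_simple[OF ppm f(1,3)] by (rule LIMSEQ_unique)
qed

section \<open>Laplace functionals under the canonical measure\<close>

lemma sets_mixture [simp]: "sets (mixture S k M) = sets S"
  and space_mixture [simp]: "space (mixture S k M) = space S"
  using sets.space_closed[of S] sets.sigma_sets_eq[of S]
  by (simp_all add: mixture_def space_measure_of sets_measure_of)

lemma emeasure_mixture:
  assumes sets: "\<And>x. x \<in> space M \<Longrightarrow> sets (k x) = sets S"
    and meas: "\<And>A. A \<in> sets S \<Longrightarrow> (\<lambda>x. emeasure (k x) A) \<in> borel_measurable M"
    and A: "A \<in> sets S"
  shows "emeasure (mixture S k M) A = (\<integral>\<^sup>+x. emeasure (k x) A \<partial>M)"
  unfolding mixture_def
proof (rule emeasure_measure_of_sigma)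
  show "sigma_algebra (space S) (sets S)" by (rule sets.sigma_algebra_axioms)
  show "positive (sets S) (\<lambda>A. \<integral>\<^sup>+x. emeasure (k x) A \<partial>M)" by (simp add: positive_def)
  show "countably_additive (sets S) (\<lambda>A. \<integral>\<^sup>+x. emeasure (k x) A \<partial>M)"
  proof (rule countably_additiveI)
    fix A :: "nat \<Rightarrow> _ set" assume A: "range A \<subseteq> sets S" "disjoint_family A"
    have "(\<Sum>i. \<integral>\<^sup>+x. emeasure (k x) (A i) \<partial>M) = (\<integral>\<^sup>+x. (\<Sum>i. emeasure (k x) (A i)) \<partial>M)"
      using A by (intro nn_integral_suminf[symmetric] meas) auto
    also have "\<dots> = (\<integral>\<^sup>+x. emeasure (k x) (\<Union>i. A i) \<partial>M)"
      using A sets by (intro nn_integral_cong suminf_emeasure) auto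
    finally show "(\<Sum>i. \<integral>\<^sup>+x. emeasure (k x) (A i) \<partial>M) = (\<integral>\<^sup>+x. emeasure (k x) (\<Union>i. A i) \<partial>M)" .
  qed
qed fact

lemma nn_integral_mixture:
  assumes sets: "\<And>x. x \<in> space M \<Longrightarrow> sets (k x) = sets S"
    and meas: "\<And>A. A \<in> sets S \<Longrightarrow> (\<lambda>x. emeasure (k x) A) \<in> borel_measurable M"
    and f: "f \<in> borel_measurable S"
  shows "(\<integral>\<^sup>+y. f y \<partial>mixture S k M) = (\<integral>\<^sup>+x. \<integral>\<^sup>+y. f y \<partial>k x \<partial>M)"
  using f
proof (induction rule: borel_measurable_induct)
  case (cong f g)
  have "(\<integral>\<^sup>+y. f y \<partial>k x) = (\<integral>\<^sup>+y. g y \<partial>k x)" if "x \<in> space M" for x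
    using cong(3) sets_eq_imp_space_eq[OF sets[OF that]] by (intro nn_integral_cong) auto
  moreover have "(\<integral>\<^sup>+y. f y \<partial>mixture S k M) = (\<integral>\<^sup>+y. g y \<partial>mixture S k M)"
    using cong(3) by (intro nn_integral_cong) auto
  ultimately show ?case using cong(4) by (simp cong: nn_integral_cong)
next
  case (set A)
  have "(\<integral>\<^sup>+y. indicator A y \<partial>k x) = emeasure (k x) A" if "x \<in> space M" for x
    using set sets[OF that] by simp
  then show ?case
    using set emeasure_mixture[OF sets meas set] by (simp cong: nn_integral_cong)
next
  case (mult u c)
  have "(\<integral>\<^sup>+y. c * u y \<partial>k x) = c * (\<integral>\<^sup>+y. u y \<partial>k x)" if "x \<in> space M" for x
    using mult(2) by (intro nn_integral_cmult) (simp only: measurable_cong_sets[OF sets[OF that] refl])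
  moreover have "(\<lambda>x. \<integral>\<^sup>+y. u y \<partial>k x) \<in> borel_measurable M"
    using mult(2) sets meas by (intro measurable_nn_integral_of_emeasure[where B=S]) auto
  moreover have "(\<integral>\<^sup>+y. c * u y \<partial>mixture S k M) = c * (\<integral>\<^sup>+y. u y \<partial>mixture S k M)"
    using mult(2) by (intro nn_integral_cmult) (simp only: measurable_cong_sets[OF sets_mixture refl])
  ultimately show ?case
    using mult.IH by (simp add: nn_integral_cmult cong: nn_integral_cong)
next
  case (add u v)
  have "(\<integral>\<^sup>+y. v y + u y \<partial>k x) = (\<integral>\<^sup>+y. v y \<partial>k x) + (\<integral>\<^sup>+y. u y \<partial>k x)" if "x \<in> space M" for x
    by (intro nn_integral_add; (unfold measurable_cong_sets[OF sets[OF that] refl])?; fact)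
  moreover have "(\<lambda>x. \<integral>\<^sup>+y. u y \<partial>k x) \<in> borel_measurable M" "(\<lambda>x. \<integral>\<^sup>+y. v y \<partial>k x) \<in> borel_measurable M"
    by (rule measurable_nn_integral_of_emeasure[where B=S, OF sets meas], assumption, assumption, fact)+
  moreover have "(\<integral>\<^sup>+y. v y + u y \<partial>mixture S k M) = (\<integral>\<^sup>+y. v y \<partial>mixture S k M) + (\<integral>\<^sup>+y. u y \<partial>mixture S k M)"
    by (intro nn_integral_add; (unfold measurable_cong_sets[OF sets_mixture refl])?; fact)
  ultimately show ?case
    using add.IH by (simp add: nn_integral_add cong: nn_integral_cong)
next
  case (seq U)
  have U: "U i \<in> borel_measurable S" for i by fact
  have "(\<integral>\<^sup>+y. (SUP i. U i) y \<partial>k x) = (SUP i. \<integral>\<^sup>+y. U i y \<partial>k x)" if "x \<in> space M" for x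
    using seq(3) U unfolding SUP_apply
    by (intro nn_integral_monotone_convergence_SUP) (simp_all only: measurable_cong_sets[OF sets[OF that] refl])
  then have "(\<integral>\<^sup>+x. \<integral>\<^sup>+y. (SUP i. U i) y \<partial>k x \<partial>M) = (\<integral>\<^sup>+x. (SUP i. \<integral>\<^sup>+y. U i y \<partial>k x) \<partial>M)"
    by (rule nn_integral_cong)
  also have "\<dots> = (SUP i. \<integral>\<^sup>+x. \<integral>\<^sup>+y. U i y \<partial>k x \<partial>M)"
  proof (rule nn_integral_monotone_convergence_SUP)
    show "incseq (\<lambda>i x. \<integral>\<^sup>+y. U i y \<partial>k x)"
      using seq(3) by (auto simp: incseq_def le_fun_def intro!: nn_integral_mono)
    show "(\<lambda>x. \<integral>\<^sup>+y. U i y \<partial>k x) \<in> borel_measurable M" for i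
      by (intro measurable_nn_integral_of_emeasure[where B=S] sets meas U)
  qed
  also have "\<dots> = (SUP i. \<integral>\<^sup>+y. U i y \<partial>mixture S k M)"
    using seq.IH by simp
  also have "\<dots> = (\<integral>\<^sup>+y. (SUP i. U i) y \<partial>mixture S k M)"
    using seq(3) U unfolding SUP_apply
    by (intro nn_integral_monotone_convergence_SUP[symmetric]) (simp_all only: measurable_cong_sets[OF sets_mixture refl])
  finally show ?case ..
qed

text \<open>Used for a start in a Dirac mass: the intensity of the Poisson clusters is then a single
  canonical measure.\<close>

lemma mixture_return:
  assumes "\<And>x. sets (k x) = sets S"
    and "\<And>A. A \<in> sets S \<Longrightarrow> (\<lambda>x. emeasure (k x) A) \<in> borel_measurable M"
    and "x \<in> space M"
  shows "mixture S k (return M x) = k x"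
proof (rule measure_eqI)
  fix A assume "A \<in> sets (mixture S k (return M x))"
  then have A: "A \<in> sets S" by simp
  have "emeasure (mixture S k (return M x)) A = (\<integral>\<^sup>+y. emeasure (k y) A \<partial>return M x)"
    using assms A by (intro emeasure_mixture) (auto cong: measurable_cong_sets)
  also have "\<dots> = emeasure (k x) A"
    using assms A by (intro nn_integral_return) auto
  finally show "emeasure (mixture S k (return M x)) A = emeasure (k x) A" .
qed (simp add: assms)

interpretation path_space: measure_paths path_space "{0..}" "{w. cadlag_on {0..} w}"
  by unfold_locales (auto simp: path_space_def)

interpretation cluster_space: measure_paths cluster_space "{0<..}"
    "{w. cadlag_on {0<..} w \<and> (\<exists>t>0. w t \<noteq> null_measure borel)}"
  by unfold_locales (auto simp: cluster_space_def)

text \<open>The exponent of the Laplace functional as an extended nonnegative number. The time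
  interval is open at 0 so that it also applies to cluster paths.\<close>

definition path_functional :: "(real \<Rightarrow> ennreal) \<Rightarrow> (real \<Rightarrow> ennreal) \<Rightarrow> real \<Rightarrow> path \<Rightarrow> ennreal" where
  "path_functional \<phi> f t w = (\<integral>\<^sup>+x. \<phi> x \<partial>w t) + (\<integral>\<^sup>+s\<in>{0<..t}. (\<integral>\<^sup>+x. f x \<partial>w s) \<partial>lborel)"

lemma (in measure_paths) measurable_path_functional:
  assumes "\<phi> \<in> borel_measurable borel" "f \<in> borel_measurable borel" "0 < t"
  shows "path_functional \<phi> f t \<in> borel_measurable K"
proof -
  have "t \<in> I" using I assms(3) by auto
  then show ?thesis
    unfolding path_functional_def[abs_def] using assms
    by (intro borel_measurable_add measurable_nn_integral_eval measurable_time_integral) auto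
qed

lemma nn_integral_bounded_nonneg_borel:
  assumes "finite_measure \<mu>" "sets \<mu> = sets borel" "bounded_nonneg_borel g"
  shows "(\<integral>\<^sup>+x. ennreal (g x) \<partial>\<mu>) = ennreal (\<integral>x. g x \<partial>\<mu>)"
    and "0 \<le> (\<integral>x. g x \<partial>\<mu>)"
    and "\<And>B. (\<And>x. g x \<le> B) \<Longrightarrow> (\<integral>x. g x \<partial>\<mu>) \<le> B * measure \<mu> UNIV"
proof -
  interpret finite_measure \<mu> by fact
  have sp: "space \<mu> = UNIV" using sets_eq_imp_space_eq[OF assms(2)] by simp
  have g: "g \<in> borel_measurable \<mu>" "\<And>x. 0 \<le> g x"
    using assms by (auto simp: bounded_nonneg_borel_def cong: measurable_cong_sets)
  obtain C where "\<And>x. norm (g x) \<le> C"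
    using assms(3) unfolding bounded_nonneg_borel_def bounded_iff by blast
  then have int: "integrable \<mu> g" using g by (intro integrable_const_bound[where B=C]) auto
  show "(\<integral>\<^sup>+x. ennreal (g x) \<partial>\<mu>) = ennreal (\<integral>x. g x \<partial>\<mu>)"
    using g by (intro nn_integral_eq_integral int) auto
  show "0 \<le> (\<integral>x. g x \<partial>\<mu>)" using g by simp
  show "(\<integral>x. g x \<partial>\<mu>) \<le> B * measure \<mu> UNIV" if "\<And>x. g x \<le> B" for B
    using integral_mono[OF int integrable_const[of B]] that sp by (simp add: mult.commute)
qed

text \<open>The Bochner integrals in the definition of super-Brownian motion agree with the
  nonnegative ones once they are known to exist. This rests on the boundedness of the total mass
  over [0, t]; time 0 is a null set.\<close>

lemma nexp_path_functional:
  assumes w: "w \<in> space path_space" and \<phi>: "bounded_nonneg_borel \<phi>" and f: "bounded_nonneg_borel f"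
    and t: "0 < t"
  shows "nexp (path_functional (\<lambda>x. ennreal (\<phi> x)) (\<lambda>x. ennreal (f x)) t w) =
    exp (- (\<integral>x. \<phi> x \<partial>w t) - (LINT s:{0..t}|lborel. (\<integral>x. f x \<partial>w s)))"
proof -
  let ?F = "\<lambda>s. \<integral>\<^sup>+x. ennreal (f x) \<partial>w s"
  define h where "h s = (\<integral>x. f x \<partial>w s)" for s
  have fin: "finite_measure (w s)" "sets (w s) = sets borel" if "0 \<le> s" for s
    using path_space.path_finite_measure[OF w] path_space.path_sets[OF w] that by auto
  have h: "(?F s) = ennreal (h s)" "0 \<le> h s" if "0 \<le> s" for s
    using nn_integral_bounded_nonneg_borel[OF fin[OF that] f] by (auto simp: h_def)
  obtain B where B: "\<And>x. f x \<le> B" "0 \<le> B"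
    using f unfolding bounded_nonneg_borel_def bounded_iff
    by (metis UNIV_I abs_ge_zero abs_le_D1 order_trans rangeI real_norm_def)
  obtain C where C: "\<And>s. s \<in> {0..t} \<Longrightarrow> measure (w s) UNIV \<le> C"
    using path_space.path_mass_bounded[OF w, of t] by (auto simp del: atLeastAtMost_iff)
  have hB: "h s \<le> B * C" if "s \<in> {0..t}" for s
  proof -
    have "h s \<le> B * measure (w s) UNIV"
      using nn_integral_bounded_nonneg_borel(3)[OF fin f, of s B] B that by (simp add: h_def)
    also have "\<dots> \<le> B * C" using C[OF that] B by (intro mult_left_mono)
    finally show ?thesis .
  qed
  have "(\<lambda>s. (?F s) * indicator {0<..t} s) \<in> borel_measurable lborel"
    using f by (intro path_space.measurable_in_time[OF w]) (auto simp: bounded_nonneg_borel_def)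
  then have "(\<lambda>s. enn2real ((?F s) * indicator {0<..t} s)) \<in> borel_measurable lborel"
    by measurable
  also have "(\<lambda>s. enn2real ((?F s) * indicator {0<..t} s)) = (\<lambda>s. indicator {0<..t} s * h s)"
    using h by (auto simp: indicator_def fun_eq_iff)
  finally have meas: "(\<lambda>s. indicator {0<..t} s * h s) \<in> borel_measurable lborel" .
  have int: "integrable lborel (\<lambda>s. indicator {0<..t} s * h s)"
  proof (rule Bochner_Integration.integrable_bound[OF _ meas])
    show "integrable lborel (\<lambda>s. indicator {0<..t} s * (B * C))"
      using t by (intro integrable_mult_left integrable_real_indicator) auto
    show "AE s in lborel. norm (indicator {0<..t} s * h s) \<le> norm (indicator {0<..t} s * (B * C))"
      using h(2) hB by (auto simp: indicator_def intro!: AE_I2 order_trans[OF _ abs_ge_self])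
  qed
  have "(\<integral>\<^sup>+s\<in>{0<..t}. (?F s) \<partial>lborel) = (\<integral>\<^sup>+s. ennreal (indicator {0<..t} s * h s) \<partial>lborel)"
    using h(1) by (intro nn_integral_cong) (auto simp: indicator_def)
  also have "\<dots> = ennreal (\<integral>s. indicator {0<..t} s * h s \<partial>lborel)"
    using h(2) by (intro nn_integral_eq_integral int) (auto simp: indicator_def intro!: AE_I2)
  also have "(\<integral>s. indicator {0<..t} s * h s \<partial>lborel) = (\<integral>s. indicator {0..t} s * h s \<partial>lborel)"
  proof (rule integral_cong_AE)
    have "(\<lambda>s. indicator {0<..t} s * h s + indicator {0} s * h 0) \<in> borel_measurable lborel"
      using meas by measurable
    also have "(\<lambda>s. indicator {0<..t} s * h s + indicator {0} s * h 0) = (\<lambda>s. indicator {0..t} s * h s)"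
      using t by (auto simp: fun_eq_iff indicator_def)
    finally show "(\<lambda>s. indicator {0..t} s * h s) \<in> borel_measurable lborel" .
    show "AE s in lborel. indicator {0<..t} s * h s = indicator {0..t} s * h s"
      using AE_lborel_singleton[of 0] by eventually_elim (auto simp: indicator_def)
  qed (rule meas)
  finally have "(\<integral>\<^sup>+s\<in>{0<..t}. (?F s) \<partial>lborel) = ennreal (LINT s:{0..t}|lborel. h s)"
    by (simp add: set_lebesgue_integral_def)
  moreover have "0 \<le> (LINT s:{0..t}|lborel. h s)"
    unfolding set_lebesgue_integral_def using h(2)
    by (intro integral_nonneg_AE) (auto simp: indicator_def intro!: AE_I2)
  moreover have "(\<integral>\<^sup>+x. ennreal (\<phi> x) \<partial>w t) = ennreal (\<integral>x. \<phi> x \<partial>w t)" "0 \<le> (\<integral>x. \<phi> x \<partial>w t)"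
    using nn_integral_bounded_nonneg_borel[OF fin \<phi>, of t] t by auto
  ultimately show ?thesis
    by (simp add: path_functional_def nexp_add nexp_ennreal h_def exp_diff exp_minus field_simps)
qed

text \<open>The functional is linear in the path, so on a superposition it is the sum of its values
  on the clusters, with the sum moved through the time integral.\<close>

lemma path_functional_superposition:
  assumes ppm: "poisson_point_measure Q \<Xi> I" and I: "sets I = sets cluster_space" and \<omega>: "\<omega> \<in> space Q"
    and X: "\<And>t. 0 < t \<Longrightarrow> X t = mixture borel (\<lambda>\<nu>. \<nu> t) (\<Xi> \<omega>)"
    and \<phi>: "\<phi> \<in> borel_measurable borel" and f: "f \<in> borel_measurable borel" and t: "0 < t"
  shows "path_functional \<phi> f t X = (\<integral>\<^sup>+\<nu>. path_functional \<phi> f t \<nu> \<partial>\<Xi> \<omega>)"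
proof -
  have sets: "sets (\<Xi> \<omega>) = sets cluster_space"
    using poisson_point_measure_sets[OF ppm \<omega>] I by simp
  note sp = sets_eq_imp_space_eq[OF sets]
  note spI = sets_eq_imp_space_eq[OF I]
  have X_int: "(\<integral>\<^sup>+x. g x \<partial>X s) = (\<integral>\<^sup>+\<nu>. \<integral>\<^sup>+x. g x \<partial>\<nu> s \<partial>\<Xi> \<omega>)"
    if "0 < s" "g \<in> borel_measurable borel" for s g
    unfolding X[OF that(1)]
  proof (rule nn_integral_mixture)
    fix A :: "real set" assume A: "A \<in> sets borel"
    have "(\<lambda>\<nu>. \<integral>\<^sup>+x. indicator A x \<partial>\<nu> s) \<in> borel_measurable cluster_space"
      using that A by (intro cluster_space.measurable_nn_integral_eval) auto
    then have "(\<lambda>\<nu>. emeasure (\<nu> s) A) \<in> borel_measurable cluster_space"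
      by (rule measurable_eqI) (use A that cluster_space.path_sets in auto)
    then show "(\<lambda>\<nu>. emeasure (\<nu> s) A) \<in> borel_measurable (\<Xi> \<omega>)"
      by (simp only: measurable_cong_sets[OF sets refl])
  qed (use that cluster_space.path_sets sp in auto)
  \<comment> \<open>Writing the integral over \<open>\<Xi> \<omega>\<close> as a countable sum over
    atoms lets it be interchanged with the time integral term by term.\<close>
  obtain J :: "nat set" and p where p: "p \<in> J \<rightarrow> space I"
    and J: "\<And>g. g \<in> borel_measurable I \<Longrightarrow> (\<integral>\<^sup>+x. g x \<partial>\<Xi> \<omega>) = (\<integral>\<^sup>+j. g (p j) \<partial>count_space J)"
    by (rule poisson_point_measure_nn_integral[OF ppm \<omega>]) (rule that, assumption, simp)
  have J': "(\<integral>\<^sup>+x. g x \<partial>\<Xi> \<omega>) = (\<integral>\<^sup>+j. g (p j) \<partial>count_space J)" if "g \<in> borel_measurable cluster_space" for g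
    using J that by (simp only: measurable_cong_sets[OF I refl])
  have "(\<integral>\<^sup>+s\<in>{0<..t}. (\<integral>\<^sup>+x. f x \<partial>X s) \<partial>lborel)
      = (\<integral>\<^sup>+s. (\<integral>\<^sup>+j. (\<integral>\<^sup>+x. f x \<partial>p j s) * indicator {0<..t} s \<partial>count_space J) \<partial>lborel)"
  proof (intro nn_integral_cong)
    fix s :: real
    show "(\<integral>\<^sup>+x. f x \<partial>X s) * indicator {0<..t} s = (\<integral>\<^sup>+j. (\<integral>\<^sup>+x. f x \<partial>p j s) * indicator {0<..t} s \<partial>count_space J)"
      using X_int[of s f] f J'[OF cluster_space.measurable_nn_integral_eval[of s f]]
      by (cases "s \<in> {0<..t}") auto
  qed
  also have "\<dots> = (\<integral>\<^sup>+j. (\<integral>\<^sup>+s. (\<integral>\<^sup>+x. f x \<partial>p j s) * indicator {0<..t} s \<partial>lborel) \<partial>count_space J)"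
  proof (rule nn_integral_count_space_nn_integral)
    fix j assume "j \<in> J"
    then have "p j \<in> space cluster_space" using p spI by auto
    then show "(\<lambda>s. (\<integral>\<^sup>+x. f x \<partial>p j s) * indicator {0<..t} s) \<in> borel_measurable lborel"
      using f by (intro cluster_space.measurable_in_time) auto
  qed simp
  also have "\<dots> = (\<integral>\<^sup>+\<nu>. (\<integral>\<^sup>+s\<in>{0<..t}. (\<integral>\<^sup>+x. f x \<partial>\<nu> s) \<partial>lborel) \<partial>\<Xi> \<omega>)"
    using f by (intro J'[symmetric] cluster_space.measurable_time_integral) auto
  finally have "(\<integral>\<^sup>+s\<in>{0<..t}. (\<integral>\<^sup>+x. f x \<partial>X s) \<partial>lborel) = (\<integral>\<^sup>+\<nu>. (\<integral>\<^sup>+s\<in>{0<..t}. (\<integral>\<^sup>+x. f x \<partial>\<nu> s) \<partial>lborel) \<partial>\<Xi> \<omega>)" .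
  moreover have "(\<lambda>\<nu>. \<integral>\<^sup>+x. \<phi> x \<partial>\<nu> t) \<in> borel_measurable (\<Xi> \<omega>)"
    unfolding measurable_cong_sets[OF sets refl]
    using t \<phi> by (intro cluster_space.measurable_nn_integral_eval) auto
  moreover have "(\<lambda>\<nu>. \<integral>\<^sup>+s\<in>{0<..t}. (\<integral>\<^sup>+x. f x \<partial>\<nu> s) \<partial>lborel) \<in> borel_measurable (\<Xi> \<omega>)"
    unfolding measurable_cong_sets[OF sets refl]
    using t f by (intro cluster_space.measurable_time_integral) auto
  ultimately show ?thesis
    unfolding path_functional_def using X_int[OF t \<phi>] by (simp add: nn_integral_add)
qed

lemma canonical_measure_sets: "canonical_measure P N \<Longrightarrow> sets (N x) = sets cluster_space"
  unfolding canonical_measure_def by blast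

text \<open>Start from the Dirac mass at 0 and compute the expectation of exp(-F(X)) twice: the
  Poisson formula gives \<open>nexp\<close> of the left side, the Laplace functional of the process
  gives exp(-V). Injectivity of \<open>nexp\<close> compares the exponents.\<close>

lemma cluster_laplace:
  assumes sbm: "super_Brownian_motion \<beta> P" and can: "canonical_measure P N"
    and \<phi>: "bounded_nonneg_borel \<phi>" and f: "bounded_nonneg_borel f"
    and V: "mild_solution \<beta> \<phi> f V" and t: "0 < t"
  shows "(\<integral>\<^sup>+w. ennreal (1 - nexp (path_functional (\<lambda>x. ennreal (\<phi> x)) (\<lambda>x. ennreal (f x)) t w)) \<partial>N 0)
    = ennreal (V t 0)"
proof -
  define F where "F = path_functional (\<lambda>x. ennreal (\<phi> x)) (\<lambda>x. ennreal (f x)) t"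
  define \<mu> where "\<mu> = return borel (0::real)"
  have \<mu>: "\<mu> \<in> space MF"
    unfolding \<mu>_def by (auto simp: space_MF intro!: prob_space.finite_measure prob_space_return)
  have setsN: "sets (N x) = sets cluster_space" for x
    using can by (rule canonical_measure_sets)
  have mix: "mixture cluster_space N \<mu> = N 0"
    unfolding \<mu>_def using can by (intro mixture_return setsN) (auto simp: canonical_measure_def)
  have can': "(\<exists>(Q :: path measure measure) \<Xi>. poisson_point_measure Q \<Xi> (N 0)) \<and>
        (\<forall>(Q :: path measure measure) \<Xi>. poisson_point_measure Q \<Xi> (N 0) \<longrightarrow>
           (\<exists>X \<in> Q \<rightarrow>\<^sub>M path_space. distr Q path_space X = P \<mu> \<and>
              (AE \<omega> in Q. \<forall>t>0. X \<omega> t = mixture borel (\<lambda>\<nu>. \<nu> t) (\<Xi> \<omega>))))"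
    using can \<mu> unfolding canonical_measure_def mix[symmetric] by blast
  then obtain Q :: "path measure measure" and \<Xi> where ppm: "poisson_point_measure Q \<Xi> (N 0)" by blast
  then obtain X where X: "X \<in> Q \<rightarrow>\<^sub>M path_space" "distr Q path_space X = P \<mu>"
    and sup: "AE \<omega> in Q. \<forall>t>0. X \<omega> t = mixture borel (\<lambda>\<nu>. \<nu> t) (\<Xi> \<omega>)"
    using can' by blast
  have meas: "(\<lambda>x. ennreal (\<phi> x)) \<in> borel_measurable borel" "(\<lambda>x. ennreal (f x)) \<in> borel_measurable borel"
    using \<phi> f by (auto simp: bounded_nonneg_borel_def)
  have F_path: "F \<in> borel_measurable path_space" and F_cl: "F \<in> borel_measurable cluster_space"
    unfolding F_def using meas t
    by (intro path_space.measurable_path_functional cluster_space.measurable_path_functional; simp)+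
  have F_N: "F \<in> borel_measurable (N 0)"
    using F_cl by (simp only: measurable_cong_sets[OF setsN refl])
  have "nexp (\<integral>\<^sup>+w. ennreal (1 - nexp (F w)) \<partial>N 0) = (\<integral>\<omega>. nexp (\<integral>\<^sup>+w. F w \<partial>\<Xi> \<omega>) \<partial>Q)"
    by (rule poisson_laplace_functional[OF ppm F_N, symmetric])
  also have "\<dots> = (\<integral>\<omega>. nexp (F (X \<omega>)) \<partial>Q)"
  proof (rule integral_cong_AE)
    show "(\<lambda>\<omega>. nexp (\<integral>\<^sup>+w. F w \<partial>\<Xi> \<omega>)) \<in> borel_measurable Q"
      using measurable_nn_integral_of_emeasure[OF poisson_point_measure_sets[OF ppm]
          poisson_point_measure_measurable[OF ppm] F_N] by measurable
    show "(\<lambda>\<omega>. nexp (F (X \<omega>))) \<in> borel_measurable Q"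
      using measurable_compose[OF X(1) F_path] by measurable
    show "AE \<omega> in Q. nexp (\<integral>\<^sup>+w. F w \<partial>\<Xi> \<omega>) = nexp (F (X \<omega>))"
      using sup AE_space
    proof eventually_elim
      case (elim \<omega>)
      then show ?case
        unfolding F_def using path_functional_superposition[OF ppm setsN elim(2) _ meas t, of "X \<omega>"] by simp
    qed
  qed
  also have "\<dots> = (\<integral>w. nexp (F w) \<partial>distr Q path_space X)"
    using measurable_compose[OF F_path borel_measurable_nexp] by (intro integral_distr[symmetric] X(1))
  also have "\<dots> = (\<integral>w. exp (- (\<integral>x. \<phi> x \<partial>w t) - (LINT s:{0..t}|lborel. (\<integral>x. f x \<partial>w s))) \<partial>P \<mu>)"
    unfolding X(2)[symmetric] F_def space_distr
    by (intro Bochner_Integration.integral_cong refl nexp_path_functional[OF _ \<phi> f t]) simp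
  also have "\<dots> = exp (- (\<integral>x. V t x \<partial>\<mu>))"
    using sbm \<mu> \<phi> f V t unfolding super_Brownian_motion_def by simp
  also have "(\<integral>x. V t x \<partial>\<mu>) = V t 0"
  proof -
    have "(\<lambda>(t, x). V t x) \<in> borel_measurable borel" using V by (simp add: mild_solution_def)
    then have "(\<lambda>(t, x). V t x) \<in> borel_measurable (borel \<Otimes>\<^sub>M borel)" by (simp add: borel_prod)
    then have "V t \<in> borel_measurable borel"
      using measurable_Pair2'[of t borel borel] by (auto dest: measurable_compose)
    then show ?thesis unfolding \<mu>_def by (intro integral_return) auto
  qed
  also have "exp (- V t 0) = nexp (ennreal (V t 0))"
  proof -
    have "0 \<le> V t 0" using V t unfolding mild_solution_def by (metis less_imp_le)
    then show ?thesis by (simp only: nexp_ennreal)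
  qed
  finally show ?thesis unfolding F_def by (rule nexp_inj)
qed

section \<open>Explicit mild solutions\<close>

text \<open>The finite exceptional set accommodates the jumps of the second derivative at the ends
  of the caps.\<close>

lemma lborel_integral_FTC_finite:
  fixes F f :: "real \<Rightarrow> real"
  assumes "finite S" "a \<le> b" "continuous_on {a..b} F"
    and F: "\<And>x. a < x \<Longrightarrow> x < b \<Longrightarrow> x \<notin> S \<Longrightarrow> (F has_real_derivative f x) (at x)"
    and f: "integrable lborel (\<lambda>x. f x * indicator {a..b} x)"
  shows "(\<integral>x. f x * indicator {a..b} x \<partial>lborel) = F b - F a"
proof -
  have "(f has_integral (F b - F a)) {a..b}"
    using assms(1,2,3) F
    by (intro fundamental_theorem_of_calculus_interior_strong[of S])
       (auto simp flip: has_real_derivative_iff_has_vector_derivative)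
  then have "((\<lambda>x. if x \<in> {a..b} then f x else 0) has_integral (F b - F a)) UNIV"
    by (simp only: has_integral_restrict_UNIV)
  moreover have "(\<lambda>x. if x \<in> {a..b} then f x else 0) = (\<lambda>x. f x * indicator {a..b} x)"
    by (auto simp: fun_eq_iff)
  ultimately show ?thesis
    using has_integral_integral_lborel[OF f] by (simp add: has_integral_unique)
qed

lemma lborel_integral_deriv_zero:
  fixes F f :: "real \<Rightarrow> real"
  assumes "finite S" "continuous_on UNIV F"
    and F: "\<And>x. x \<notin> S \<Longrightarrow> (F has_real_derivative f x) (at x)"
    and f: "integrable lborel f"
    and lim: "(F \<longlongrightarrow> 0) at_top" "(F \<longlongrightarrow> 0) at_bot"
  shows "(\<integral>x. f x \<partial>lborel) = 0"
proof -
  let ?I = "\<lambda>n::nat. \<integral>x. f x * indicator {- real n..real n} x \<partial>lborel"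
  have "?I \<longlonglongrightarrow> (\<integral>x. f x \<partial>lborel)"
  proof (rule integral_dominated_convergence[where w="\<lambda>x. norm (f x)"])
    show "AE x in lborel. (\<lambda>n. f x * indicator {- real n..real n} x) \<longlonglongrightarrow> f x"
    proof (rule AE_I2)
      fix x :: real
      obtain N :: nat where "\<bar>x\<bar> \<le> N" using real_arch_simple by blast
      then have "eventually (\<lambda>n. f x * indicator {- real n..real n} x = f x) sequentially"
        by (intro eventually_sequentiallyI[of N]) (auto simp: indicator_def)
      then show "(\<lambda>n. f x * indicator {- real n..real n} x) \<longlonglongrightarrow> f x" by (rule tendsto_eventually)
    qed
  qed (use f in \<open>auto simp: indicator_def\<close>)
  moreover have "?I = (\<lambda>n. F (real n) - F (- real n))"
  proof (intro ext lborel_integral_FTC_finite[OF assms(1)] F)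
    fix n :: nat
    show "continuous_on {- real n..real n} F" using assms(2) by (rule continuous_on_subset) simp
    show "integrable lborel (\<lambda>x. f x * indicator {- real n..real n} x)"
      using integrable_mult_indicator[OF _ f, of "{- real n..real n}"] by (simp add: mult.commute)
  qed auto
  moreover have "(\<lambda>n. F (real n) - F (- real n)) \<longlonglongrightarrow> 0 - 0"
    by (intro tendsto_diff filterlim_compose[OF lim(1)] filterlim_compose[OF lim(2)]
        filterlim_real_sequentially filterlim_compose[OF filterlim_uminus_at_bot_at_top])
  ultimately show ?thesis by (simp add: LIMSEQ_unique)
qed

text \<open>The substitution y = x + sqrt s z fixes the Gaussian weight, so that only the argument
  of \<open>g\<close> depends on time, and it covers s = 0 as well.\<close>

lemma heat_semigroup_std:
  assumes "0 \<le> s"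
  shows "heat_semigroup s g x = (\<integral>z. std_normal_density z * g (x + sqrt s * z) \<partial>lborel)"
proof (cases "s = 0")
  case False
  then have s: "0 < s" using assms by simp
  have "(\<integral>y. normal_density x (sqrt s) y * g y \<partial>lborel)
      = \<bar>sqrt s\<bar> *\<^sub>R (\<integral>z. normal_density x (sqrt s) (x + sqrt s * z) * g (x + sqrt s * z) \<partial>lborel)"
    using s by (intro lborel_integral_real_affine) auto
  also have "\<dots> = (\<integral>z. sqrt s * (normal_density x (sqrt s) (x + sqrt s * z) * g (x + sqrt s * z)) \<partial>lborel)"
    using s by (simp add: abs_of_pos)
  also have "\<dots> = (\<integral>z. std_normal_density z * g (x + sqrt s * z) \<partial>lborel)"
  proof (intro Bochner_Integration.integral_cong refl)
    fix z
    have "sqrt s * normal_density x (sqrt s) (x + sqrt s * z) = std_normal_density z"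
      using s by (simp add: normal_density_def real_sqrt_mult power_mult_distrib field_simps)
    then show "sqrt s * (normal_density x (sqrt s) (x + sqrt s * z) * g (x + sqrt s * z)) = std_normal_density z * g (x + sqrt s * z)"
      by (simp add: mult.assoc[symmetric])
  qed
  finally show ?thesis using False by (simp add: heat_semigroup_def)
qed (simp add: heat_semigroup_def)

lemma heat_semigroup_const [simp]: "0 \<le> s \<Longrightarrow> heat_semigroup s (\<lambda>_. c) x = c"
  by (simp add: heat_semigroup_std)

text \<open>Constants are invariant under the heat semigroup, so the equation reduces to V' = -
  V^(1+\<beta>) with V(0) = \<theta>. The solution stays below (\<beta> t)^(-1/\<beta>) for every
  \<theta>: this decay is the quantitative form of extinction.\<close>

lemma mild_solution_const:
  assumes \<beta>: "0 < \<beta>" and \<theta>: "0 < \<theta>"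
  shows "mild_solution \<beta> (\<lambda>_. \<theta>) (\<lambda>_. 0) (\<lambda>t _. (\<theta> powr (- \<beta>) + \<beta> * t) powr (- 1 / \<beta>))"
  unfolding mild_solution_def
proof (intro conjI allI impI)
  let ?V = "\<lambda>t. (\<theta> powr (- \<beta>) + \<beta> * t) powr (- 1 / \<beta>)"
  have \<theta>0: "0 < \<theta> powr (- \<beta>)" using \<theta> by simp
  have "(\<lambda>p::real \<times> real. ?V (fst p)) \<in> borel_measurable (borel \<Otimes>\<^sub>M borel)"
    by measurable
  then show "(\<lambda>(t, x::real). ?V t) \<in> borel_measurable borel"
    by (simp only: case_prod_unfold borel_prod)
  fix t :: real
  show "\<exists>C. \<forall>s\<in>{0..t}. \<forall>x::real. ?V s \<le> C"
  proof (intro exI[of _ "?V 0"] ballI allI)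
    fix s assume "s \<in> {0..t}"
    then show "?V s \<le> ?V 0" using \<beta> \<theta>0
      by (intro powr_mono2') auto
  qed
  fix x :: real
  show "0 \<le> ?V t" by simp
  assume t: "0 \<le> t"
  have V': "((\<lambda>s. ?V (t - s)) has_real_derivative ?V (t - s) powr (1 + \<beta>)) (at s)" if "s \<le> t" for s
  proof -
    have pos: "0 < \<theta> powr (- \<beta>) + \<beta> * (t - s)" using that \<beta> \<theta>0 by (intro add_pos_nonneg) auto
    have "?V (t - s) powr (1 + \<beta>) = (\<theta> powr (- \<beta>) + \<beta> * (t - s)) powr (- 1 / \<beta> - 1)"
    proof -
      have "- 1 / \<beta> * (1 + \<beta>) = - 1 / \<beta> - 1" using \<beta> by (simp add: field_simps)
      then show ?thesis by (simp only: powr_powr)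
    qed
    moreover have "((\<lambda>s. ?V (t - s)) has_real_derivative
        (- 1 / \<beta>) * (\<theta> powr (- \<beta>) + \<beta> * (t - s)) powr (- 1 / \<beta> - 1) * (- \<beta>)) (at s)"
      using pos \<beta> by (auto intro!: derivative_eq_intros simp: field_simps)
    ultimately show ?thesis using \<beta> by simp
  qed
  have "(\<integral>s. ?V (t - s) powr (1 + \<beta>) * indicator {0..t} s \<partial>lborel) = ?V (t - t) - ?V (t - 0)"
  proof (rule integral_FTC_Icc_real[OF t V'])
    fix s assume "0 \<le> s" "s \<le> t"
    have "\<theta> powr (- \<beta>) + \<beta> * (t - s) > 0" using \<open>s \<le> t\<close> \<beta> \<theta>0 by (intro add_pos_nonneg) auto
    then show "isCont (\<lambda>s. ?V (t - s) powr (1 + \<beta>)) s"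
      by (intro continuous_intros) auto
  qed
  also have "(\<integral>s. ?V (t - s) powr (1 + \<beta>) * indicator {0..t} s \<partial>lborel) =
      - (LINT s:{0..t}|lborel. heat_semigroup s (\<lambda>y. 0 - ?V (t - s) powr (1 + \<beta>)) x)"
    unfolding set_lebesgue_integral_def Bochner_Integration.integral_minus[symmetric]
    by (intro Bochner_Integration.integral_cong) (auto simp: indicator_def simp del: diff_0)
  finally show "?V t = heat_semigroup t (\<lambda>_. \<theta>) x +
      (LINT s:{0..t}|lborel. heat_semigroup s (\<lambda>y. 0 - ?V (t - s) powr (1 + \<beta>)) x)"
    using t \<theta> \<beta> by (simp add: powr_powr)
qed

section \<open>Gaussian integration by parts and Duhamel's formula for time-independent
  functions\<close>

lemma integrable_gauss_bounded:
  assumes "h \<in> borel_measurable borel" "\<And>z. \<bar>h z\<bar> \<le> (B::real)"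
  shows "integrable lborel (\<lambda>z. std_normal_density z * h z)"
    and "integrable lborel (\<lambda>z. std_normal_density z * z * h z)"
proof -
  have B: "0 \<le> B" using assms(2)[of 0] by linarith
  show "integrable lborel (\<lambda>z. std_normal_density z * h z)"
  proof (rule Bochner_Integration.integrable_bound)
    show "integrable lborel (\<lambda>z. B * std_normal_density z)" by auto
  qed (use assms B in \<open>auto intro!: AE_I2 simp: abs_mult mult.commute intro: mult_right_mono\<close>)
  show "integrable lborel (\<lambda>z. std_normal_density z * z * h z)"
  proof (rule Bochner_Integration.integrable_bound)
    show "integrable lborel (\<lambda>z. B * (std_normal_density z * \<bar>z\<bar>))"
      using integrable_std_normal_moment_abs[of 1] by auto
  qed (use assms B in \<open>auto intro!: AE_I2 mult_right_mono simp: abs_mult mult.commute[of B] intro!: mult_left_mono\<close>)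
qed

text \<open>Stein's identity: the standard normal density has derivative -z times itself, and
  boundary terms vanish because \<open>W\<close> is bounded.\<close>

lemma gaussian_by_parts:
  assumes S: "finite S" and W: "continuous_on UNIV W" "\<And>x. \<bar>W x\<bar> \<le> B"
    and W': "\<And>x. x \<notin> S \<Longrightarrow> (W has_real_derivative v x) (at x)"
    and v: "v \<in> borel_measurable borel" "\<And>x. \<bar>v x\<bar> \<le> B"
    and u: "0 < u"
  shows "(\<integral>z. std_normal_density z * z * W (x + u * z) \<partial>lborel) =
    (\<integral>z. std_normal_density z * (u * v (x + u * z)) \<partial>lborel)"
proof -
  have Wm: "W \<in> borel_measurable borel" using W(1) by (rule borel_measurable_continuous_onI)
  have i1: "integrable lborel (\<lambda>z. std_normal_density z * z * W (x + u * z))"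
    using Wm W(2) by (intro integrable_gauss_bounded[of _ B]) auto
  have i2: "integrable lborel (\<lambda>z. std_normal_density z * (u * v (x + u * z)))"
    using v u by (intro integrable_gauss_bounded[of _ "u * B"]) (auto simp: abs_mult)
  have d: "(std_normal_density has_real_derivative - (std_normal_density z * z)) (at z)" for z
    unfolding std_normal_density_def[abs_def]
    by (auto intro!: derivative_eq_intros simp: field_simps power2_eq_square)
  have lim: "((\<lambda>z. std_normal_density z * W (x + u * z)) \<longlongrightarrow> 0) F"
    if "F = at_top \<or> F = at_bot" for F
  proof -
    have "((\<lambda>z::real. exp (- z\<^sup>2 / 2)) \<longlongrightarrow> 0) F"
      using that by (elim disjE) (simp only:, real_asymp)+
    then have "((\<lambda>z. B / sqrt (2 * pi) * exp (- z\<^sup>2 / 2)) \<longlongrightarrow> 0) F"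
      by (rule tendsto_mult_right_zero)
    then show ?thesis
    proof (rule Lim_null_comparison[rotated], intro always_eventually allI)
      fix z
      show "norm (std_normal_density z * W (x + u * z)) \<le> B / sqrt (2 * pi) * exp (- z\<^sup>2 / 2)"
        using mult_left_mono[OF W(2)[of "x + u * z"], of "std_normal_density z"]
        by (simp add: abs_mult std_normal_density_def field_simps)
    qed
  qed
  have "(\<integral>z. std_normal_density z * (u * v (x + u * z)) - std_normal_density z * z * W (x + u * z) \<partial>lborel) = 0"
  proof (rule lborel_integral_deriv_zero)
    show "finite ((\<lambda>z. x + u * z) -` S)"
      using S u by (intro finite_vimageI) (auto simp: inj_on_def)
    show "continuous_on UNIV (\<lambda>z. std_normal_density z * W (x + u * z))"
      using DERIV_isCont[OF d] by (intro continuous_on_mult continuous_at_imp_continuous_on ballI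
          continuous_on_compose2[OF W(1)] continuous_intros) auto
    fix z assume "z \<notin> (\<lambda>z. x + u * z) -` S"
    then have "(W has_real_derivative v (x + u * z)) (at (x + u * z))" by (intro W') simp
    then have "((\<lambda>z. W (x + u * z)) has_real_derivative v (x + u * z) * u) (at z)"
      by (rule DERIV_chain2) (auto intro!: derivative_eq_intros)
    from DERIV_mult[OF d this]
    show "((\<lambda>z. std_normal_density z * W (x + u * z)) has_real_derivative
        std_normal_density z * (u * v (x + u * z)) - std_normal_density z * z * W (x + u * z)) (at z)"
      by (simp add: algebra_simps)
  qed (use i1 i2 lim in auto)
  then show ?thesis using i1 i2 by simp
qed

text \<open>Expand V along the segment from x to x + sqrt t z, average over a standard normal z, and
  integrate by parts in z. Parametrizing by u = sqrt s avoids the singular factor 1 / sqrt s that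
  differentiation in time would produce, and needs only a bounded second derivative off finitely
  many points.\<close>

lemma heat_semigroup_duhamel:
  assumes S: "finite S" and V: "continuous_on UNIV V" and W: "continuous_on UNIV W"
    and V': "\<And>x. x \<notin> S \<Longrightarrow> (V has_real_derivative W x) (at x)"
    and W': "\<And>x. x \<notin> S \<Longrightarrow> (W has_real_derivative v x) (at x)"
    and v: "v \<in> borel_measurable borel"
    and B: "\<And>x. \<bar>V x\<bar> \<le> B" "\<And>x. \<bar>W x\<bar> \<le> B" "\<And>x. \<bar>v x\<bar> \<le> B"
    and t: "0 \<le> t"
  shows "V x = heat_semigroup t V x + (LINT s:{0..t}|lborel. heat_semigroup s (\<lambda>y. - v y / 2) x)"
proof -
  let ?i = "\<lambda>u. indicator {0..sqrt t} u"
  let ?\<phi> = "std_normal_density"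
  \<comment> \<open>This is the heat semigroup at time u^2 applied to \<open>v\<close>, evaluated at
    x.\<close>
  define H where "H u = (\<integral>z. ?\<phi> z * v (x + u * z) \<partial>lborel)" for u
  have B0: "0 \<le> B" using B(1)[of 0] by linarith
  have [measurable]: "V \<in> borel_measurable borel" "W \<in> borel_measurable borel"
    using V W by (auto intro: borel_measurable_continuous_onI)
  note [measurable] = v
  have Hm [measurable]: "H \<in> borel_measurable borel"
    unfolding H_def by measurable
  have HB: "\<bar>H u\<bar> \<le> B" for u
  proof -
    have "\<bar>H u\<bar> \<le> (\<integral>z. \<bar>?\<phi> z * v (x + u * z)\<bar> \<partial>lborel)"
      unfolding H_def by (rule integral_abs_bound)
    also have "\<dots> \<le> (\<integral>z. ?\<phi> z * B \<partial>lborel)"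
      using B(3) B0 by (intro integral_mono integrable_abs integrable_gauss_bounded[of _ B])
        (auto simp: abs_mult intro!: mult_left_mono)
    also have "\<dots> = B" by simp
    finally show ?thesis .
  qed
  have FTC: "V (x + sqrt t * z) - V x = (\<integral>u. z * W (x + u * z) * ?i u \<partial>lborel)" for z
  proof (cases "z = 0")
    case False
    have "(\<integral>u. z * W (x + u * z) * ?i u \<partial>lborel) = V (x + sqrt t * z) - V (x + 0 * z)"
    proof (rule lborel_integral_FTC_finite)
      show "finite ((\<lambda>u. x + u * z) -` S)"
        using S False by (intro finite_vimageI) (auto simp: inj_on_def)
      show "continuous_on {0..sqrt t} (\<lambda>u. V (x + u * z))"
        by (intro continuous_on_compose2[OF V] continuous_intros) auto
      fix u assume "u \<notin> (\<lambda>u. x + u * z) -` S"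
      then have "(V has_real_derivative W (x + u * z)) (at (x + u * z))" by (intro V') simp
      then have "((\<lambda>u. V (x + u * z)) has_real_derivative W (x + u * z) * z) (at u)"
        by (rule DERIV_chain2) (auto intro!: derivative_eq_intros)
      then show "((\<lambda>u. V (x + u * z)) has_real_derivative z * W (x + u * z)) (at u)"
        by (simp only: mult.commute)
    next
      show "integrable lborel (\<lambda>u. z * W (x + u * z) * ?i u)"
      proof (rule Bochner_Integration.integrable_bound)
        show "integrable lborel (\<lambda>u. ?i u * (\<bar>z\<bar> * B))"
          using t by (intro integrable_mult_left integrable_real_indicator) auto
      qed (use B(2) B0 in \<open>auto simp: abs_mult indicator_def intro!: AE_I2 mult_left_mono\<close>)
    qed (use t in auto)
    then show ?thesis by simp
  qed simp
  have "(\<integral>z. ?\<phi> z * V (x + sqrt t * z) \<partial>lborel) - V x = (\<integral>z. ?\<phi> z * (V (x + sqrt t * z) - V x) \<partial>lborel)"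
  proof -
    have "integrable lborel (\<lambda>z. ?\<phi> z * V (x + sqrt t * z))"
      using B(1) by (intro integrable_gauss_bounded[of _ B]) auto
    then show ?thesis by (simp add: right_diff_distrib)
  qed
  also have "\<dots> = (\<integral>z. (\<integral>u. ?\<phi> z * z * W (x + u * z) * ?i u \<partial>lborel) \<partial>lborel)"
    unfolding FTC by (simp add: mult.assoc)
  also have "\<dots> = (\<integral>u. (\<integral>z. ?\<phi> z * z * W (x + u * z) * ?i u \<partial>lborel) \<partial>lborel)"
  proof (rule lborel_pair.Fubini_integral[symmetric])
    have dom: "integrable (lborel \<Otimes>\<^sub>M lborel) (\<lambda>(z, u). (?\<phi> z * \<bar>z\<bar> * B) * ?i u)"
    proof (rule lborel_pair.Fubini_integrable)
      have "integrable lborel (\<lambda>z. ?\<phi> z * \<bar>z\<bar> * B * sqrt t)"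
        using integrable_std_normal_moment_abs[of 1] by (intro integrable_mult_left) simp
      then show "integrable lborel (\<lambda>z. \<integral>u. norm (case (z, u) of (z, u) \<Rightarrow> (?\<phi> z * \<bar>z\<bar> * B) * ?i u) \<partial>lborel)"
        using B0 t by (simp add: abs_mult)
      show "AE z in lborel. integrable lborel (\<lambda>u. case (z, u) of (z, u) \<Rightarrow> (?\<phi> z * \<bar>z\<bar> * B) * ?i u)"
        using t by (auto intro!: AE_I2 integrable_mult_right integrable_real_indicator)
    qed measurable
    show "integrable (lborel \<Otimes>\<^sub>M lborel) (\<lambda>(z, u). ?\<phi> z * z * W (x + u * z) * ?i u)"
    proof (rule Bochner_Integration.integrable_bound[OF dom])
      show "AE p in lborel \<Otimes>\<^sub>M lborel. norm (case p of (z, u) \<Rightarrow> ?\<phi> z * z * W (x + u * z) * ?i u)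
          \<le> norm (case p of (z, u) \<Rightarrow> (?\<phi> z * \<bar>z\<bar> * B) * ?i u)"
        using B(2) B0 by (auto intro!: AE_I2 simp: abs_mult indicator_def intro!: mult_left_mono)
    qed measurable
  qed
  \<comment> \<open>Stein's identity turns z W into u v. The factor u is written as 2 u / 2 in
    preparation for the substitution s = u^2; it applies for u > 0, which leaves out a null
    set.\<close>
  also have "\<dots> = (\<integral>u. H u / 2 * (2 * u) * ?i u \<partial>lborel)"
  proof (rule integral_cong_AE)
    show "AE u in lborel. (\<integral>z. ?\<phi> z * z * W (x + u * z) * ?i u \<partial>lborel) = H u / 2 * (2 * u) * ?i u"
      using AE_lborel_singleton[of 0]
    proof eventually_elim
      case (elim u)
      show ?case
      proof (cases "u \<in> {0..sqrt t}")
        case True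
        then have "0 < u" using elim by auto
        from gaussian_by_parts[OF S W B(2) W' v B(3) this, of x]
        have "(\<integral>z. ?\<phi> z * z * W (x + u * z) \<partial>lborel) = (\<integral>z. ?\<phi> z * v (x + u * z) * u \<partial>lborel)"
          by (simp add: ac_simps)
        then show ?thesis using True by (simp add: H_def)
      qed simp
    qed
  qed measurable
  also have "\<dots> = (\<integral>s. H (sqrt s) / 2 * indicator {0..t} s \<partial>lborel)"
  proof -
    have "(\<integral>s. H (sqrt s) / 2 * indicator {0\<^sup>2..(sqrt t)\<^sup>2} s \<partial>lborel) =
        (\<integral>u. H (sqrt (u\<^sup>2)) / 2 * (2 * u) * ?i u \<partial>lborel)"
    proof (rule integral_substitution)
      show "set_integrable lborel {0\<^sup>2..(sqrt t)\<^sup>2} (\<lambda>s. H (sqrt s) / 2)"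
        unfolding set_integrable_def
      proof (rule Bochner_Integration.integrable_bound)
        show "integrable lborel (\<lambda>s. indicator {0..t} s * B)"
          using t by (intro integrable_mult_left integrable_real_indicator) auto
        have "\<bar>H u\<bar> \<le> B * 2" for u using HB[of u] B0 by linarith
        then show "AE s in lborel. norm (indicator {0\<^sup>2..(sqrt t)\<^sup>2} s *\<^sub>R (H (sqrt s) / 2)) \<le> norm (indicator {0..t} s * B)"
          using t B0 by (auto intro!: AE_I2 simp: indicator_def)
      qed measurable
    qed (use t in \<open>auto intro!: derivative_eq_intros continuous_intros\<close>)
    also have "\<dots> = (\<integral>u. H u / 2 * (2 * u) * ?i u \<partial>lborel)"
      by (intro Bochner_Integration.integral_cong) (auto simp: indicator_def)
    finally show ?thesis using t by simp
  qed
  also have "\<dots> = - (LINT s:{0..t}|lborel. heat_semigroup s (\<lambda>y. - v y / 2) x)"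
    unfolding set_lebesgue_integral_def Bochner_Integration.integral_minus[symmetric]
    by (intro Bochner_Integration.integral_cong) (auto simp: indicator_def heat_semigroup_std H_def)
  finally show ?thesis using t by (simp add: heat_semigroup_std)
qed

text \<open>\<open>W\<close> and \<open>v\<close> are V' and V'', and \<open>S\<close> collects the
  corners of \<open>W\<close>. The equation is read backwards: V is prescribed, the source is
  whatever is left over, and only its sign has to be checked.\<close>

locale stationary =
  fixes \<beta> :: real and S :: "real set" and V W v :: "real \<Rightarrow> real" and B :: real
  assumes S: "finite S" and V: "continuous_on UNIV V" and W: "continuous_on UNIV W"
    and V': "\<And>x. x \<notin> S \<Longrightarrow> (V has_real_derivative W x) (at x)"
    and W': "\<And>x. x \<notin> S \<Longrightarrow> (W has_real_derivative v x) (at x)"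
    and v: "v \<in> borel_measurable borel"
    and B: "\<And>x. \<bar>V x\<bar> \<le> B" "\<And>x. \<bar>W x\<bar> \<le> B" "\<And>x. \<bar>v x\<bar> \<le> B"
    and V_nonneg: "\<And>x. 0 \<le> V x"
    and source_nonneg: "\<And>x. v x / 2 \<le> V x powr (1 + \<beta>)"
    and \<beta>: "0 < \<beta>"
begin

definition source :: "real \<Rightarrow> real" where
  "source x = V x powr (1 + \<beta>) - v x / 2"

lemma bounded_V: "bounded_nonneg_borel V"
  using V V_nonneg B(1) unfolding bounded_nonneg_borel_def bounded_iff
  by (auto intro: borel_measurable_continuous_onI)

lemma bounded_source: "bounded_nonneg_borel source"
  unfolding bounded_nonneg_borel_def
proof (intro conjI allI)
  have "V \<in> borel_measurable borel" using V by (rule borel_measurable_continuous_onI)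
  then show "source \<in> borel_measurable borel" unfolding source_def[abs_def] using v by measurable
  show "0 \<le> source x" for x using source_nonneg[of x] by (simp add: source_def)
  have "\<bar>source x\<bar> \<le> B powr (1 + \<beta>) + B" for x
  proof -
    have "V x powr (1 + \<beta>) \<le> B powr (1 + \<beta>)"
      using B(1)[of x] V_nonneg[of x] \<beta> by (intro powr_mono2) auto
    then show ?thesis using B(3)[of x] powr_ge_zero[of "V x" "1 + \<beta>"] unfolding source_def by linarith
  qed
  then show "bounded (range source)" unfolding bounded_iff by auto
qed

text \<open>Taking V itself as initial condition keeps the solution constant in time, and Duhamel's
  formula is then the mild equation.\<close>

lemma mild_solution_stationary: "mild_solution \<beta> V source (\<lambda>_. V)"
  unfolding mild_solution_def
proof (intro conjI allI impI)
  have "V \<in> borel_measurable borel" using V by (rule borel_measurable_continuous_onI)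
  then have "(\<lambda>p::real \<times> real. V (snd p)) \<in> borel_measurable (borel \<Otimes>\<^sub>M borel)" by measurable
  then show "(\<lambda>(t::real, x). V x) \<in> borel_measurable borel"
    by (simp only: case_prod_unfold borel_prod)
  show "\<exists>C. \<forall>t\<in>{0..T}. \<forall>x. V x \<le> C" for T :: real
    using B(1) abs_le_D1 by blast
  show "V x = heat_semigroup t V x + (LINT s:{0..t}|lborel. heat_semigroup s (\<lambda>y. source y - V y powr (1 + \<beta>)) x)"
    if "0 \<le> t" for t x
    using heat_semigroup_duhamel[OF S V W V' W' v B that, of x] by (simp add: source_def)
qed (rule V_nonneg)

end

section \<open>Extinction of clusters and the Laplace functional of the total occupation\<close>

lemma nn_integral_LIMSEQ_space:
  assumes "\<And>i. f i \<in> borel_measurable M" "\<And>x. x \<in> space M \<Longrightarrow> incseq (\<lambda>i. f i x)"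
    and "\<And>x. x \<in> space M \<Longrightarrow> (\<lambda>i. f i x) \<longlonglongrightarrow> u x"
  shows "(\<lambda>i. \<integral>\<^sup>+x. f i x \<partial>M) \<longlonglongrightarrow> (\<integral>\<^sup>+x. u x \<partial>M)"
proof -
  have "(\<lambda>i. \<integral>\<^sup>+x. (if x \<in> space M then f i x else 0) \<partial>M) \<longlonglongrightarrow> (\<integral>\<^sup>+x. (if x \<in> space M then u x else 0) \<partial>M)"
    using assms by (intro nn_integral_LIMSEQ) (auto simp: incseq_def le_fun_def)
  then show ?thesis by (simp cong: nn_integral_cong)
qed

lemma cluster_survival_laplace:
  assumes "super_Brownian_motion \<beta> P" "canonical_measure P N" "0 < \<beta>" "0 < \<theta>" "0 < t"
  shows "(\<integral>\<^sup>+w. ennreal (1 - nexp (\<integral>\<^sup>+x. ennreal \<theta> \<partial>w t)) \<partial>N 0) = ennreal ((\<theta> powr (- \<beta>) + \<beta> * t) powr (- 1 / \<beta>))"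
proof -
  have "bounded_nonneg_borel (\<lambda>_. \<theta>)" "bounded_nonneg_borel (\<lambda>_. 0)"
    using assms(4) by (auto simp: bounded_nonneg_borel_def)
  from cluster_laplace[OF assms(1,2) this mild_solution_const[OF assms(3,4)] assms(5)]
  show ?thesis by (simp add: path_functional_def)
qed

text \<open>At each finite time the exponent of occupation plus terminal term equals V(0). The
  occupation part alone lies below V(0), by at most the exponent of the terminal term; since V is
  bounded, the latter is controlled by a constant initial condition and vanishes as time
  grows.\<close>

lemma (in stationary) total_occupation_laplace:
  assumes sbm: "super_Brownian_motion \<beta> P" and can: "canonical_measure P N"
  shows "(\<integral>\<^sup>+w. ennreal (1 - nexp (\<integral>\<^sup>+s\<in>{0<..}. (\<integral>\<^sup>+x. ennreal (source x) \<partial>w s) \<partial>lborel)) \<partial>N 0) = ennreal (V 0)"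
proof -
  define I where "I T w = (\<integral>\<^sup>+s\<in>T. (\<integral>\<^sup>+x. ennreal (source x) \<partial>w s) \<partial>lborel)" for T and w :: path
  define E where "E t w = (\<integral>\<^sup>+x. ennreal (V x) \<partial>w t)" for t and w :: path
  note setsN = canonical_measure_sets[OF can]
  have sm: "(\<lambda>x. ennreal (source x)) \<in> borel_measurable borel" "(\<lambda>x. ennreal (V x)) \<in> borel_measurable borel"
    using bounded_source bounded_V by (auto simp: bounded_nonneg_borel_def)
  have Im [measurable]: "I T \<in> borel_measurable (N 0)" if "T \<in> sets borel" "T \<subseteq> {0<..}" for T
    unfolding measurable_cong_sets[OF setsN refl] I_def[abs_def]
    using sm that by (intro cluster_space.measurable_time_integral)
  have Em [measurable]: "E t \<in> borel_measurable (N 0)" if "0 < t" for t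
    unfolding measurable_cong_sets[OF setsN refl] E_def[abs_def]
    using sm that by (intro cluster_space.measurable_nn_integral_eval) auto
  define a where "a n = (\<integral>\<^sup>+w. ennreal (1 - nexp (I {0<..real (Suc n)} w)) \<partial>N 0)" for n
  \<comment> \<open>The constant solution started from \<theta> = B + 1; adding 1 makes \<theta>
    positive even if B = 0.\<close>
  define r where "r n = ((B + 1) powr (- \<beta>) + \<beta> * real (Suc n)) powr (- 1 / \<beta>)" for n
  have B0: "0 \<le> B" using B(1)[of 0] by linarith
  have V0: "ennreal (V 0) = (\<integral>\<^sup>+w. ennreal (1 - nexp (E t w + I {0<..t} w)) \<partial>N 0)" if "0 < t" for t
    using cluster_laplace[OF sbm can bounded_V bounded_source mild_solution_stationary that]
    by (simp add: path_functional_def E_def I_def)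
  have Im' [measurable]: "I {0<..real (Suc n)} \<in> borel_measurable (N 0)" for n by (rule Im) auto
  have "a \<longlonglongrightarrow> (\<integral>\<^sup>+w. ennreal (1 - nexp (I {0<..} w)) \<partial>N 0)"
    unfolding a_def
  proof (rule nn_integral_LIMSEQ_space)
    show "incseq (\<lambda>n. ennreal (1 - nexp (I {0<..real (Suc n)} w)))" for w
      unfolding I_def incseq_def
      by (auto intro!: ennreal_leI nexp_mono nn_integral_mono mult_left_mono simp: indicator_def)
    fix w assume "w \<in> space (N 0)"
    then have w: "w \<in> space cluster_space" using sets_eq_imp_space_eq[OF setsN] by simp
    have "(\<lambda>n. I {0<..real (Suc n)} w) \<longlonglongrightarrow> I {0<..} w"
      unfolding I_def
    proof (rule nn_integral_LIMSEQ)
      show "incseq (\<lambda>n s. (\<integral>\<^sup>+x. ennreal (source x) \<partial>w s) * indicator {0<..real (Suc n)} s)"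
        by (auto simp: incseq_def le_fun_def indicator_def)
      show "(\<lambda>s. (\<integral>\<^sup>+x. ennreal (source x) \<partial>w s) * indicator {0<..real (Suc n)} s) \<in> borel_measurable lborel" for n
        using sm by (intro cluster_space.measurable_in_time[OF w]) auto
      fix s :: real
      obtain N :: nat where N: "s \<le> N" using real_arch_simple by blast
      show "(\<lambda>n. (\<integral>\<^sup>+x. ennreal (source x) \<partial>w s) * indicator {0<..real (Suc n)} s)
          \<longlonglongrightarrow> (\<integral>\<^sup>+x. ennreal (source x) \<partial>w s) * indicator {0<..} s"
        using N by (intro tendsto_eventually eventually_sequentiallyI[of N]) (auto simp: indicator_def)
    qed
    then show "(\<lambda>n. ennreal (1 - nexp (I {0<..real (Suc n)} w))) \<longlonglongrightarrow> ennreal (1 - nexp (I {0<..} w))"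
      by (intro tendsto_intros)
  qed measurable
  moreover have "ennreal (V 0) \<le> a n + ennreal (r n)" for n
  proof -
    define R where "R w = (\<integral>\<^sup>+x. ennreal (B + 1) \<partial>w (real (Suc n)))" for w :: path
    have [measurable]: "R \<in> borel_measurable (N 0)"
      unfolding measurable_cong_sets[OF setsN refl] R_def[abs_def]
      by (intro cluster_space.measurable_nn_integral_eval) auto
    \<comment> \<open>1 - x y \<le> (1 - x) + (1 - y) on [0, 1] separates occupation and terminal
      mass.\<close>
    have sub: "1 - nexp (E (real (Suc n)) w + i) \<le> (1 - nexp i) + (1 - nexp (R w))" for i and w
    proof -
      have "E (real (Suc n)) w \<le> R w"
        unfolding E_def R_def using B(1) by (intro nn_integral_mono ennreal_leI) (simp add: abs_le_iff add_increasing2)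
      then have "nexp (R w) \<le> nexp (E (real (Suc n)) w)" by (rule nexp_mono)
      then have "nexp i * nexp (R w) \<le> nexp (E (real (Suc n)) w + i)"
        by (simp add: nexp_add mult.commute mult_left_mono)
      moreover have "0 \<le> (1 - nexp i) * (1 - nexp (R w))" by (intro mult_nonneg_nonneg) auto
      ultimately show ?thesis by (simp add: algebra_simps)
    qed
    have "ennreal (V 0) \<le> (\<integral>\<^sup>+w. ennreal (1 - nexp (I {0<..real (Suc n)} w)) + ennreal (1 - nexp (R w)) \<partial>N 0)"
      unfolding V0[OF of_nat_0_less_iff[THEN iffD2, OF zero_less_Suc[of n]]]
      by (intro nn_integral_mono, subst ennreal_plus[symmetric]) (simp_all only: diff_ge_0_iff_ge nexp_le_1 ennreal_leI sub)
    also have "\<dots> = a n + (\<integral>\<^sup>+w. ennreal (1 - nexp (R w)) \<partial>N 0)"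
      unfolding a_def by (intro nn_integral_add) measurable
    also have "(\<integral>\<^sup>+w. ennreal (1 - nexp (R w)) \<partial>N 0) = ennreal (r n)"
      unfolding R_def r_def using B0 \<beta> by (intro cluster_survival_laplace[OF sbm can]) auto
    finally show ?thesis .
  qed
  moreover have "a n \<le> ennreal (V 0)" for n
    unfolding a_def V0[OF of_nat_0_less_iff[THEN iffD2, OF zero_less_Suc[of n]]]
    by (intro nn_integral_mono ennreal_leI diff_left_mono nexp_mono) simp
  moreover have "r \<longlonglongrightarrow> 0"
    unfolding r_def
  proof (rule tendsto_neg_powr)
    show "filterlim (\<lambda>n. (B + 1) powr (- \<beta>) + \<beta> * real (Suc n)) at_top sequentially"
      using \<beta> by real_asymp
  qed (use \<beta> in auto)
  ultimately show ?thesis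
  proof -
    assume a: "a \<longlonglongrightarrow> (\<integral>\<^sup>+w. ennreal (1 - nexp (I {0<..} w)) \<partial>N 0)"
      and up: "\<And>n. ennreal (V 0) \<le> a n + ennreal (r n)" and lo: "\<And>n. a n \<le> ennreal (V 0)"
      and r: "r \<longlonglongrightarrow> 0"
    have "(\<lambda>n. a n + ennreal (r n)) \<longlonglongrightarrow> (\<integral>\<^sup>+w. ennreal (1 - nexp (I {0<..} w)) \<partial>N 0) + ennreal 0"
      by (intro tendsto_add a tendsto_ennrealI r)
    from LIMSEQ_le_const[OF this, of "ennreal (V 0)"] LIMSEQ_le_const2[OF a, of "ennreal (V 0)"] up lo
    show ?thesis unfolding I_def by (intro antisym) auto
  qed
qed

section \<open>Stationary solutions with concentrated sources\<close>

lemma DERIV_max_const [derivative_intros]: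
  fixes f :: "real \<Rightarrow> real"
  assumes "(f has_real_derivative f') (at x)" "f x \<noteq> c"
  shows "((\<lambda>x. max c (f x)) has_real_derivative (if c < f x then f' else 0)) (at x)"
proof -
  have "((\<lambda>y. max c y) has_real_derivative (if c < y then 1 else 0)) (at y)" if "y \<noteq> c" for y :: real
  proof (cases "c < y")
    case True
    have "((\<lambda>y. y) has_real_derivative 1) (at y)" by (rule DERIV_ident)
    then have "((\<lambda>y. max c y) has_real_derivative 1) (at y)"
      by (rule has_field_derivative_transform_within_open[of _ _ _ "{c<..}"]) (use True in auto)
    then show ?thesis using True by simp
  next
    case False
    have "((\<lambda>y. c) has_real_derivative 0) (at y)" by (rule DERIV_const)
    then have "((\<lambda>y. max c y) has_real_derivative 0) (at y)"
      by (rule has_field_derivative_transform_within_open[of _ _ _ "{..<c}"]) (use False that in auto)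
    then show ?thesis using False by simp
  qed
  from DERIV_chain2[OF this[OF assms(2)] assms(1)] show ?thesis by (auto split: if_splits)
qed

lemma DERIV_min_const [derivative_intros]:
  fixes f :: "real \<Rightarrow> real"
  assumes "(f has_real_derivative f') (at x)" "f x \<noteq> c"
  shows "((\<lambda>x. min c (f x)) has_real_derivative (if f x < c then f' else 0)) (at x)"
proof -
  have "((\<lambda>x. - max (- c) (- f x)) has_real_derivative - (if - c < - f x then - f' else 0)) (at x)"
    using assms by (intro DERIV_minus DERIV_max_const) auto
  moreover have "(\<lambda>x. - max (- c) (- f x)) = (\<lambda>x. min c (f x))" by (auto simp: max_def min_def)
  ultimately show ?thesis by (simp split: if_splits)
qed

text \<open>At the corner the difference quotient of the squared positive part is
  \<open>max 0 h\<close>, which tends to 0. Unlike the positive part itself, its square has a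
  derivative everywhere, so caps can be glued from such squares.\<close>

lemma DERIV_max_0_square:
  fixes f :: "real \<Rightarrow> real"
  assumes "(f has_real_derivative f') (at x)"
  shows "((\<lambda>x. (max 0 (f x))\<^sup>2) has_real_derivative 2 * max 0 (f x) * f') (at x)"
proof -
  have "((\<lambda>y. (max 0 y)\<^sup>2) has_real_derivative 2 * max 0 y) (at y)" for y :: real
  proof (cases "y = 0")
    case True
    have "isCont (\<lambda>h. max 0 h) (0::real)" by (intro continuous_intros)
    then have "((\<lambda>h. max 0 h) \<longlongrightarrow> (0::real)) (at 0)" by (simp add: isCont_def)
    then have "((\<lambda>h::real. ((max 0 (0 + h))\<^sup>2 - (max 0 0)\<^sup>2) / h) \<longlongrightarrow> 0) (at 0)"
      by (rule Lim_transform_eventually)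
         (auto simp: eventually_at_filter max_def power2_eq_square)
    then show ?thesis using True by (simp add: DERIV_def)
  next
    case False
    then show ?thesis by (auto intro!: derivative_eq_intros)
  qed
  from DERIV_chain2[OF this assms] show ?thesis .
qed

text \<open>The amplitude A for which A x^(-2/\<beta>) solves U''/2 = U^(1+\<beta>) on x > 0:
  comparing coefficients gives A^\<beta> = (1/\<beta>)(2/\<beta> + 1).\<close>

definition amp :: "real \<Rightarrow> real" where
  "amp \<beta> = ((2 + \<beta>) / \<beta>\<^sup>2) powr (1 / \<beta>)"

text \<open>For \<open>\<eta> = 0\<close> the profile solves \<open>U'' / 2 = U powr (1 + \<beta>)\<close> on the half line. The concave
  term with \<open>\<eta> > 0\<close> adds a source that is positive on the whole line.\<close>

locale profile =
  fixes \<beta> k \<eta> :: real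
  assumes \<beta>: "0 < \<beta>" and k: "0 < k" and \<eta>: "0 \<le> \<eta>"
begin

definition U :: "real \<Rightarrow> real" where
  "U x = amp \<beta> * (x + k) powr (- 2 / \<beta>)"

definition U1 :: "real \<Rightarrow> real" where
  "U1 x = - (2 / \<beta>) * amp \<beta> * (x + k) powr (- 2 / \<beta> - 1)"

definition E :: "real \<Rightarrow> real" where
  "E x = U x + \<eta> - \<eta> / (1 + x)"

definition E1 :: "real \<Rightarrow> real" where
  "E1 x = U1 x + \<eta> / (1 + x)\<^sup>2"

definition E2 :: "real \<Rightarrow> real" where
  "E2 x = 2 * U x powr (1 + \<beta>) - 2 * \<eta> / (1 + x) ^ 3"

lemma amp_pos: "0 < amp \<beta>"
  using \<beta> by (simp add: amp_def)

lemma coeff_pos: "0 < 2 / \<beta> * amp \<beta>"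
  using amp_pos \<beta> by simp

lemma U_pos: "0 \<le> x \<Longrightarrow> 0 < U x"
  using amp_pos k by (simp add: U_def)

lemma U_powr: "0 \<le> x \<Longrightarrow> 2 * U x powr (1 + \<beta>) = (2 / \<beta>) * (2 / \<beta> + 1) * amp \<beta> * (x + k) powr (- 2 / \<beta> - 2)"
proof -
  assume x: "0 \<le> x"
  have "amp \<beta> powr \<beta> = (2 + \<beta>) / \<beta>\<^sup>2"
    using \<beta> by (simp add: amp_def powr_powr)
  then have "amp \<beta> powr (1 + \<beta>) = amp \<beta> * ((2 + \<beta>) / \<beta>\<^sup>2)"
    using amp_pos by (simp add: powr_add)
  moreover have "- 2 / \<beta> * (1 + \<beta>) = - 2 / \<beta> - 2" using \<beta> by (simp add: field_simps)
  then have "((x + k) powr (- 2 / \<beta>)) powr (1 + \<beta>) = (x + k) powr (- 2 / \<beta> - 2)"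
    by (simp only: powr_powr)
  ultimately have "U x powr (1 + \<beta>) = amp \<beta> * ((2 + \<beta>) / \<beta>\<^sup>2) * (x + k) powr (- 2 / \<beta> - 2)"
    using amp_pos by (simp add: U_def powr_mult)
  then show ?thesis using \<beta> by (simp add: field_simps power2_eq_square)
qed

lemma DERIV_U: "0 \<le> x \<Longrightarrow> (U has_real_derivative U1 x) (at x)"
  unfolding U_def[abs_def] U1_def using k by (auto intro!: derivative_eq_intros)

lemma DERIV_E: "0 \<le> x \<Longrightarrow> (E has_real_derivative E1 x) (at x)"
  unfolding E_def[abs_def] E1_def
  by (auto intro!: derivative_eq_intros DERIV_U simp: power2_eq_square)

lemma DERIV_E1: "0 \<le> x \<Longrightarrow> (E1 has_real_derivative E2 x) (at x)"
proof -
  assume x: "0 \<le> x"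
  have "(U1 has_real_derivative 2 * U x powr (1 + \<beta>)) (at x)"
  proof -
    have "(U1 has_real_derivative - (2 / \<beta>) * amp \<beta> * ((- 2 / \<beta> - 1) * (x + k) powr (- 2 / \<beta> - 1 - 1))) (at x)"
      unfolding U1_def[abs_def] using x k \<beta> by (auto intro!: derivative_eq_intros)
    moreover have "- (2 / \<beta>) * amp \<beta> * ((- 2 / \<beta> - 1) * (x + k) powr (- 2 / \<beta> - 1 - 1)) = 2 * U x powr (1 + \<beta>)"
      unfolding U_powr[OF x] by (simp add: algebra_simps)
    ultimately show ?thesis by simp
  qed
  moreover have "((\<lambda>x. \<eta> / (1 + x)\<^sup>2) has_real_derivative - 2 * \<eta> / (1 + x) ^ 3) (at x)"
  proof -
    have *: "((\<lambda>x. \<eta> / (1 + x)\<^sup>2) has_real_derivative - (\<eta> * (2 * (1 + x))) / ((1 + x)\<^sup>2 * (1 + x)\<^sup>2)) (at x)"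
      using x by (auto intro!: derivative_eq_intros)
    have eq: "- (\<eta> * (2 * y)) / (y\<^sup>2 * y\<^sup>2) = - 2 * \<eta> / y ^ 3" if "y \<noteq> 0" for y :: real
      using that by (simp add: field_simps power2_eq_square power3_eq_cube)
    have "- (\<eta> * (2 * (1 + x))) / ((1 + x)\<^sup>2 * (1 + x)\<^sup>2) = - 2 * \<eta> / (1 + x) ^ 3"
      by (rule eq) (use x in simp)
    with * show ?thesis by (simp only:)
  qed
  ultimately show ?thesis
    using DERIV_add unfolding E1_def[abs_def] E2_def by fastforce
qed

lemma E_ge_U: "0 \<le> x \<Longrightarrow> U x \<le> E x"
  using \<eta> by (simp add: E_def field_simps mult_left_mono)

lemma E_le: "0 \<le> x \<Longrightarrow> E x \<le> U 0 + \<eta>"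
proof -
  assume x: "0 \<le> x"
  have "U x \<le> U 0"
    unfolding U_def using x k \<beta> amp_pos by (intro mult_left_mono powr_mono2') auto
  moreover have "0 \<le> \<eta> / (1 + x)" using x \<eta> by simp
  ultimately show ?thesis by (simp add: E_def)
qed

text \<open>The source left over by the profile. Since E \<ge> U, the power of E covers the convex
  part of E''/2, and the concave part remains as a gain.\<close>

lemma E2_le: "0 \<le> x \<Longrightarrow> \<eta> / (1 + x) ^ 3 \<le> E x powr (1 + \<beta>) - E2 x / 2"
  using powr_mono2[of "1 + \<beta>" "U x" "E x"] E_ge_U[of x] U_pos[of x] \<beta> by (simp add: E2_def diff_divide_distrib)

lemma E1_bound: "0 \<le> x \<Longrightarrow> \<bar>E1 x\<bar> \<le> \<bar>U1 0\<bar> + \<eta>"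
proof -
  assume x: "0 \<le> x"
  have "(x + k) powr (- 2 / \<beta> - 1) \<le> (0 + k) powr (- 2 / \<beta> - 1)"
    using x k \<beta> by (intro powr_mono2') (auto simp: field_simps)
  then have "\<bar>U1 x\<bar> \<le> \<bar>U1 0\<bar>"
    using mult_left_mono[of _ _ "2 / \<beta> * amp \<beta>"] coeff_pos amp_pos \<beta>
    unfolding U1_def mult_minus_left abs_minus_cancel by (simp add: abs_mult)
  moreover have "\<bar>\<eta> / (1 + x)\<^sup>2\<bar> \<le> \<eta>"
    using x \<eta> by (simp add: divide_le_eq mult_left_mono mult_right_mono one_le_power mult_le_cancel_left1)
  ultimately show ?thesis unfolding E1_def by linarith
qed

lemma E2_bound: "0 \<le> x \<Longrightarrow> \<bar>E2 x\<bar> \<le> 2 * U 0 powr (1 + \<beta>) + 2 * \<eta>"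
proof -
  assume x: "0 \<le> x"
  have "U x \<le> U 0"
    unfolding U_def using x k \<beta> amp_pos by (intro mult_left_mono powr_mono2') auto
  then have "U x powr (1 + \<beta>) \<le> U 0 powr (1 + \<beta>)"
    using U_pos[OF x] \<beta> by (intro powr_mono2) auto
  moreover have "\<bar>2 * \<eta> / (1 + x) ^ 3\<bar> \<le> 2 * \<eta>"
    using x \<eta> by (simp add: divide_le_eq mult_le_cancel_left1 one_le_power)
  ultimately show ?thesis unfolding E2_def using powr_ge_zero[of "U x" "1 + \<beta>"] by linarith
qed

text \<open>Convexity of U puts its tangent at e below U(0) when extrapolated back to 0; the concave
  term costs at most \<eta> e. This bounds the height of the caps.\<close>

lemma tangent_le: "0 \<le> e \<Longrightarrow> E e - e * E1 e \<le> U 0 + \<eta> * e"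
proof -
  assume e: "0 \<le> e"
  have "U e - e * U1 e \<le> U 0"
  proof (cases "e = 0")
    case False
    then obtain z where z: "0 < z" "z < e" "U e - U 0 = (e - 0) * U1 z"
      using MVT2[of 0 e U U1] DERIV_U e by auto
    have "(e + k) powr (- 2 / \<beta> - 1) \<le> (z + k) powr (- 2 / \<beta> - 1)"
      using z k \<beta> by (intro powr_mono2') (auto simp: field_simps)
    then have "U1 z \<le> U1 e"
      using mult_left_mono[of _ _ "2 / \<beta> * amp \<beta>"] coeff_pos
    unfolding U1_def mult_minus_left neg_le_iff_le by simp
    then have "e * U1 z \<le> e * U1 e" using e by (rule mult_left_mono)
    then show ?thesis using z(3) by simp
  qed simp
  moreover have "\<eta> - \<eta> / (1 + e) \<le> \<eta> * e"
    using e \<eta> by (simp add: field_simps)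
  moreover have "0 \<le> e * (\<eta> / (1 + e)\<^sup>2)" using e \<eta> by simp
  ultimately show ?thesis unfolding E_def E1_def by (simp add: algebra_simps)
qed

end

text \<open>The curvatures of the cap provide constant sources \<open>p\<close> on |x| < e and
  \<open>q\<close> on |x| < d, of masses 2 p e and 2 q d. Two nested intervals are allowed so that
  one solution controls two windows jointly.\<close>

locale cap = profile +
  fixes e d p q :: real
  assumes d: "0 < d" "d \<le> e" and pq: "0 \<le> p" "0 \<le> q"
    and slope: "2 * p * e + 2 * q * d = - E1 e"
begin

text \<open>On \<open>\<bar>x\<bar> < e\<close> the profile is replaced by a cap made of parabolas; \<open>slope\<close> makes the
  derivative continuous at \<open>\<bar>x\<bar> = e\<close>.\<close>

definition clamp :: "real \<Rightarrow> real \<Rightarrow> real" where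
  "clamp a x = max (- a) (min a x)"

text \<open>One formula for all x: \<open>max e\<close> freezes the profile inside and
  \<open>clamp e\<close> freezes the cap outside. In the bracket of \<open>q\<close>, the terms in
  \<open>clamp e x\<close> form a parabola on |x| \<le> d, continued linearly with matching slope up
  to e.\<close>

definition V :: "real \<Rightarrow> real" where
  "V x = E (max e x) + E (max e (- x)) - E e + p * (e\<^sup>2 - (clamp e x)\<^sup>2)
    + q * (2 * d * e - d\<^sup>2 - (clamp e x)\<^sup>2 + (max 0 (clamp e x - d))\<^sup>2 + (max 0 (- clamp e x - d))\<^sup>2)"

definition W :: "real \<Rightarrow> real" where
  "W x = E1 (max e x) - E1 (max e (- x)) - 2 * p * clamp e x - 2 * q * clamp d x"

definition v :: "real \<Rightarrow> real" where
  "v x = (if \<bar>x\<bar> < e then - 2 * p - (if \<bar>x\<bar> < d then 2 * q else 0) else E2 \<bar>x\<bar>)"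

lemma e: "0 < e" using d by simp

lemma clamp_simps:
  assumes "0 < a"
  shows "\<bar>x\<bar> \<le> a \<Longrightarrow> clamp a x = x" "a \<le> x \<Longrightarrow> clamp a x = a" "x \<le> - a \<Longrightarrow> clamp a x = - a"
    and "\<bar>clamp a x\<bar> \<le> a"
  using assms by (auto simp: clamp_def)

lemma V_outside: "e \<le> \<bar>x\<bar> \<Longrightarrow> V x = E \<bar>x\<bar>"
proof -
  assume x: "e \<le> \<bar>x\<bar>"
  have "(clamp e x)\<^sup>2 = e\<^sup>2" "(max 0 (clamp e x - d))\<^sup>2 + (max 0 (- clamp e x - d))\<^sup>2 = (e - d)\<^sup>2"
    using x e d by (cases "0 \<le> x"; simp add: clamp_simps)+
  moreover have "E (max e x) + E (max e (- x)) - E e = E \<bar>x\<bar>"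
    using x e by (cases "0 \<le> x") (auto simp: max_absorb1 max_absorb2)
  ultimately show "V x = E \<bar>x\<bar>"
    by (simp add: V_def power2_eq_square algebra_simps)
qed

lemma W_outside: "e \<le> \<bar>x\<bar> \<Longrightarrow> W x = sgn x * E1 \<bar>x\<bar>"
proof -
  assume x: "e \<le> \<bar>x\<bar>"
  then show ?thesis
  proof (cases "0 \<le> x")
    case True
    then have "e \<le> x" "d \<le> x" using x d by auto
    then show ?thesis using slope e d by (simp add: W_def clamp_simps max_absorb1 max_absorb2)
  next
    case False
    then have "x \<le> - e" "x \<le> - d" using x d by auto
    then show ?thesis using slope e d False by (simp add: W_def clamp_simps max_absorb1 max_absorb2 sgn_if)
  qed
qed

lemma V_0: "V 0 = E e + p * e\<^sup>2 + q * (2 * d * e - d\<^sup>2)"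
  using e d by (simp add: V_def clamp_simps)

lemma V_inside:
  assumes "\<bar>x\<bar> \<le> e"
  shows "E e \<le> V x" and "V x \<le> E e + p * e\<^sup>2 + q * (2 * d * e)"
proof -
  \<comment> \<open>Huber's function: x^2 for |x| \<le> d and 2 d |x| - d^2 beyond.\<close>
  define T where "T = x\<^sup>2 - (max 0 (x - d))\<^sup>2 - (max 0 (- x - d))\<^sup>2"
  have T: "0 \<le> T" "T \<le> 2 * d * e - d\<^sup>2"
  proof -
    consider "\<bar>x\<bar> \<le> d" | "d < x" | "x < - d" by linarith
    then have "0 \<le> T \<and> T \<le> 2 * d * e - d\<^sup>2"
    proof cases
      case 1
      then have "max 0 (x - d) = 0" "max 0 (- x - d) = 0" by auto
      then have "T = x\<^sup>2" by (simp add: T_def)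
      moreover have "x\<^sup>2 \<le> d\<^sup>2" using 1 d by (simp add: abs_le_square_iff[symmetric])
      moreover have "d\<^sup>2 \<le> d * e" using d by (simp add: power2_eq_square)
      ultimately show ?thesis by simp
    next
      case 2
      then have "T = 2 * d * x - d\<^sup>2" using d by (simp add: T_def max_def power2_eq_square algebra_simps)
      moreover have "d * x \<le> d * e" "d * d \<le> d * x" using 2 assms d by (auto intro!: mult_left_mono)
      moreover have "0 < d * d" using d by simp
      ultimately show ?thesis by (simp add: power2_eq_square)
    next
      case 3
      then have "T = 2 * d * (- x) - d\<^sup>2" using d by (simp add: T_def max_def power2_eq_square algebra_simps)
      moreover have "d * (- x) \<le> d * e" "d * d \<le> d * (- x)" using 3 assms d by (intro mult_left_mono; simp)+
      moreover have "0 < d * d" using d by simp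
      ultimately show ?thesis by (simp add: power2_eq_square)
    qed
    then show "0 \<le> T" "T \<le> 2 * d * e - d\<^sup>2" by auto
  qed
  have "clamp e x = x" using assms by (auto simp: clamp_def)
  then have V: "V x = E e + p * (e\<^sup>2 - x\<^sup>2) + q * (2 * d * e - d\<^sup>2 - T)"
    using assms by (simp add: V_def T_def max_absorb1 algebra_simps)
  have x2: "0 \<le> e\<^sup>2 - x\<^sup>2" "e\<^sup>2 - x\<^sup>2 \<le> e\<^sup>2" using assms e by (auto simp: abs_le_square_iff[symmetric])
  show "E e \<le> V x" unfolding V using pq x2 T by (simp add: add_increasing2)
  have "p * (e\<^sup>2 - x\<^sup>2) \<le> p * e\<^sup>2" using pq x2 by (intro mult_left_mono) auto
  moreover have "q * (2 * d * e - d\<^sup>2 - T) \<le> q * (2 * d * e)"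
    using pq T zero_le_power2[of d] by (intro mult_left_mono) linarith+
  ultimately show "V x \<le> E e + p * e\<^sup>2 + q * (2 * d * e)" unfolding V by simp
qed

text \<open>The concave cap leaves |x| = e with the slope of the profile, so it stays below the
  tangent there; \<open>tangent_le\<close> bounds where that tangent meets the axis.\<close>

lemma V_0_le: "V 0 \<le> U 0 + \<eta> * e"
proof -
  have "V 0 \<le> E e + e * (2 * p * e + 2 * q * d)"
    unfolding V_0 using pq e d by (simp add: algebra_simps power2_eq_square add_increasing)
  also have "\<dots> = E e - e * E1 e" unfolding slope by simp
  also have "\<dots> \<le> U 0 + \<eta> * e" using e by (intro tangent_le) simp
  finally show ?thesis .
qed

lemma V_le: "\<bar>x\<bar> \<le> e \<Longrightarrow> V x \<le> U 0 + \<eta> * e"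
proof -
  assume x: "\<bar>x\<bar> \<le> e"
  have "V x \<le> E e + p * e\<^sup>2 + q * (2 * d * e)" by (rule V_inside(2)[OF x])
  also have "\<dots> \<le> E e + e * (2 * p * e + 2 * q * d)"
    using pq e d by (simp add: algebra_simps power2_eq_square)
  also have "\<dots> = E e - e * E1 e" unfolding slope by simp
  also have "\<dots> \<le> U 0 + \<eta> * e" using e by (intro tangent_le) simp
  finally show ?thesis .
qed

lemma continuous_on_E: "continuous_on {0..} E" and continuous_on_E1: "continuous_on {0..} E1"
  using DERIV_E DERIV_E1 by (auto intro!: continuous_at_imp_continuous_on DERIV_isCont)

text \<open>The source is nonnegative inside because caps have v \<le> 0, and outside by
  \<open>E2_le\<close>. The rest verifies the derivatives piece by piece away from the four break
  points.\<close>

lemma cap_stationary: "\<exists>B. stationary \<beta> {- e, - d, d, e} V W v B"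
proof -
  have V0: "0 \<le> V x" for x
    using V_outside[of x] V_inside(1)[of x] E_ge_U[of "\<bar>x\<bar>"] U_pos[of "\<bar>x\<bar>"] E_ge_U[of e] U_pos[of e] e
    by (cases "e \<le> \<bar>x\<bar>") auto
  define BV where "BV = U 0 + \<eta> * e + \<eta>"
  have BV: "U 0 + \<eta> * e \<le> BV" "U 0 + \<eta> \<le> BV" using \<eta> e by (simp_all add: BV_def)
  have VB: "\<bar>V x\<bar> \<le> BV" for x
    using V0[of x] V_outside[of x] V_le[of x] E_le[of "\<bar>x\<bar>"] e \<eta> BV
    by (cases "e \<le> \<bar>x\<bar>") auto
  define BW where "BW = \<bar>U1 0\<bar> + \<eta> + 2 * p * e + 2 * q * d"
  have WB: "\<bar>W x\<bar> \<le> BW" for x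
  proof (cases "e \<le> \<bar>x\<bar>")
    case True
    have "\<bar>W x\<bar> \<le> \<bar>E1 \<bar>x\<bar>\<bar>" unfolding W_outside[OF True] by (simp add: abs_mult sgn_if)
    also have "\<dots> \<le> \<bar>U1 0\<bar> + \<eta>" by (intro E1_bound) simp
    also have "\<dots> \<le> BW" using pq e d by (simp add: BW_def)
    finally show ?thesis .
  next
    case False
    then have "W x = - 2 * p * clamp e x - 2 * q * clamp d x" using e by (simp add: W_def max_absorb1)
    then have "\<bar>W x\<bar> \<le> \<bar>2 * p * clamp e x\<bar> + \<bar>2 * q * clamp d x\<bar>" by linarith
    also have "\<dots> = 2 * p * \<bar>clamp e x\<bar> + 2 * q * \<bar>clamp d x\<bar>" using pq by (simp add: abs_mult)
    also have "\<dots> \<le> 2 * p * e + 2 * q * d"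
      using pq e d by (intro add_mono mult_left_mono) (auto intro: clamp_simps)
    also have "\<dots> \<le> BW" using \<eta> by (simp add: BW_def)
    finally show ?thesis .
  qed
  define Bv where "Bv = 2 * U 0 powr (1 + \<beta>) + 2 * \<eta> + 2 * p + 2 * q"
  have vB: "\<bar>v x\<bar> \<le> Bv" for x
  proof (cases "e \<le> \<bar>x\<bar>")
    case True
    then show ?thesis using E2_bound[of "\<bar>x\<bar>"] pq by (simp add: v_def Bv_def)
  next
    case False
    then have "\<bar>v x\<bar> \<le> 2 * p + 2 * q" using pq by (simp add: v_def)
    also have "\<dots> \<le> Bv" using \<eta> by (simp add: Bv_def)
    finally show ?thesis .
  qed
  have cE: "continuous_on UNIV (\<lambda>x. E (max e (f x)))" "continuous_on UNIV (\<lambda>x. E1 (max e (f x)))"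
    if "continuous_on UNIV f" for f :: "real \<Rightarrow> real"
    using e that by (auto intro!: continuous_on_compose2[OF continuous_on_E] continuous_on_compose2[OF continuous_on_E1] continuous_intros)
  have cl: "continuous_on UNIV (clamp a)" for a
    unfolding clamp_def[abs_def] by (intro continuous_intros)
  have "stationary \<beta> {- e, - d, d, e} V W v (max BV (max BW Bv))"
  proof
    show "continuous_on UNIV V" unfolding V_def[abs_def]
      by (intro continuous_intros cE cl)
    show "continuous_on UNIV W" unfolding W_def[abs_def]
      by (intro continuous_intros cE cl)
    show "v \<in> borel_measurable borel"
      unfolding v_def[abs_def] E2_def U_def by measurable
    show "\<bar>V x\<bar> \<le> max BV (max BW Bv)" "\<bar>W x\<bar> \<le> max BV (max BW Bv)" "\<bar>v x\<bar> \<le> max BV (max BW Bv)" for x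
      using VB[of x] WB[of x] vB[of x] by auto
    show "v x / 2 \<le> V x powr (1 + \<beta>)" for x
    proof (cases "e \<le> \<bar>x\<bar>")
      case True
      have "0 \<le> \<eta> / (1 + \<bar>x\<bar>) ^ 3" using \<eta> by simp
      then show ?thesis using True E2_le[of "\<bar>x\<bar>"] V_outside[OF True] by (simp add: v_def)
    next
      case False
      then have "v x \<le> 0" using pq by (simp add: v_def)
      then show ?thesis using powr_ge_zero[of "V x" "1 + \<beta>"] by linarith
    qed
    fix x assume x: "x \<notin> {- e, - d, d, e}"
  let ?fm = "(if e < - x then - 1 else 0)"
  let ?fp = "(if e < x then 1 else 0)"
    have dm: "((\<lambda>x. max e x) has_real_derivative ?fp) (at x)"
      "((\<lambda>x. max e (- x)) has_real_derivative ?fm) (at x)"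
      using x by (auto intro!: derivative_eq_intros)
    have dE: "((\<lambda>x. E (max e x)) has_real_derivative E1 (max e x) * ?fp) (at x)"
      "((\<lambda>x. E (max e (- x))) has_real_derivative E1 (max e (- x)) * ?fm) (at x)"
      "((\<lambda>x. E1 (max e x)) has_real_derivative E2 (max e x) * ?fp) (at x)"
      "((\<lambda>x. E1 (max e (- x))) has_real_derivative E2 (max e (- x)) * ?fm) (at x)"
      using e DERIV_chain2[where f=E, OF DERIV_E dm(1)] DERIV_chain2[where f=E, OF DERIV_E dm(2)]
        DERIV_chain2[where f=E1, OF DERIV_E1 dm(1)] DERIV_chain2[where f=E1, OF DERIV_E1 dm(2)]
      by simp_all
    have dc: "(clamp a has_real_derivative (if \<bar>x\<bar> < a then 1 else 0)) (at x)" if "0 < a" "x \<noteq> a" "x \<noteq> - a" for a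
    proof -
      have "(clamp a has_real_derivative (if - a < min a x then if x < a then 1 else 0 else 0)) (at x)"
        unfolding clamp_def[abs_def] using that
        by (intro DERIV_max_const DERIV_min_const DERIV_ident) (auto simp: min_def)
      moreover have "(if - a < min a x then if x < a then 1 else 0 else 0) = (if \<bar>x\<bar> < a then 1 else 0 :: real)"
        using that by auto
      ultimately show ?thesis by simp
    qed
    let ?c = "if \<bar>x\<bar> < e then 1 else 0 :: real"
    have ce: "(clamp e has_real_derivative ?c) (at x)" using x e by (intro dc) auto
    have "(W has_real_derivative E2 (max e x) * ?fp - E2 (max e (- x)) * ?fm
        - 2 * p * ?c - 2 * q * (if \<bar>x\<bar> < d then 1 else 0)) (at x)"
      unfolding W_def[abs_def] using x d by (intro DERIV_diff DERIV_cmult dE ce dc) auto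
    also have "E2 (max e x) * ?fp - E2 (max e (- x)) * ?fm
        - 2 * p * ?c - 2 * q * (if \<bar>x\<bar> < d then 1 else 0) = v x"
      using x d e by (cases "0 \<le> x") (auto simp: v_def max_absorb1 max_absorb2)
    finally show "(W has_real_derivative v x) (at x)" .
    have "(V has_real_derivative E1 (max e x) * ?fp + E1 (max e (- x)) * ?fm - 0
        + p * (0 - 2 * clamp e x * ?c)
        + q * (0 - 2 * clamp e x * ?c + 2 * max 0 (clamp e x - d) * (?c - 0) + 2 * max 0 (- clamp e x - d) * (- ?c - 0))) (at x)"
      unfolding V_def[abs_def]
      by (intro DERIV_diff DERIV_add DERIV_cmult DERIV_const dE DERIV_max_0_square DERIV_minus ce)
         (auto intro!: derivative_eq_intros ce)
    also have "E1 (max e x) * ?fp + E1 (max e (- x)) * ?fm - 0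
        + p * (0 - 2 * clamp e x * ?c)
        + q * (0 - 2 * clamp e x * ?c + 2 * max 0 (clamp e x - d) * (?c - 0) + 2 * max 0 (- clamp e x - d) * (- ?c - 0)) = W x"
    proof (cases "e \<le> \<bar>x\<bar>")
      case True
      then show ?thesis using x e W_outside[OF True] by (cases "0 \<le> x") (auto simp: max_absorb2)
    next
      case False
      \<comment> \<open>Differentiating the squares of positive parts in V produces the right side;
        this identity recognizes it as the clamp used in W.\<close>
      have "clamp d x = x - max 0 (x - d) + max 0 (- x - d)" using d by (auto simp: clamp_def)
      moreover have "\<not> e < x" "\<not> e < - x" "clamp e x = x" using False e by (auto simp: clamp_simps)
      ultimately show ?thesis using False e by (simp only: W_def) (simp add: max_absorb1 right_diff_distrib distrib_left)
    qed
    finally show "(V has_real_derivative W x) (at x)" .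
  qed (use V0 \<beta> in auto)
  then show ?thesis by blast
qed

end

section \<open>The Laplace transform of the local time at the origin\<close>

definition occ :: "(real \<Rightarrow> ennreal) \<Rightarrow> path \<Rightarrow> ennreal" where
  "occ g w = (\<integral>\<^sup>+s\<in>{0<..}. (\<integral>\<^sup>+x. g x \<partial>w s) \<partial>lborel)"

text \<open>The uniform probability density on (-e, e); integrated against a continuous local time
  it approximates the value at 0.\<close>

definition window :: "real \<Rightarrow> real \<Rightarrow> ennreal" where
  "window e x = ennreal (1 / (2 * e)) * indicator {- e<..<e} x"

lemma borel_measurable_window [measurable]: "window e \<in> borel_measurable borel"
  unfolding window_def[abs_def] by measurable

lemma window_tendsto:
  fixes l :: "real \<Rightarrow> real" and e :: "nat \<Rightarrow> real"
  assumes l: "continuous_on UNIV l" "\<And>y. 0 \<le> l y" and e: "\<And>n. 0 < e n" "e \<longlonglongrightarrow> 0"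
  shows "(\<lambda>n. \<integral>\<^sup>+y. window (e n) y * ennreal (l y) \<partial>lborel) \<longlonglongrightarrow> ennreal (l 0)"
proof -
  let ?J = "\<lambda>n. \<integral>\<^sup>+y. window (e n) y * ennreal (l y) \<partial>lborel"
  have win: "(\<integral>\<^sup>+y. window h y * ennreal C \<partial>lborel) = ennreal C" if "0 < h" "0 \<le> C" for h C
  proof -
    have "(\<integral>\<^sup>+y. window h y * ennreal C \<partial>lborel) = (\<integral>\<^sup>+y. ennreal (C / (2 * h)) * indicator {- h<..<h} y \<partial>lborel)"
      using that by (intro nn_integral_cong) (auto simp: window_def indicator_def simp flip: ennreal_mult)
    also have "\<dots> = ennreal (C / (2 * h)) * ennreal (2 * h)"
      using that by (simp add: nn_integral_cmult_indicator)
    also have "\<dots> = ennreal C" using that by (simp flip: ennreal_mult)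
    finally show ?thesis .
  qed
  have near: "\<exists>h>0. \<forall>y. \<bar>y\<bar> < h \<longrightarrow> \<bar>l y - l 0\<bar> < \<epsilon>" if "0 < \<epsilon>" for \<epsilon>
  proof -
    have "isCont l 0" using l(1) by (simp add: continuous_on_eq_continuous_at)
    then show ?thesis using that unfolding continuous_at_eps_delta dist_real_def by simp
  qed
  have ev: "\<forall>\<^sub>F n in sequentially. ennreal (l 0 - \<epsilon>) \<le> (?J n)
      \<and> (?J n) \<le> ennreal (l 0 + \<epsilon>)" if \<epsilon>: "0 < \<epsilon>" for \<epsilon>
  proof -
    obtain h where h: "0 < h" "\<And>y. \<bar>y\<bar> < h \<Longrightarrow> \<bar>l y - l 0\<bar> < \<epsilon>" using near[OF \<epsilon>] by blast
    have "\<forall>\<^sub>F n in sequentially. e n < h" using e(2) h(1) by (rule order_tendstoD)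
    then show ?thesis
    proof eventually_elim
      case (elim n)
      have *: "window (e n) y * ennreal (max 0 (l 0 - \<epsilon>)) \<le> window (e n) y * ennreal (l y)"
        "window (e n) y * ennreal (l y) \<le> window (e n) y * ennreal (l 0 + \<epsilon>)" for y
      proof -
        have "max 0 (l 0 - \<epsilon>) \<le> l y \<and> l y \<le> l 0 + \<epsilon>" if "y \<in> {- e n<..<e n}"
        proof -
          have "\<bar>y\<bar> < h" using that elim by auto
          from h(2)[OF this] show ?thesis using l(2)[of y] by linarith
        qed
        then show "window (e n) y * ennreal (max 0 (l 0 - \<epsilon>)) \<le> window (e n) y * ennreal (l y)"
          "window (e n) y * ennreal (l y) \<le> window (e n) y * ennreal (l 0 + \<epsilon>)"
          by (cases "y \<in> {- e n<..<e n}"; simp add: window_def mult_left_mono ennreal_leI)+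
      qed
      have "ennreal (l 0 - \<epsilon>) \<le> ennreal (max 0 (l 0 - \<epsilon>))" by (intro ennreal_leI) simp
      also have "\<dots> = (\<integral>\<^sup>+y. window (e n) y * ennreal (max 0 (l 0 - \<epsilon>)) \<partial>lborel)"
        using e(1) by (intro win[symmetric]) auto
      also have "\<dots> \<le> (?J n)"
        by (intro nn_integral_mono *)
      finally have "ennreal (l 0 - \<epsilon>) \<le> (?J n)" .
      moreover have "(?J n) \<le> (\<integral>\<^sup>+y. window (e n) y * ennreal (l 0 + \<epsilon>) \<partial>lborel)"
        by (intro nn_integral_mono *)
      moreover have "(\<integral>\<^sup>+y. window (e n) y * ennreal (l 0 + \<epsilon>) \<partial>lborel) = ennreal (l 0 + \<epsilon>)"
        using e(1) \<epsilon> l(2)[of 0] by (intro win) auto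
      ultimately show ?case by simp
    qed
  qed
  show ?thesis
  proof (rule order_tendstoI)
    fix a assume a: "a < ennreal (l 0)"
    obtain a' where a': "a = ennreal a'" "0 \<le> a'" using a by (cases a) auto
    then have "a' < l 0" using a by (simp add: ennreal_less_iff)
    define \<epsilon> where "\<epsilon> = (l 0 - a') / 2"
    have "0 < \<epsilon>" "a' < l 0 - \<epsilon>" using \<open>a' < l 0\<close> by (auto simp: \<epsilon>_def field_simps)
    from ev[OF this(1)] show "\<forall>\<^sub>F n in sequentially. a < (?J n)"
      by eventually_elim (use a' \<open>a' < l 0 - \<epsilon>\<close> in \<open>auto simp: ennreal_less_iff intro: less_le_trans[of _ "ennreal (l 0 - \<epsilon>)"]\<close>)
  next
    fix a assume a: "ennreal (l 0) < a"
    then obtain a' where a': "l 0 < a'" "ennreal a' < a"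
      using dense[OF a] l(2)[of 0] by (metis ennreal_cases ennreal_less_iff order_less_imp_not_less top_greatest not_le)
    from ev[of "a' - l 0"] a'(1) have "\<forall>\<^sub>F n in sequentially. (?J n) \<le> ennreal a'"
      by (auto elim: eventually_mono)
    then show "\<forall>\<^sub>F n in sequentially. (?J n) < a"
      by eventually_elim (use a' in auto)
  qed
qed

lemma nn_integral_le_of_tendsto:
  fixes b :: "nat \<Rightarrow> real"
  assumes meas: "\<And>n. f n \<in> borel_measurable M"
    and lim: "AE x in M. (\<lambda>n. f n x) \<longlonglongrightarrow> u x"
    and le: "\<forall>\<^sub>F n in sequentially. (\<integral>\<^sup>+x. f n x \<partial>M) \<le> ennreal (b n)" and b: "b \<longlonglongrightarrow> c"
  shows "(\<integral>\<^sup>+x. u x \<partial>M) \<le> ennreal c"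
proof -
  have "(\<integral>\<^sup>+x. u x \<partial>M) = (\<integral>\<^sup>+x. liminf (\<lambda>n. f n x) \<partial>M)"
    using lim by (intro nn_integral_cong_AE) (auto elim!: eventually_mono dest!: lim_imp_Liminf[OF sequentially_bot])
  also have "\<dots> \<le> liminf (\<lambda>n. \<integral>\<^sup>+x. f n x \<partial>M)" by (rule nn_integral_liminf[OF meas])
  also have "\<dots> \<le> liminf (\<lambda>n. ennreal (b n))" by (rule Liminf_mono[OF le])
  also have "\<dots> = ennreal c"
    using b by (intro lim_imp_Liminf) (auto intro: tendsto_intros)
  finally show ?thesis .
qed

text \<open>The distance from its pole at which \<open>amp \<beta>\<close> times x^(-2/\<beta>) has
  slope - \<rho>.\<close>

definition kap :: "real \<Rightarrow> real \<Rightarrow> real" where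
  "kap \<beta> \<rho> = (2 * amp \<beta> / (\<beta> * \<rho>)) powr (\<beta> / (2 + \<beta>))"

lemma amp_pos: "0 < \<beta> \<Longrightarrow> 0 < amp \<beta>"
  by (simp add: amp_def)

lemma kap_pos: "0 < \<beta> \<Longrightarrow> 0 < \<rho> \<Longrightarrow> 0 < kap \<beta> \<rho>"
  using amp_pos[of \<beta>] by (simp add: kap_def)

lemma kap_slope:
  assumes "0 < \<beta>" "0 < \<rho>"
  shows "2 / \<beta> * amp \<beta> * kap \<beta> \<rho> powr (- 2 / \<beta> - 1) = \<rho>"
proof -
  have "- 2 / \<beta> - 1 = - ((2 + \<beta>) / \<beta>)" using assms by (simp add: field_simps)
  then have "\<beta> / (2 + \<beta>) * (- 2 / \<beta> - 1) = - 1" using assms by simp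
  then have "kap \<beta> \<rho> powr (- 2 / \<beta> - 1) = (2 * amp \<beta> / (\<beta> * \<rho>)) powr (- 1)"
    unfolding kap_def by (simp only: powr_powr)
  also have "\<dots> = \<beta> * \<rho> / (2 * amp \<beta>)"
    using assms amp_pos[of \<beta>] by (simp add: powr_minus_divide)
  finally show ?thesis using assms amp_pos[of \<beta>] by simp
qed

text \<open>The height of the profile where its slope is - \<rho>. Substituting \<open>kap\<close>
  gives A^(1-\<alpha>) (\<beta>/2)^\<alpha> \<rho>^\<alpha>. Since (1-\<alpha>)/\<beta> = \<alpha>/2
  = 1/(2+\<beta>), the first two factors combine to ((2+\<beta>)/4)^(1/(2+\<beta>)), which is the
  constant c.\<close>

lemma kap_value:
  assumes "0 < \<beta>" "0 < \<rho>" and \<alpha>: "\<alpha> = 2 / (2 + \<beta>)"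
  shows "amp \<beta> * kap \<beta> \<rho> powr (- 2 / \<beta>) = (sqrt (\<beta> + 2) / 2) powr \<alpha> * \<rho> powr \<alpha>"
proof -
  have A: "0 < amp \<beta>" using assms(1) by (rule amp_pos)
  have "\<beta> / (2 + \<beta>) * (- 2 / \<beta>) = - \<alpha>" using assms by (simp add: field_simps)
  then have "kap \<beta> \<rho> powr (- 2 / \<beta>) = (2 * amp \<beta> / (\<beta> * \<rho>)) powr (- \<alpha>)"
    unfolding kap_def by (simp only: powr_powr)
  also have "\<dots> = (\<beta> / (2 * amp \<beta>)) powr \<alpha> * \<rho> powr \<alpha>"
    using assms A by (simp add: powr_minus powr_divide powr_mult field_simps)
  also have "(\<beta> / (2 * amp \<beta>)) powr \<alpha> = (\<beta> / 2) powr \<alpha> * amp \<beta> powr (- \<alpha>)"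
    using assms A by (simp add: powr_minus powr_divide powr_mult field_simps)
  finally have "amp \<beta> * kap \<beta> \<rho> powr (- 2 / \<beta>) = (amp \<beta> powr (1 - \<alpha>) * (\<beta> / 2) powr \<alpha>) * \<rho> powr \<alpha>"
    using A powr_add[of "amp \<beta>" 1 "- \<alpha>"] by simp
  also have "amp \<beta> powr (1 - \<alpha>) = ((2 + \<beta>) / \<beta>\<^sup>2) powr (1 / (2 + \<beta>))"
  proof -
    have "1 / \<beta> * (1 - \<alpha>) = 1 / (2 + \<beta>)" using assms by (simp add: field_simps)
    then show ?thesis unfolding amp_def by (simp only: powr_powr)
  qed
  also have "(\<beta> / 2) powr \<alpha> = ((\<beta> / 2)\<^sup>2) powr (1 / (2 + \<beta>))"
    using assms by (simp add: powr_powr flip: powr_numeral)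
  also have "((2 + \<beta>) / \<beta>\<^sup>2) powr (1 / (2 + \<beta>)) * ((\<beta> / 2)\<^sup>2) powr (1 / (2 + \<beta>)) = ((2 + \<beta>) / 4) powr (1 / (2 + \<beta>))"
    using assms by (simp add: powr_mult[symmetric] power_divide)
  also have "(2 + \<beta>) / 4 = (sqrt (\<beta> + 2) / 2)\<^sup>2"
    using assms by (simp add: power_divide add.commute)
  also have "\<dots> powr (1 / (2 + \<beta>)) = (sqrt (\<beta> + 2) / 2) powr \<alpha>"
    using assms by (simp add: powr_powr flip: powr_numeral)
  finally show ?thesis .
qed

locale cluster_local_time =
  fixes \<beta> \<alpha> c :: real and P :: "real measure \<Rightarrow> path measure" and N :: "real \<Rightarrow> path measure"
    and L :: "real \<Rightarrow> path \<Rightarrow> real"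
  assumes \<beta>: "0 < \<beta>" and sbm: "super_Brownian_motion \<beta> P" and can: "canonical_measure P N"
    and tlt: "total_local_time (N 0) L"
    and \<alpha>: "\<alpha> = 2 / (2 + \<beta>)" and c: "c = (sqrt (\<beta> + 2) / 2) powr \<alpha>"
begin

abbreviation exponent :: "(path \<Rightarrow> ennreal) \<Rightarrow> ennreal" where
  "exponent F \<equiv> \<integral>\<^sup>+w. ennreal (1 - nexp (F w)) \<partial>N 0"

definition H :: "real \<Rightarrow> real" where
  "H r = c * r powr \<alpha>"

lemma \<alpha>01: "0 < \<alpha>" "\<alpha> < 1"
  using \<beta> by (auto simp: \<alpha>)

lemma c_pos: "0 < c"
  using \<beta> by (simp add: c)

lemma H_kap: "0 < \<rho> \<Longrightarrow> amp \<beta> * kap \<beta> \<rho> powr (- 2 / \<beta>) = H \<rho>"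
  using kap_value[OF \<beta> _ \<alpha>, of \<rho>] unfolding H_def by (simp only: c)

lemma sets_N: "sets (N 0) = sets cluster_space"
  using can by (rule canonical_measure_sets)

lemma space_N: "space (N 0) = space cluster_space"
  using sets_N by (rule sets_eq_imp_space_eq)

lemma measurable_occ [measurable]: "g \<in> borel_measurable borel \<Longrightarrow> occ g \<in> borel_measurable (N 0)"
  unfolding measurable_cong_sets[OF sets_N refl] occ_def[abs_def]
  by (intro cluster_space.measurable_time_integral) auto

lemma measurable_L [measurable]: "L y \<in> borel_measurable (N 0)"
  using tlt by (simp add: total_local_time_def)

lemma AE_local_time:
  "AE w in N 0. continuous_on UNIV (\<lambda>y. L y w) \<and> (\<forall>y. 0 \<le> L y w) \<and>
    (\<forall>g \<in> borel_measurable borel. occ g w = (\<integral>\<^sup>+y. g y * ennreal (L y w) \<partial>lborel))"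
  using tlt unfolding total_local_time_def occ_def by blast

lemma occ_mono: "(\<And>x. f x \<le> g x) \<Longrightarrow> occ f w \<le> occ g w"
  unfolding occ_def by (intro nn_integral_mono mult_right_mono) auto

lemma AE_occ_add:
  assumes [measurable]: "f \<in> borel_measurable borel" "g \<in> borel_measurable borel"
  shows "AE w in N 0. occ (\<lambda>x. f x + g x) w = occ f w + occ g w"
  using AE_local_time
proof eventually_elim
  case (elim w)
  then have [measurable]: "(\<lambda>y. L y w) \<in> borel_measurable borel"
    by (auto intro: borel_measurable_continuous_onI)
  show ?case using elim by (simp add: distrib_right nn_integral_add)
qed

lemma AE_occ_cmult:
  assumes [measurable]: "f \<in> borel_measurable borel"
  shows "AE w in N 0. occ (\<lambda>x. a * f x) w = a * occ f w"
  using AE_local_time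
proof eventually_elim
  case (elim w)
  then have [measurable]: "(\<lambda>y. L y w) \<in> borel_measurable borel"
    by (auto intro: borel_measurable_continuous_onI)
  show ?case using elim by (simp add: mult.assoc nn_integral_cmult)
qed

lemma stationary_occ:
  assumes "stationary \<beta> S V W v B"
  shows "exponent (\<lambda>w. occ (\<lambda>x. ennreal (stationary.source \<beta> V v x)) w) = ennreal (V 0)"
  using stationary.total_occupation_laplace[OF assms sbm can] by (simp add: occ_def)

text \<open>A cap is built whose source dominates both windows and the tail term, so monotonicity
  bounds the exponent by its value V(0), which is at most U(0) + \<eta> e.\<close>

lemma window_laplace_le:
  assumes de: "0 < d" "d \<le> e" and \<rho>: "0 \<le> \<rho>1" "0 \<le> \<rho>2" "0 < \<rho>1 + \<rho>2" and \<eta>: "0 \<le> \<eta>"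
    and k: "e < kap \<beta> (\<rho>1 + \<rho>2 + \<eta>)"
  shows "exponent (\<lambda>w. ennreal \<rho>1 * occ (window e) w + ennreal \<rho>2 * occ (window d) w
      + occ (\<lambda>x. ennreal (\<eta> / (1 + \<bar>x\<bar>) ^ 3) * indicator {x. e \<le> \<bar>x\<bar>} x) w)
    \<le> ennreal (amp \<beta> * (kap \<beta> (\<rho>1 + \<rho>2 + \<eta>) - e) powr (- 2 / \<beta>) + \<eta> * e)"
proof -
  \<comment> \<open>The profile is shifted so that U has slope -(\<rho>1 + \<rho>2 + \<eta>) at |x|
    = e, where the cap is glued, rather than at 0.\<close>
  define k where "k = kap \<beta> (\<rho>1 + \<rho>2 + \<eta>) - e"
  interpret profile \<beta> k \<eta>
    using \<beta> k \<eta> by unfold_locales (auto simp: k_def)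
  have ek: "e + k = kap \<beta> (\<rho>1 + \<rho>2 + \<eta>)" by (simp add: k_def)
  have E1: "- E1 e = \<rho>1 + \<rho>2 + (\<eta> - \<eta> / (1 + e)\<^sup>2)"
    using kap_slope[OF \<beta>, of "\<rho>1 + \<rho>2 + \<eta>"] \<rho> \<eta> by (simp add: E1_def U1_def ek)
  have s: "0 \<le> \<eta> - \<eta> / (1 + e)\<^sup>2"
    using de \<eta> by (simp add: divide_le_eq mult_le_cancel_left1 one_le_power)
  \<comment> \<open>The slope not accounted for by the two windows,
    \<open>\<eta> - \<eta> / (1 + e)\<^sup>2\<close>, is nonnegative and is assigned to the wide
    parabola, where it only enlarges the source.\<close>
  define p where "p = (\<rho>1 + (\<eta> - \<eta> / (1 + e)\<^sup>2)) / (2 * e)"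
  define q where "q = \<rho>2 / (2 * d)"
  interpret cap \<beta> k \<eta> e d p q
    using de \<rho> s E1 by unfold_locales (auto simp: p_def q_def)
  obtain B where st: "stationary \<beta> {- e, - d, d, e} V W v B" using cap_stationary by blast
  interpret stationary \<beta> "{- e, - d, d, e}" V W v B by (rule st)
  let ?\<psi> = "\<lambda>x. ennreal (\<eta> / (1 + \<bar>x\<bar>) ^ 3) * indicator {x. e \<le> \<bar>x\<bar>} x"
  have dom: "ennreal \<rho>1 * window e x + ennreal \<rho>2 * window d x + ?\<psi> x \<le> ennreal (source x)" for x
  proof (cases "e \<le> \<bar>x\<bar>")
    case True
    then have "window e x = 0" "window d x = 0" using de by (auto simp: window_def indicator_def)
    then show ?thesis
      using True E2_le[of "\<bar>x\<bar>"] V_outside[OF True] by (auto simp: source_def v_def intro!: ennreal_leI)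
  next
    case False
    have w: "window e x = ennreal (1 / (2 * e))" using False by (auto simp: window_def indicator_def)
    have w': "window d x = ennreal (if \<bar>x\<bar> < d then 1 / (2 * d) else 0)"
      by (auto simp: window_def indicator_def)
    have "\<rho>1 * (1 / (2 * e)) \<le> p" using de s by (simp add: p_def divide_right_mono)
    moreover have "\<rho>2 * (if \<bar>x\<bar> < d then 1 / (2 * d) else 0) = (if \<bar>x\<bar> < d then q else 0)" by (simp add: q_def)
    moreover have "source x = V x powr (1 + \<beta>) + p + (if \<bar>x\<bar> < d then q else 0)"
      using False by (simp add: source_def v_def diff_divide_distrib)
    ultimately have "\<rho>1 * (1 / (2 * e)) + \<rho>2 * (if \<bar>x\<bar> < d then 1 / (2 * d) else 0) \<le> source x"
      using powr_ge_zero[of "V x" "1 + \<beta>"] by linarith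
    then have "ennreal (\<rho>1 * (1 / (2 * e)) + \<rho>2 * (if \<bar>x\<bar> < d then 1 / (2 * d) else 0)) \<le> ennreal (source x)"
      by (rule ennreal_leI)
    moreover have "ennreal (\<rho>1 * (1 / (2 * e)) + \<rho>2 * (if \<bar>x\<bar> < d then 1 / (2 * d) else 0))
        = ennreal \<rho>1 * window e x + ennreal \<rho>2 * window d x"
    proof -
      have "ennreal (\<rho>1 * a + \<rho>2 * b) = ennreal \<rho>1 * ennreal a + ennreal \<rho>2 * ennreal b" if "0 \<le> a" "0 \<le> b" for a b
        using \<rho> that by (simp add: ennreal_mult)
      from this[of "1 / (2 * e)" "if \<bar>x\<bar> < d then 1 / (2 * d) else 0"]
      show ?thesis unfolding w w' using de by auto
    qed
    ultimately show ?thesis using False by simp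
  qed
  have occ_dom: "occ (\<lambda>x. ennreal \<rho>1 * window e x + ennreal \<rho>2 * window d x + ?\<psi> x) w \<le> occ (\<lambda>x. ennreal (source x)) w" for w
    by (rule occ_mono[OF dom])
  have wm: "(\<lambda>x. ennreal \<rho>1 * window e x) \<in> borel_measurable borel" "(\<lambda>x. ennreal \<rho>2 * window d x) \<in> borel_measurable borel"
    "(\<lambda>x. ennreal \<rho>1 * window e x + ennreal \<rho>2 * window d x) \<in> borel_measurable borel"
    by measurable
  have \<psi>m: "?\<psi> \<in> borel_measurable borel" by measurable
  have ae: "AE w in N 0. ennreal \<rho>1 * occ (window e) w + ennreal \<rho>2 * occ (window d) w + occ ?\<psi> w
      \<le> occ (\<lambda>x. ennreal (source x)) w"
    using AE_occ_add[OF wm(3) \<psi>m] AE_occ_add[OF wm(1,2)]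
      AE_occ_cmult[OF borel_measurable_window, of "ennreal \<rho>1" e] AE_occ_cmult[OF borel_measurable_window, of "ennreal \<rho>2" d]
  proof eventually_elim
    case (elim w)
    then show ?case using occ_dom[of w] by simp
  qed
  have "exponent (\<lambda>w. ennreal \<rho>1 * occ (window e) w + ennreal \<rho>2 * occ (window d) w + occ ?\<psi> w)
      \<le> exponent (\<lambda>w. occ (\<lambda>x. ennreal (source x)) w)"
    using ae by (intro nn_integral_mono_AE) (auto elim!: eventually_mono intro!: ennreal_leI nexp_mono)
  also have "\<dots> = ennreal (V 0)" by (rule stationary_occ[OF st])
  also have "\<dots> \<le> ennreal (amp \<beta> * k powr (- 2 / \<beta>) + \<eta> * e)"
    using V_0_le by (intro ennreal_leI) (simp add: U_def)
  finally show ?thesis by (simp only: k_def)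
qed

text \<open>With \<eta> = 0 the source of a cap vanishes outside |x| < e, and inside it exceeds the
  constant density by V^(1+\<beta>) \<le> U(0)^(1+\<beta>). The surplus has mass at most 2 e
  U(0)^(1+\<beta>), which r is required to cover; and V(0) \<ge> U(e) = H \<rho>.\<close>

lemma window_laplace_ge:
  assumes e: "0 < e" and \<rho>: "0 < \<rho>" and k: "e < kap \<beta> \<rho>"
    and r: "\<rho> + 2 * e * (amp \<beta> * (kap \<beta> \<rho> - e) powr (- 2 / \<beta>)) powr (1 + \<beta>) \<le> r"
  shows "ennreal (H \<rho>) \<le> exponent (\<lambda>w. ennreal r * occ (window e) w)"
proof -
  define k where "k = kap \<beta> \<rho> - e"
  interpret profile \<beta> k 0
    using \<beta> k by unfold_locales (auto simp: k_def)
  have ek: "e + k = kap \<beta> \<rho>" by (simp add: k_def)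
  have E1: "- E1 e = \<rho>"
    using kap_slope[OF \<beta> \<rho>] by (simp add: E1_def U1_def ek)
  have U0: "U 0 = amp \<beta> * (kap \<beta> \<rho> - e) powr (- 2 / \<beta>)"
    unfolding U_def by (simp add: k_def)
  define p where "p = \<rho> / (2 * e)"
  interpret cap \<beta> k 0 e e p 0
    using e \<rho> E1 by unfold_locales (auto simp: p_def)
  obtain B where st: "stationary \<beta> {- e, - e, e, e} V W v B" using cap_stationary by blast
  interpret stationary \<beta> "{- e, - e, e, e}" V W v B by (rule st)
  have dom: "ennreal (source x) \<le> ennreal r * window e x" for x
  proof (cases "e \<le> \<bar>x\<bar>")
    case True
    then have "source x = 0"
      using V_outside[OF True] by (simp add: source_def v_def E_def E2_def)
    then show ?thesis by simp
  next
    case False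
    have "V x powr (1 + \<beta>) \<le> U 0 powr (1 + \<beta>)"
      using V_le[of x] V_nonneg[of x] False \<beta> by (intro powr_mono2) auto
    then have "source x \<le> U 0 powr (1 + \<beta>) + p"
      using False by (simp add: source_def v_def)
    also have "\<dots> = (\<rho> + 2 * e * U 0 powr (1 + \<beta>)) * (1 / (2 * e))"
      using e by (simp add: p_def field_simps)
    also have "\<dots> \<le> r * (1 / (2 * e))"
      using r e by (intro mult_right_mono) (simp_all add: U0)
    finally have "ennreal (source x) \<le> ennreal (r * (1 / (2 * e)))" by (rule ennreal_leI)
    moreover have "0 \<le> r" using r e \<rho> by (auto intro: order_trans[rotated])
    moreover have "window e x = ennreal (1 / (2 * e))" using False by (auto simp: window_def indicator_def)
    ultimately show ?thesis using e by (simp add: ennreal_mult[symmetric])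
  qed
  have occ_dom: "occ (\<lambda>x. ennreal (source x)) w \<le> occ (\<lambda>x. ennreal r * window e x) w" for w
    by (rule occ_mono[OF dom])
  have "H \<rho> = U e"
    using H_kap[OF \<rho>] by (simp add: U_def ek)
  also have "\<dots> \<le> V 0"
    using V_inside(1)[of 0] E_ge_U[of e] e by simp
  finally have "ennreal (H \<rho>) \<le> ennreal (V 0)" by (rule ennreal_leI)
  also have "\<dots> = exponent (\<lambda>w. occ (\<lambda>x. ennreal (source x)) w)"
    by (rule stationary_occ[OF st, symmetric])
  also have "\<dots> \<le> exponent (\<lambda>w. ennreal r * occ (window e) w)"
  proof (rule nn_integral_mono_AE)
    show "AE w in N 0. ennreal (1 - nexp (occ (\<lambda>x. ennreal (source x)) w)) \<le> ennreal (1 - nexp (ennreal r * occ (window e) w))"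
      using AE_occ_cmult[OF borel_measurable_window, of "ennreal r" e]
    proof eventually_elim
      case (elim w)
      then show ?case using occ_dom[of w] by (auto intro!: ennreal_leI nexp_mono)
    qed
  qed
  finally show ?thesis .
qed

section \<open>Shrinking windows and identification of the Laplace exponent\<close>

definition G :: "real \<Rightarrow> ennreal" where
  "G r = exponent (\<lambda>w. ennreal (r * L 0 w))"

definition width :: "nat \<Rightarrow> real" where
  "width n = 1 / real (Suc n)"

lemma width: "0 < width n" "width \<longlonglongrightarrow> 0" "n \<le> m \<Longrightarrow> width m \<le> width n"
  unfolding width_def[abs_def] using LIMSEQ_Suc[OF lim_1_over_n] by (auto simp: frac_le)

lemma AE_window_tendsto:
  assumes "0 \<le> r"
  shows "AE w in N 0. (\<lambda>n. ennreal r * occ (window (width n)) w) \<longlonglongrightarrow> ennreal (r * L 0 w)"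
  using AE_local_time
proof eventually_elim
  case (elim w)
  then have "(\<lambda>n. occ (window (width n)) w) \<longlonglongrightarrow> ennreal (L 0 w)"
    using window_tendsto[of "\<lambda>y. L y w", OF _ _ width(1,2)] by simp
  then have "(\<lambda>n. ennreal r * occ (window (width n)) w) \<longlonglongrightarrow> ennreal r * ennreal (L 0 w)"
    by (intro ennreal_tendsto_cmult) auto
  then show ?case using elim assms by (simp add: ennreal_mult)
qed

lemma upper_limit:
  assumes "0 < r" "0 \<le> \<eta>"
  shows "(\<lambda>n. amp \<beta> * (kap \<beta> (r + \<eta>) - width n) powr (- 2 / \<beta>) + \<eta> * width n) \<longlonglongrightarrow> H (r + \<eta>)"
proof -
  have k: "0 < kap \<beta> (r + \<eta>)" using \<beta> assms by (intro kap_pos) auto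
  have "(\<lambda>n. amp \<beta> * (kap \<beta> (r + \<eta>) - width n) powr (- 2 / \<beta>) + \<eta> * width n)
      \<longlonglongrightarrow> amp \<beta> * (kap \<beta> (r + \<eta>) - 0) powr (- 2 / \<beta>) + \<eta> * 0"
    using k by (intro tendsto_intros width(2)) auto
  then show ?thesis using H_kap[of "r + \<eta>"] assms by simp
qed

lemma eventually_width_less: "0 < x \<Longrightarrow> \<forall>\<^sub>F n in sequentially. width n < x"
  using width(2) by (rule order_tendstoD)

text \<open>The surplus mass in \<open>window_laplace_ge\<close> vanishes with the width, so any r
  strictly above \<rho> eventually covers it.\<close>

lemma eventually_window_ge:
  assumes "0 < \<rho>" "\<rho> < r"
  shows "\<forall>\<^sub>F n in sequentially. ennreal (H \<rho>) \<le> exponent (\<lambda>w. ennreal r * occ (window (width n)) w)"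
proof -
  have k: "0 < kap \<beta> \<rho>" using \<beta> assms by (intro kap_pos) auto
  have "(\<lambda>n. \<rho> + 2 * width n * (amp \<beta> * (kap \<beta> \<rho> - width n) powr (- 2 / \<beta>)) powr (1 + \<beta>))
      \<longlonglongrightarrow> \<rho> + 2 * 0 * (amp \<beta> * (kap \<beta> \<rho> - 0) powr (- 2 / \<beta>)) powr (1 + \<beta>)"
    using k amp_pos[OF \<beta>] by (intro tendsto_intros width(2)) auto
  then have "\<forall>\<^sub>F n in sequentially. \<rho> + 2 * width n * (amp \<beta> * (kap \<beta> \<rho> - width n) powr (- 2 / \<beta>)) powr (1 + \<beta>) < r"
    using assms by (intro order_tendstoD(2)) auto
  then show ?thesis
    using eventually_width_less[OF k]
    by eventually_elim (use assms width(1) in \<open>auto intro!: window_laplace_ge\<close>)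
qed

text \<open>Two nested windows of mass r each have total slope 2 r; n \<le> m makes
  \<open>width m\<close> the inner one.\<close>

lemma pair_laplace_le:
  assumes "0 < r" "n \<le> m" "width n < kap \<beta> (2 * r)"
  shows "exponent (\<lambda>w. ennreal r * occ (window (width n)) w + ennreal r * occ (window (width m)) w)
    \<le> ennreal (amp \<beta> * (kap \<beta> (2 * r) - width n) powr (- 2 / \<beta>))"
proof -
  have "occ (\<lambda>x. 0) w = 0" for w by (simp add: occ_def)
  then show ?thesis
    using window_laplace_le[of "width m" "width n" r r 0] assms width(1)[of m] width(3)[of n m] by simp
qed

lemma single_laplace_le:
  assumes "0 < r" "width n < kap \<beta> r"
  shows "exponent (\<lambda>w. ennreal r * occ (window (width n)) w)
    \<le> ennreal (amp \<beta> * (kap \<beta> r - width n) powr (- 2 / \<beta>))"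
proof -
  have "occ (\<lambda>x. 0) w = 0" for w by (simp add: occ_def)
  then show ?thesis
    using window_laplace_le[of "width n" "width n" r 0 0] assms width(1)[of n] by simp
qed

lemma G_le_H:
  assumes "0 < r"
  shows "G r \<le> ennreal (H r)"
  unfolding G_def
proof (rule nn_integral_le_of_tendsto)
  show "(\<lambda>w. ennreal (1 - nexp (ennreal r * occ (window (width n)) w))) \<in> borel_measurable (N 0)" for n
    by measurable
  show "AE w in N 0. (\<lambda>n. ennreal (1 - nexp (ennreal r * occ (window (width n)) w))) \<longlonglongrightarrow> ennreal (1 - nexp (ennreal (r * L 0 w)))"
    using AE_window_tendsto[OF less_imp_le[OF assms]] by eventually_elim (intro tendsto_intros)
  show "\<forall>\<^sub>F n in sequentially. exponent (\<lambda>w. ennreal r * occ (window (width n)) w)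
      \<le> ennreal (amp \<beta> * (kap \<beta> r - width n) powr (- 2 / \<beta>))"
    using eventually_width_less[OF kap_pos[OF \<beta> assms]] by eventually_elim (rule single_laplace_le[OF assms])
  show "(\<lambda>n. amp \<beta> * (kap \<beta> r - width n) powr (- 2 / \<beta>)) \<longlonglongrightarrow> H r"
    using upper_limit[of r 0] assms by simp
qed

text \<open>(1 - a)(1 - b) + (1 - a b) = (1 - a) + (1 - b), arranged without subtraction of
  integrals so that it can be integrated term by term in [0, \<infinity>].\<close>

lemma one_minus_nexp_product:
  "ennreal ((1 - nexp x) * (1 - nexp y)) + ennreal (1 - nexp (x + y)) = ennreal (1 - nexp x) + ennreal (1 - nexp y)"
proof -
  have "0 \<le> (1 - nexp x) * (1 - nexp y)" by (intro mult_nonneg_nonneg) auto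
  then have "ennreal ((1 - nexp x) * (1 - nexp y)) + ennreal (1 - nexp (x + y))
      = ennreal ((1 - nexp x) * (1 - nexp y) + (1 - nexp (x + y)))"
    by (intro ennreal_plus[symmetric]) auto
  also have "(1 - nexp x) * (1 - nexp y) + (1 - nexp (x + y)) = (1 - nexp x) + (1 - nexp y)"
    by (simp add: nexp_add algebra_simps)
  also have "ennreal ((1 - nexp x) + (1 - nexp y)) = ennreal (1 - nexp x) + ennreal (1 - nexp y)"
    by (intro ennreal_plus) auto
  finally show ?thesis .
qed

text \<open>Products of approximations at two different scales are dominated by one factor, so the
  iterated limit may be taken although the measure is infinite. In terms of \<open>l = H - G\<close> the
  result is \<open>2 * l r \<le> l (2 * r)\<close>.\<close>

lemma G_defect:
  assumes r: "0 < r"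
  shows "ennreal (2 * H r) + G (2 * r) \<le> ennreal (H (2 * r)) + 2 * G r"
proof -
  define g where "g n w = 1 - nexp (ennreal r * occ (window (width n)) w)" for n w
  define g0 where "g0 w = 1 - nexp (ennreal (r * L 0 w))" for w
  define a where "a n = (\<integral>\<^sup>+w. ennreal (g n w) \<partial>N 0)" for n
  define u where "u n = amp \<beta> * (kap \<beta> (2 * r) - width n) powr (- 2 / \<beta>)" for n
  have g: "0 \<le> g n w" "g n w \<le> 1" and g0: "0 \<le> g0 w" "g0 w \<le> 1" for n w
    by (auto simp: g_def g0_def)
  let ?g2 = "\<integral>\<^sup>+w. ennreal (g0 w * g0 w) \<partial>N 0"
  let ?g1 = "\<lambda>n. \<integral>\<^sup>+w. ennreal (g n w * g0 w) \<partial>N 0"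
  let ?gg = "\<lambda>u v. \<integral>\<^sup>+w. ennreal (g u w * g v w) \<partial>N 0"
  have [measurable]: "g n \<in> borel_measurable (N 0)" "g0 \<in> borel_measurable (N 0)" for n
    unfolding g_def[abs_def] g0_def[abs_def] by measurable
  have lim: "AE w in N 0. (\<lambda>n. g n w) \<longlonglongrightarrow> g0 w"
    using AE_window_tendsto[OF less_imp_le[OF r]] unfolding g_def g0_def
    by eventually_elim (intro tendsto_intros)
  have pair: "a n + a m \<le> (?gg n m) + ennreal (u n)"
    if "n \<le> m" "width n < kap \<beta> (2 * r)" for n m
  proof -
    have "a n + a m = (\<integral>\<^sup>+w. ennreal (g n w) + ennreal (g m w) \<partial>N 0)"
      unfolding a_def by (intro nn_integral_add[symmetric]) measurable
    also have "\<dots> = (?gg n m) +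
        exponent (\<lambda>w. ennreal r * occ (window (width n)) w + ennreal r * occ (window (width m)) w)"
      unfolding g_def one_minus_nexp_product[symmetric] by (intro nn_integral_add) measurable
    also have "\<dots> \<le> (?gg n m) + ennreal (u n)"
      unfolding u_def using r that by (intro add_left_mono pair_laplace_le)
    finally show ?thesis .
  qed
  have fin: "\<forall>\<^sub>F n in sequentially. a n < \<infinity>"
    using eventually_width_less[OF kap_pos[OF \<beta> r]]
  proof eventually_elim
    case (elim n)
    show ?case unfolding a_def g_def using single_laplace_le[OF r elim] by (rule order_le_less_trans) simp
  qed
  have kk: "0 < kap \<beta> (2 * r)" using \<beta> r by (intro kap_pos) auto
  \<comment> \<open>First m tends to infinity with n fixed: the products are dominated by
    \<open>g n\<close>, whose integral \<open>a n\<close> is finite. The term \<open>a m\<close> is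
    replaced by its lower bound, which is available only for \<rho> < r.\<close>
  have inner: "a n + ennreal (H \<rho>) \<le> (?g1 n) + ennreal (u n)"
    if n: "width n < kap \<beta> (2 * r)" "a n < \<infinity>" and \<rho>: "0 < \<rho>" "\<rho> < r" for n \<rho>
  proof -
    have "(\<lambda>m. ?gg n m) \<longlonglongrightarrow> (?g1 n)"
    proof (rule nn_integral_dominated_convergence[where w="\<lambda>w. ennreal (g n w)"])
      show "AE w in N 0. (\<lambda>m. ennreal (g n w * g m w)) \<longlonglongrightarrow> ennreal (g n w * g0 w)"
        using lim by eventually_elim (intro tendsto_intros)
    qed (use n g in \<open>auto simp: a_def mult_left_le intro!: AE_I2 ennreal_leI\<close>)
    then have "(\<lambda>m. (?gg n m) + ennreal (u n)) \<longlonglongrightarrow> (?g1 n) + ennreal (u n)"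
      by (intro tendsto_add tendsto_const)
    moreover have "\<forall>\<^sub>F m in sequentially. a n + ennreal (H \<rho>) \<le> (?gg n m) + ennreal (u n)"
      using eventually_window_ge[OF \<rho>] eventually_ge_at_top[of n]
    proof eventually_elim
      case (elim m)
      then have "a n + ennreal (H \<rho>) \<le> a n + a m" by (simp add: a_def g_def add_left_mono)
      also note pair[OF elim(2) n(1)]
      finally show ?case .
    qed
    ultimately show ?thesis by (rule tendsto_lowerbound) simp
  qed
  have Gfin: "G r < \<infinity>" using G_le_H[OF r] by (rule order_le_less_trans) simp
  \<comment> \<open>Then n tends to infinity, now dominated by \<open>g0\<close>, whose integral
    \<open>G r\<close> is finite by the Fatou bound. Continuity of H afterwards allows \<rho> to
    increase to r.\<close>
  have outer: "ennreal (2 * H \<rho>) \<le> (?g2) + ennreal (H (2 * r))"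
    if \<rho>: "0 < \<rho>" "\<rho> < r" for \<rho>
  proof -
    have "(\<lambda>n. ?g1 n) \<longlonglongrightarrow> (?g2)"
    proof (rule nn_integral_dominated_convergence[where w="\<lambda>w. ennreal (g0 w)"])
      show "AE w in N 0. (\<lambda>n. ennreal (g n w * g0 w)) \<longlonglongrightarrow> ennreal (g0 w * g0 w)"
        using lim by eventually_elim (intro tendsto_intros)
    qed (use Gfin g g0 in \<open>auto simp: G_def g0_def[symmetric] mult_left_le_one_le intro!: AE_I2 ennreal_leI\<close>)
    moreover have "u \<longlonglongrightarrow> H (2 * r)"
      using upper_limit[of "2 * r" 0] r unfolding u_def by simp
    ultimately have "(\<lambda>n. (?g1 n) + ennreal (u n)) \<longlonglongrightarrow> (?g2) + ennreal (H (2 * r))"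
      by (intro tendsto_add tendsto_ennrealI)
    moreover have "\<forall>\<^sub>F n in sequentially. ennreal (2 * H \<rho>) \<le> (?g1 n) + ennreal (u n)"
      using eventually_window_ge[OF \<rho>] eventually_width_less[OF kk] fin
    proof eventually_elim
      case (elim n)
      have "0 \<le> H \<rho>" using c_pos by (simp add: H_def)
      then have "ennreal (2 * H \<rho>) = ennreal (H \<rho>) + ennreal (H \<rho>)" by (simp flip: ennreal_plus)
      also have "\<dots> \<le> a n + ennreal (H \<rho>)" using elim(1) by (simp add: a_def g_def add_right_mono)
      also note inner[OF elim(2,3) \<rho>]
      finally show ?case .
    qed
    ultimately show ?thesis by (rule tendsto_lowerbound) simp
  qed
  have "ennreal (2 * H r) \<le> (?g2) + ennreal (H (2 * r))"
  proof (rule tendsto_upperbound)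
    show "((\<lambda>\<rho>. ennreal (2 * H \<rho>)) \<longlongrightarrow> ennreal (2 * H r)) (at_left r)"
      unfolding H_def using r by (intro tendsto_intros) auto
    have "\<forall>\<^sub>F \<rho> in at_left r. \<rho> \<in> {0<..<r}" using r by (rule eventually_at_left_real)
    then show "\<forall>\<^sub>F \<rho> in at_left r. ennreal (2 * H \<rho>) \<le> (?g2) + ennreal (H (2 * r))"
      by eventually_elim (use outer in auto)
  qed simp
  then have "ennreal (2 * H r) + G (2 * r) \<le> ((?g2) + ennreal (H (2 * r))) + G (2 * r)"
    by (rule add_right_mono)
  also have "\<dots> = ennreal (H (2 * r)) + ((?g2) + G (2 * r))"
    by (simp add: ac_simps)
  \<comment> \<open>The product identity, used with both arguments equal to r times the local time,
    turns the limit of the products back into values of G.\<close>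
  also have "(?g2) + G (2 * r) = (\<integral>\<^sup>+w. ennreal (g0 w * g0 w) + ennreal (1 - nexp (ennreal (2 * r * L 0 w))) \<partial>N 0)"
    unfolding G_def by (intro nn_integral_add[symmetric]) measurable
  also have "\<dots> = (\<integral>\<^sup>+w. ennreal (g0 w) + ennreal (g0 w) \<partial>N 0)"
  proof (rule nn_integral_cong_AE)
    show "AE w in N 0. ennreal (g0 w * g0 w) + ennreal (1 - nexp (ennreal (2 * r * L 0 w))) = ennreal (g0 w) + ennreal (g0 w)"
      using AE_local_time
    proof eventually_elim
      case (elim w)
      have "ennreal (2 * r * L 0 w) = ennreal (r * L 0 w) + ennreal (r * L 0 w)"
        using elim r by (simp flip: ennreal_plus)
      then show ?case unfolding g0_def by (simp only: one_minus_nexp_product)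
    qed
  qed
  also have "\<dots> = G r + G r"
  proof -
    have *: "G r = (\<integral>\<^sup>+w. ennreal (g0 w) \<partial>N 0)" by (simp only: G_def g0_def)
    have "(\<lambda>w. ennreal (g0 w)) \<in> borel_measurable (N 0)"
      by (rule measurable_compose[OF _ measurable_ennreal]) fact
    from nn_integral_add[OF this this] show ?thesis unfolding * .
  qed
  finally show ?thesis by (simp only: mult_2)
qed

lemma G_eq_H:
  assumes r: "0 < r"
  shows "G r = ennreal (H r)"
proof -
  define l where "l s = H s - enn2real (G s)" for s
  have Gl: "G s = ennreal (H s - l s)" "0 \<le> l s" "l s \<le> H s" if "0 < s" for s
  proof -
    have "0 \<le> H s" using c_pos by (simp add: H_def)
    then have "enn2real (G s) \<le> H s" using G_le_H[OF that] by (intro enn2real_leI)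
    moreover have "G s < \<top>" using G_le_H[OF that] by (rule order_le_less_trans) simp
    ultimately show "G s = ennreal (H s - l s)" "0 \<le> l s" "l s \<le> H s"
      by (auto simp: l_def)
  qed
  have step: "2 * l s \<le> l (2 * s)" if "0 < s" for s
  proof -
    have Hl: "0 \<le> l s" "l s \<le> H s" "0 \<le> l (2 * s)" "l (2 * s) \<le> H (2 * s)"
      using Gl(2,3)[of s] Gl(2,3)[of "2 * s"] that by auto
    have "ennreal (2 * H s) + ennreal (H (2 * s) - l (2 * s)) \<le> ennreal (H (2 * s)) + 2 * ennreal (H s - l s)"
      using G_defect[OF that] Gl(1)[of s] Gl(1)[of "2 * s"] that by simp
    also have "ennreal (2 * H s) + ennreal (H (2 * s) - l (2 * s)) = ennreal (2 * H s + (H (2 * s) - l (2 * s)))"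
      using Hl by (intro ennreal_plus[symmetric]) auto
    also have "ennreal (H (2 * s)) + 2 * ennreal (H s - l s) = ennreal (H (2 * s) + 2 * (H s - l s))"
    proof -
      have "2 * ennreal (H s - l s) = ennreal (2 * (H s - l s))"
        using Hl unfolding mult_2 by (intro ennreal_plus[symmetric]) auto
      then show ?thesis using Hl by (simp only:) (intro ennreal_plus[symmetric]; simp)
    qed
    finally show ?thesis using Hl by (subst (asm) ennreal_le_iff) auto
  qed
  \<comment> \<open>Doubling n times uses only the crude bound l \<le> H at
    \<open>2 ^ n * r\<close>: H is homogeneous of degree \<alpha> < 1, while the defect at least
    doubles at each step.\<close>
  have le: "l r \<le> H r * (2 powr (\<alpha> - 1)) ^ n" for n
  proof -
    have "2 ^ n * l r \<le> l (2 ^ n * r)"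
    proof (induction n)
      case (Suc n)
      have "2 ^ Suc n * l r \<le> 2 * l (2 ^ n * r)" using Suc by simp
      also have "\<dots> \<le> l (2 * (2 ^ n * r))" using r by (intro step) simp
      finally show ?case by (simp add: mult.assoc)
    qed simp
    also have "\<dots> \<le> H (2 ^ n * r)" using r by (intro Gl(3)) simp
    also have "\<dots> = H r * (2 ^ n) powr \<alpha>" using r by (simp add: H_def powr_mult)
    also have "(2 ^ n) powr \<alpha> = (2 powr \<alpha>) ^ n"
      by (simp add: powr_powr powr_realpow[symmetric] mult.commute)
    finally have "l r \<le> H r * ((2 powr \<alpha>) ^ n / 2 ^ n)" by (simp add: field_simps)
    also have "(2 powr \<alpha>) ^ n / 2 ^ n = (2 powr (\<alpha> - 1)) ^ n"
      by (simp add: powr_diff power_divide)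
    finally show ?thesis .
  qed
  have "(\<lambda>n. H r * (2 powr (\<alpha> - 1)) ^ n) \<longlonglongrightarrow> H r * 0"
    using \<alpha>01 powr_less_mono[of "\<alpha> - 1" 0 2] by (intro tendsto_mult tendsto_const LIMSEQ_power_zero) auto
  from LIMSEQ_le_const[OF this, of "l r"] le have "l r \<le> 0" by simp
  then show ?thesis using Gl[OF r] by simp
qed

lemma laplace_local_time:
  assumes r: "0 < r"
  shows "(\<integral>\<^sup>+w. ennreal (1 - exp (- r * L 0 w)) \<partial>N 0) = ennreal (c * r powr \<alpha>)"
proof -
  have "(\<integral>\<^sup>+w. ennreal (1 - exp (- r * L 0 w)) \<partial>N 0) = G r"
    unfolding G_def
  proof (rule nn_integral_cong_AE)
    show "AE w in N 0. ennreal (1 - exp (- r * L 0 w)) = ennreal (1 - nexp (ennreal (r * L 0 w)))"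
      using AE_local_time by eventually_elim (use r in \<open>simp add: nexp_ennreal\<close>)
  qed
  then show ?thesis using G_eq_H[OF r] by (simp add: H_def)
qed

end

section \<open>Uniqueness of Laplace exponents\<close>

text \<open>The Dynkin argument of \<open>measurable_emeasure_of_integral\<close> is reused: the two
  measures form a kernel indexed by \<open>bool\<close>, and measurability for the trivial
  sigma-algebra forces its two values to agree.\<close>

lemma finite_measure_eqI_integral:
  fixes M M' :: "real measure"
  assumes M: "finite_measure M" "sets M = sets borel" and M': "finite_measure M'" "sets M' = sets borel"
    and eq: "\<And>g :: real \<Rightarrow> real. continuous_on UNIV g \<Longrightarrow> bounded (range g) \<Longrightarrow> (\<integral>x. g x \<partial>M) = (\<integral>x. g x \<partial>M')"
  shows "M = M'"
proof (rule measure_eqI)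
  fix A assume A: "A \<in> sets M"
  text \<open>A function is measurable for the trivial \<open>\<sigma>\<close>-algebra only if it is constant.\<close>
  define T where "T = sigma (UNIV :: bool set) {}"
  have sets_T: "sets T = {{}, UNIV}" and space_T: "space T = UNIV"
    by (auto simp: T_def sigma_sets_empty_eq)
  define \<kappa> where "\<kappa> b = (if b then M else M')" for b
  have "(\<lambda>b. emeasure (\<kappa> b) A) \<in> borel_measurable T"
  proof (rule measurable_emeasure_of_integral)
    fix g :: "real \<Rightarrow> real" assume "continuous_on UNIV g" "bounded (range g)"
    then have "(\<lambda>b. \<integral>x. g x \<partial>\<kappa> b) = (\<lambda>b. \<integral>x. g x \<partial>M)" using eq by (auto simp: \<kappa>_def)
    then show "(\<lambda>b. \<integral>x. g x \<partial>\<kappa> b) \<in> borel_measurable T" by simp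
  qed (use A M M' in \<open>auto simp: \<kappa>_def\<close>)
  then have "(\<lambda>b. emeasure (\<kappa> b) A) -` {emeasure M A} \<inter> space T \<in> sets T"
    by (rule measurable_sets) auto
  moreover have "True \<in> (\<lambda>b. emeasure (\<kappa> b) A) -` {emeasure M A} \<inter> space T"
    by (simp add: \<kappa>_def space_T)
  ultimately have "False \<in> (\<lambda>b. emeasure (\<kappa> b) A) -` {emeasure M A}"
    unfolding sets_T space_T by blast
  then show "emeasure M A = emeasure M' A" by (simp add: \<kappa>_def)
qed (use M M' in simp)

text \<open>The image under x = exp(-l) lives on [0, 1], where the given integrals are the moments;
  equal moments give equal integrals of polynomials and then, by uniform approximation, of
  continuous functions.\<close>

lemma finite_measure_eqI_laplace:
  fixes M M' :: "real measure"
  assumes M: "finite_measure M" "sets M = sets borel" "AE l in M. 0 < l"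
    and M': "finite_measure M'" "sets M' = sets borel" "AE l in M'. 0 < l"
    and eq: "\<And>n::nat. (\<integral>\<^sup>+l. ennreal (exp (- l) ^ n) \<partial>M) = (\<integral>\<^sup>+l. ennreal (exp (- l) ^ n) \<partial>M')"
  shows "M = M'"
proof -
  have int: "integrable K (\<lambda>l. g (exp (- l)))" and
    bnd: "\<And>B. (\<And>x. x \<in> {0..1} \<Longrightarrow> \<bar>g x\<bar> \<le> B) \<Longrightarrow> \<bar>\<integral>l. g (exp (- l)) \<partial>K\<bar> \<le> B * measure K UNIV"
    if K: "finite_measure K" "sets K = sets borel" "AE l in K. 0 < l" and g: "continuous_on UNIV g"
    for K :: "real measure" and g :: "real \<Rightarrow> real"
  proof -
    interpret finite_measure K by fact
    have gm: "g \<in> borel_measurable borel" using g by (rule borel_measurable_continuous_onI)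
    have m: "(\<lambda>l. g (exp (- l))) \<in> borel_measurable K"
      unfolding measurable_cong_sets[OF K(2) refl] using gm by measurable
    have sp: "space K = UNIV" using sets_eq_imp_space_eq[OF K(2)] by simp
    have *: "integrable K (\<lambda>l. g (exp (- l))) \<and> \<bar>\<integral>l. g (exp (- l)) \<partial>K\<bar> \<le> B * measure K UNIV"
      if B: "\<And>x. x \<in> {0..1} \<Longrightarrow> \<bar>g x\<bar> \<le> B" for B
    proof
      have ae: "AE l in K. \<bar>g (exp (- l))\<bar> \<le> B"
        using K(3) by eventually_elim (intro B, auto)
      show i: "integrable K (\<lambda>l. g (exp (- l)))"
        by (rule integrable_const_bound[of _ B]) (use ae m in auto)
      have "\<bar>\<integral>l. g (exp (- l)) \<partial>K\<bar> \<le> (\<integral>l. \<bar>g (exp (- l))\<bar> \<partial>K)" by (rule integral_abs_bound)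
      also have "\<dots> \<le> (\<integral>l. B \<partial>K)" using i ae by (intro integral_mono_AE) auto
      also have "\<dots> = B * measure K UNIV" using sp by simp
      finally show "\<bar>\<integral>l. g (exp (- l)) \<partial>K\<bar> \<le> B * measure K UNIV" .
    qed
    have "compact (g ` {0..1})"
      using g by (intro compact_continuous_image) (auto intro: continuous_on_subset)
    then obtain B where "\<And>x. x \<in> {0..1} \<Longrightarrow> \<bar>g x\<bar> \<le> B"
      using compact_imp_bounded[of "g ` {0..1}"] unfolding bounded_iff by (auto simp del: atLeastAtMost_iff)
    then show "integrable K (\<lambda>l. g (exp (- l)))" using * by blast
    show "\<And>B. (\<And>x. x \<in> {0..1} \<Longrightarrow> \<bar>g x\<bar> \<le> B) \<Longrightarrow> \<bar>\<integral>l. g (exp (- l)) \<partial>K\<bar> \<le> B * measure K UNIV"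
      using * by blast
  qed
  have mom: "(\<integral>l. exp (- l) ^ n \<partial>M) = (\<integral>l. exp (- l) ^ n \<partial>M')" for n :: nat
  proof -
    have "(\<lambda>l::real. exp (- l) ^ n) \<in> borel_measurable borel" by measurable
    then have "(\<lambda>l. exp (- l) ^ n) \<in> borel_measurable M" "(\<lambda>l. exp (- l) ^ n) \<in> borel_measurable M'"
      unfolding measurable_cong_sets[OF M(2) refl] measurable_cong_sets[OF M'(2) refl] by simp_all
    then show ?thesis using eq[of n] by (simp add: integral_eq_nn_integral)
  qed
  have poly: "(\<integral>l. p (exp (- l)) \<partial>M) = (\<integral>l. p (exp (- l)) \<partial>M')" if "real_polynomial_function p" for p :: "real \<Rightarrow> real"
  proof -
    have "\<exists>a n. p = (\<lambda>x. \<Sum>i\<le>n. a i * x ^ i)"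
      using that unfolding real_polynomial_function_iff_sum .
    then obtain a n where p: "p = (\<lambda>x. \<Sum>i\<le>n. a i * x ^ i)" by (elim exE)
    have "(\<integral>l. p (exp (- l)) \<partial>K) = (\<Sum>i\<le>n. a i * (\<integral>l. exp (- l) ^ i \<partial>K))"
      if "finite_measure K" "sets K = sets borel" "AE l in K. 0 < l" for K :: "real measure"
    proof -
      have "integrable K (\<lambda>l. exp (- l) ^ i)" for i :: nat
        using int[OF that, of "\<lambda>x. x ^ i"] by (simp add: continuous_intros)
      then show ?thesis unfolding p by simp
    qed
    then show ?thesis using M M' mom by simp
  qed
  have cont: "(\<integral>l. g (exp (- l)) \<partial>M) = (\<integral>l. g (exp (- l)) \<partial>M')" if g: "continuous_on UNIV g" for g :: "real \<Rightarrow> real"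
  proof -
    define C where "C = measure M UNIV + measure M' UNIV"
  let ?D = "\<bar>(\<integral>l. g (exp (- l)) \<partial>M) - (\<integral>l. g (exp (- l)) \<partial>M')\<bar>"
    have *: "?D \<le> \<epsilon> * C" if \<epsilon>: "0 < \<epsilon>" for \<epsilon>
    proof -
      obtain p where p: "real_polynomial_function p" "\<And>x. x \<in> {0..1} \<Longrightarrow> \<bar>g x - p x\<bar> < \<epsilon>"
        using Stone_Weierstrass_real_polynomial_function[of "{0..1::real}" g \<epsilon>] g \<epsilon>
        by (auto intro: continuous_on_subset)
      have pc: "continuous_on UNIV p"
        using p(1) by (simp add: continuous_on_polymonial_function real_polynomial_function_eq)
      have d: "continuous_on UNIV (\<lambda>x. g x - p x)" using g pc by (intro continuous_intros)
      have dle: "\<bar>g x - p x\<bar> \<le> \<epsilon>" if "x \<in> {0..1}" for x using p(2)[OF that] by simp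
      have "\<bar>\<integral>l. g (exp (- l)) - p (exp (- l)) \<partial>M\<bar> \<le> \<epsilon> * measure M UNIV"
        "\<bar>\<integral>l. g (exp (- l)) - p (exp (- l)) \<partial>M'\<bar> \<le> \<epsilon> * measure M' UNIV"
        using bnd[OF M d dle] bnd[OF M' d dle] by auto
      then show ?thesis
        using poly[OF p(1)] int[OF M g] int[OF M' g] int[OF M pc] int[OF M' pc]
        by (simp add: C_def algebra_simps)
    qed
    have C: "0 \<le> C" by (simp add: C_def)
    have "?D \<le> 0"
    proof (rule field_le_epsilon)
      fix e :: real assume e: "0 < e"
      have "e / (C + 1) * C \<le> e" using e C by (simp add: field_simps)
      then show "?D \<le> 0 + e"
        using *[of "e / (C + 1)"] e C by simp
    qed
    then show ?thesis by simp
  qed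
  have e: "(\<lambda>l::real. exp (- l)) \<in> borel \<rightarrow>\<^sub>M borel" by measurable
  have eM: "(\<lambda>l. exp (- l)) \<in> M \<rightarrow>\<^sub>M borel" "(\<lambda>l. exp (- l)) \<in> M' \<rightarrow>\<^sub>M borel"
    using e unfolding measurable_cong_sets[OF M(2) refl] measurable_cong_sets[OF M'(2) refl] by simp_all
  have "distr M borel (\<lambda>l. exp (- l)) = distr M' borel (\<lambda>l. exp (- l))"
  proof (rule finite_measure_eqI_integral)
    fix g :: "real \<Rightarrow> real" assume g: "continuous_on UNIV g"
    then have "g \<in> borel_measurable borel" by (rule borel_measurable_continuous_onI)
    then show "(\<integral>x. g x \<partial>distr M borel (\<lambda>l. exp (- l))) = (\<integral>x. g x \<partial>distr M' borel (\<lambda>l. exp (- l)))"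
      using cont[OF g] eM by (simp add: integral_distr)
  qed (use M(1) M'(1) eM in \<open>auto intro: finite_measure.finite_measure_distr\<close>)
  \<comment> \<open>The map -ln inverts l \<mapsto> exp(-l), so the original measures are
    recovered.\<close>
  then have "distr (distr M borel (\<lambda>l. exp (- l))) borel (\<lambda>x. - ln x)
      = distr (distr M' borel (\<lambda>l. exp (- l))) borel (\<lambda>x. - ln x)" by simp
  moreover have "(\<lambda>x::real. - ln x) \<in> borel \<rightarrow>\<^sub>M borel" by measurable
  ultimately have "distr M borel (\<lambda>x. x) = distr M' borel (\<lambda>x. x)"
    using eM by (simp add: distr_distr comp_def)
  then show ?thesis using M(2) M'(2) by (simp add: distr_id2)
qed

text \<open>The measures may be infinite near 0, so they are first weighted by 1 - exp(-l), which
  makes them finite. Moments in exp(-l) of the weighted measures are increments of the Laplace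
  exponent between n and n + 1. The weight is positive on l > 0 and can be divided out
  there.\<close>

lemma measure_eq_of_laplace_exponent:
  fixes M M' :: "real measure"
  assumes M: "sets M = sets borel" and M': "sets M' = sets borel"
    and pos: "AE l in M. 0 \<le> l" "AE l in M'. 0 \<le> l"
    and eq: "\<And>r. 0 < r \<Longrightarrow> (\<integral>\<^sup>+l. ennreal (1 - exp (- r * l)) \<partial>M) = (\<integral>\<^sup>+l. ennreal (1 - exp (- r * l)) \<partial>M')"
    and fin: "\<And>r. 0 < r \<Longrightarrow> (\<integral>\<^sup>+l. ennreal (1 - exp (- r * l)) \<partial>M) < \<infinity>"
    and A: "A \<in> sets borel" "A \<subseteq> {0<..}"
  shows "emeasure M A = emeasure M' A"
proof -
  define h where "h l = ennreal (1 - exp (- l)) * indicator {0<..} l" for l :: real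
  have hm [measurable]: "h \<in> borel_measurable borel" unfolding h_def[abs_def] by measurable
  have [measurable]: "A \<in> sets borel" by (rule A(1))
  define X where "X K r = (\<integral>\<^sup>+l. ennreal (1 - exp (- r * l)) \<partial>K)" for K :: "real measure" and r
  have meas: "f \<in> borel_measurable K" if "sets K = sets borel" "f \<in> borel_measurable borel"
    for K :: "real measure" and f :: "real \<Rightarrow> ennreal"
    using that(2) unfolding measurable_cong_sets[OF that(1) refl] .
  \<comment> \<open>The increment is stated as a sum so that no infinite integrals are subtracted; n
    = 0 gives the total mass of the weighted measure.\<close>
  have X_density: "(\<integral>\<^sup>+l. ennreal (exp (- l) ^ n) \<partial>density K h) + X K (real n) = X K (real (Suc n))"
    if K: "sets K = sets borel" "AE l in K. 0 \<le> l" for K and n :: nat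
  proof -
    have "(\<integral>\<^sup>+l. ennreal (exp (- l) ^ n) \<partial>density K h) = (\<integral>\<^sup>+l. h l * ennreal (exp (- l) ^ n) \<partial>K)"
      by (intro nn_integral_density meas[OF K(1)]) measurable
    then have "(\<integral>\<^sup>+l. ennreal (exp (- l) ^ n) \<partial>density K h) + X K (real n)
        = (\<integral>\<^sup>+l. h l * ennreal (exp (- l) ^ n) + ennreal (1 - exp (- real n * l)) \<partial>K)"
      unfolding X_def by (simp only:) (intro nn_integral_add[symmetric] meas[OF K(1)]; measurable)
    also have "\<dots> = (\<integral>\<^sup>+l. ennreal (1 - exp (- real (Suc n) * l)) \<partial>K)"
    proof (rule nn_integral_cong_AE)
      show "AE l in K. h l * ennreal (exp (- l) ^ n) + ennreal (1 - exp (- real n * l)) = ennreal (1 - exp (- real (Suc n) * l))"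
        using K(2)
      proof eventually_elim
        case (elim l)
        have e: "exp (- l) ^ n = exp (- real n * l)" by (simp flip: exp_of_nat_mult)
        have "h l = ennreal (1 - exp (- l))" using elim by (cases "l = 0") (auto simp: h_def)
        then have "h l * ennreal (exp (- l) ^ n) = ennreal ((1 - exp (- l)) * exp (- real n * l))"
          using elim by (simp only: e) (rule ennreal_mult[symmetric]; simp)
        moreover have "0 \<le> 1 - exp (- real n * l)" "0 \<le> (1 - exp (- l)) * exp (- real n * l)" using elim by auto
        ultimately have "h l * ennreal (exp (- l) ^ n) + ennreal (1 - exp (- real n * l))
            = ennreal ((1 - exp (- l)) * exp (- real n * l) + (1 - exp (- real n * l)))"
          by (simp only: ennreal_plus)
        also have "(1 - exp (- l)) * exp (- real n * l) + (1 - exp (- real n * l)) = 1 - exp (- real (Suc n) * l)"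
          by (simp add: algebra_simps exp_add[symmetric])
        finally show ?case .
      qed
    qed
    finally show ?thesis by (simp only: X_def)
  qed
  have X_eq: "X M (real n) = X M' (real n)" "X M (real n) < \<infinity>" for n
    using eq[of "real n"] fin[of "real n"] by (cases n; simp add: X_def)+
  have mom: "(\<integral>\<^sup>+l. ennreal (exp (- l) ^ n) \<partial>density M h) = (\<integral>\<^sup>+l. ennreal (exp (- l) ^ n) \<partial>density M' h)" for n :: nat
  proof -
    have "(\<integral>\<^sup>+l. ennreal (exp (- l) ^ n) \<partial>density M h) + X M (real n)
        = (\<integral>\<^sup>+l. ennreal (exp (- l) ^ n) \<partial>density M' h) + X M (real n)"
      using X_density[OF M pos(1), of n] X_density[OF M' pos(2), of n] X_eq(1)[of n] X_eq(1)[of "Suc n"] by simp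
    then show ?thesis using X_eq(2)[of n] by (auto simp: add.commute[of _ "X M (real n)"] ennreal_add_left_cancel)
  qed
  have finK: "finite_measure (density K h)" and posK: "AE l in density K h. 0 < l"
    if K: "sets K = sets borel" "AE l in K. 0 \<le> l" "X K 1 < \<infinity>" for K
  proof -
    have "(\<integral>\<^sup>+l. ennreal (exp (- l) ^ 0) \<partial>density K h) < \<infinity>"
      using X_density[OF K(1,2), of 0] K(3) by (auto simp: X_def less_top[symmetric])
    then show "finite_measure (density K h)" by (intro finite_measureI) auto
    show "AE l in density K h. 0 < l"
      using meas[OF K(1) hm] by (subst AE_density) (auto simp: h_def indicator_def)
  qed
  have "density M h = density M' h"
    using M M' pos X_eq[of 1] by (intro finite_measure_eqI_laplace finK posK mom) auto
  moreover have "emeasure K A = (\<integral>\<^sup>+l. ennreal (1 / (1 - exp (- l))) * indicator A l \<partial>density K h)"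
    if K: "sets K = sets borel" for K
  proof -
    have "(\<integral>\<^sup>+l. ennreal (1 / (1 - exp (- l))) * indicator A l \<partial>density K h)
        = (\<integral>\<^sup>+l. h l * (ennreal (1 / (1 - exp (- l))) * indicator A l) \<partial>K)"
      by (intro nn_integral_density meas[OF K]) measurable
    also have "\<dots> = (\<integral>\<^sup>+l. indicator A l \<partial>K)"
    proof (rule nn_integral_cong)
      fix l
      show "h l * (ennreal (1 / (1 - exp (- l))) * indicator A l) = indicator A l"
      proof (cases "l \<in> A")
        case True
        then have "0 < l" using A(2) by auto
        then have "ennreal (1 - exp (- l)) * ennreal (1 / (1 - exp (- l))) = 1"
          by (subst ennreal_mult[symmetric]) auto
        then show ?thesis using True \<open>0 < l\<close> by (simp add: h_def)
      qed simp
    qed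
    finally show ?thesis using K A(1) by simp
  qed
  ultimately show ?thesis using M M' by simp
qed

text \<open>Write 1 - exp(-r l) as the integral of r exp(-r s) over 0 \<le> s \<le> l and exchange
  the order: the tail of l^(-1-\<alpha>) beyond s is s^(-\<alpha>) / \<alpha>, which leaves a Gamma
  integral.\<close>

lemma stable_laplace_exponent:
  fixes \<alpha> r :: real
  assumes \<alpha>: "0 < \<alpha>" "\<alpha> < 1" and r: "0 < r"
  shows "(\<integral>\<^sup>+l. ennreal (1 - exp (- r * l)) * (ennreal (l powr (- 1 - \<alpha>)) * indicator {0<..} l) \<partial>lborel)
    = ennreal (Gamma (1 - \<alpha>) / \<alpha> * r powr \<alpha>)"
proof -
  define k where "k s l = ennreal (r * exp (- r * s)) * ennreal (l powr (- 1 - \<alpha>)) * indicator {0..} s * indicator {0<..} l * indicator {s..} l" for s l :: real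
  have km [measurable]: "case_prod k \<in> borel_measurable (lborel \<Otimes>\<^sub>M lborel)"
    "(\<lambda>(l, s). k s l) \<in> borel_measurable (lborel \<Otimes>\<^sub>M lborel)"
  proof -
    have ind: "indicator {s..} l = (if s \<le> l then 1 else 0 :: ennreal)" for s l :: real by (simp add: indicator_def)
    show "case_prod k \<in> borel_measurable (lborel \<Otimes>\<^sub>M lborel)" "(\<lambda>(l, s). k s l) \<in> borel_measurable (lborel \<Otimes>\<^sub>M lborel)"
      unfolding k_def[abs_def] ind by measurable
  qed
  have inner_s: "(\<integral>\<^sup>+s. k s l \<partial>lborel) = ennreal (1 - exp (- r * l)) * (ennreal (l powr (- 1 - \<alpha>)) * indicator {0<..} l)" for l
  proof (cases "0 < l")
    case True
    have "(\<integral>\<^sup>+s. k s l \<partial>lborel) = (\<integral>\<^sup>+s. ennreal (l powr (- 1 - \<alpha>)) * (ennreal (r * exp (- r * s)) * indicator {0..l} s) \<partial>lborel)"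
      using True by (intro nn_integral_cong) (auto simp: k_def indicator_def mult.commute)
    also have "\<dots> = ennreal (l powr (- 1 - \<alpha>)) * (\<integral>\<^sup>+s. ennreal (r * exp (- r * s)) * indicator {0..l} s \<partial>lborel)"
      by (intro nn_integral_cmult) measurable
    also have "(\<integral>\<^sup>+s. ennreal (r * exp (- r * s)) * indicator {0..l} s \<partial>lborel) = ennreal (- exp (- r * l) - - exp (- r * 0))"
      using True r by (intro nn_integral_FTC_Icc) (auto intro!: derivative_eq_intros)
    finally show ?thesis using True by (simp add: mult.commute)
  qed (simp add: k_def)
  \<comment> \<open>At s = 0 the inner integral diverges, but this is a single point.\<close>
  have inner_l: "(\<integral>\<^sup>+l. k s l \<partial>lborel) = ennreal (r * exp (- r * s) * (s powr (- \<alpha>) / \<alpha>)) * indicator {0..} s" if "s \<noteq> 0" for s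
  proof (cases "0 < s")
    case True
    have "(\<integral>\<^sup>+l. k s l \<partial>lborel) = (\<integral>\<^sup>+l. ennreal (r * exp (- r * s)) * (ennreal (l powr (- 1 - \<alpha>)) * indicator {s..} l) \<partial>lborel)"
      using True by (intro nn_integral_cong) (auto simp: k_def indicator_def)
    also have "\<dots> = ennreal (r * exp (- r * s)) * (\<integral>\<^sup>+l. ennreal (l powr (- 1 - \<alpha>)) * indicator {s..} l \<partial>lborel)"
      by (intro nn_integral_cmult) measurable
    also have "(\<integral>\<^sup>+l. ennreal (l powr (- 1 - \<alpha>)) * indicator {s..} l \<partial>lborel) = ennreal (0 - - (s powr (- \<alpha>) / \<alpha>))"
    proof (rule nn_integral_FTC_atLeast)
      fix l assume "s \<le> l"
      then have "((\<lambda>l. - (l powr (- \<alpha>) / \<alpha>)) has_real_derivative - (- \<alpha> * l powr (- \<alpha> - 1) / \<alpha>)) (at l)"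
        using True by (auto intro!: derivative_eq_intros)
      then show "((\<lambda>l. - (l powr (- \<alpha>) / \<alpha>)) has_real_derivative l powr (- 1 - \<alpha>)) (at l)"
        using \<alpha> by (simp add: minus_diff_commute)
    next
      have "((\<lambda>l. l powr (- \<alpha>)) \<longlongrightarrow> 0) at_top" using \<alpha> by (intro tendsto_neg_powr filterlim_ident) auto
      from tendsto_minus[OF tendsto_divide[OF this tendsto_const[of \<alpha>]]]
      show "((\<lambda>l. - (l powr (- \<alpha>) / \<alpha>)) \<longlongrightarrow> 0) at_top" using \<alpha> by simp
    qed auto
    also have "ennreal (r * exp (- r * s)) * ennreal (0 - - (s powr (- \<alpha>) / \<alpha>)) = ennreal (r * exp (- r * s) * (s powr (- \<alpha>) / \<alpha>))"
      using r \<alpha> by (subst ennreal_mult) auto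
    finally show ?thesis using True by simp
  qed (use that in \<open>simp add: k_def\<close>)
  have "(\<integral>\<^sup>+l. ennreal (1 - exp (- r * l)) * (ennreal (l powr (- 1 - \<alpha>)) * indicator {0<..} l) \<partial>lborel)
      = (\<integral>\<^sup>+l. (\<integral>\<^sup>+s. k s l \<partial>lborel) \<partial>lborel)" by (simp only: inner_s)
  also have "\<dots> = (\<integral>\<^sup>+s. (\<integral>\<^sup>+l. k s l \<partial>lborel) \<partial>lborel)"
    by (rule lborel_pair.Fubini'[OF km(1)])
  also have "\<dots> = (\<integral>\<^sup>+s. ennreal (r * exp (- r * s) * (s powr (- \<alpha>) / \<alpha>)) * indicator {0..} s \<partial>lborel)"
    using AE_lborel_singleton[of 0] by (intro nn_integral_cong_AE) (auto elim!: eventually_mono simp: inner_l)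
  \<comment> \<open>Substituting s = u / r produces Euler's integral at 1 - \<alpha>.\<close>
  also have "\<dots> = ennreal \<bar>1 / r\<bar> * (\<integral>\<^sup>+u. ennreal (r * exp (- r * (0 + 1 / r * u)) * ((0 + 1 / r * u) powr (- \<alpha>) / \<alpha>)) * indicator {0..} (0 + 1 / r * u) \<partial>lborel)"
    using r by (intro nn_integral_real_affine) auto
  also have "\<dots> = ennreal (1 / r) * (\<integral>\<^sup>+u. ennreal (r * r powr \<alpha> / \<alpha>) * ennreal (indicator {0..} u * u powr (1 - \<alpha> - 1) / exp u) \<partial>lborel)"
  proof -
    have "ennreal (r * exp (- r * (0 + 1 / r * u)) * ((0 + 1 / r * u) powr (- \<alpha>) / \<alpha>)) * indicator {0..} (0 + 1 / r * u)
        = ennreal (r * r powr \<alpha> / \<alpha>) * ennreal (indicator {0..} u * u powr (1 - \<alpha> - 1) / exp u)" for u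
    proof (cases "0 \<le> u")
      case True
      have "(u / r) powr (- \<alpha>) = u powr (- \<alpha>) * r powr \<alpha>"
        using True r by (simp add: powr_divide powr_minus field_simps)
      then have "r * exp (- u) * ((u / r) powr (- \<alpha>) / \<alpha>) = (r * r powr \<alpha> / \<alpha>) * (u powr (1 - \<alpha> - 1) / exp u)"
        by (simp add: exp_minus field_simps)
      then show ?thesis using True r \<alpha> by (simp add: ennreal_mult[symmetric])
    next
      case False
      then have "\<not> 0 \<le> u / r" using r by (simp add: divide_less_0_iff not_le)
      then show ?thesis using False by simp
    qed
    then show ?thesis using r by simp
  qed
  also have "\<dots> = ennreal (1 / r) * (ennreal (r * r powr \<alpha> / \<alpha>) * ennreal (Gamma (1 - \<alpha>)))"
    using \<alpha> by (subst nn_integral_cmult) (auto simp: Gamma_conv_nn_integral_real)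
  also have "\<dots> = ennreal (Gamma (1 - \<alpha>) / \<alpha> * r powr \<alpha>)"
    using r \<alpha> Gamma_real_pos[of "1 - \<alpha>"] by (simp add: ennreal_mult[symmetric] field_simps)
  finally show ?thesis .
qed

section \<open>The law of the local time\<close>

context cluster_local_time
begin

lemma local_time_law:
  assumes A: "A \<in> sets borel" "A \<subseteq> {0<..}"
  shows "emeasure (N 0) {w \<in> space (N 0). L 0 w \<in> A} =
    (\<integral>\<^sup>+l\<in>A. ennreal (c * \<alpha> / Gamma (1 - \<alpha>) * l powr (- 1 - \<alpha>)) \<partial>lborel)"
proof -
  \<comment> \<open>Normalized so that a times the constant Gamma(1 - \<alpha>) / \<alpha> of
    \<open>stable_laplace_exponent\<close> equals c.\<close>
  define a where "a = c * \<alpha> / Gamma (1 - \<alpha>)"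
  have \<Gamma>: "0 < Gamma (1 - \<alpha>)" using \<alpha>01 by (intro Gamma_real_pos) simp
  then have a: "0 < a" using c_pos \<alpha>01 by (simp add: a_def)
  define f where "f l = ennreal (a * l powr (- 1 - \<alpha>)) * indicator {0<..} l" for l
  have fm [measurable]: "f \<in> borel_measurable borel" unfolding f_def[abs_def] by measurable
  have "emeasure (distr (N 0) borel (L 0)) A = emeasure (density lborel f) A"
  proof (rule measure_eq_of_laplace_exponent)
    have D: "(\<integral>\<^sup>+l. ennreal (1 - exp (- r * l)) \<partial>distr (N 0) borel (L 0)) = ennreal (c * r powr \<alpha>)" if "0 < r" for r
      using laplace_local_time[OF that] by (subst nn_integral_distr) auto
    have "(\<integral>\<^sup>+l. ennreal (1 - exp (- r * l)) \<partial>density lborel f) = ennreal (c * r powr \<alpha>)" if r: "0 < r" for r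
    proof -
      have "(\<integral>\<^sup>+l. ennreal (1 - exp (- r * l)) \<partial>density lborel f) = (\<integral>\<^sup>+l. f l * ennreal (1 - exp (- r * l)) \<partial>lborel)"
        by (intro nn_integral_density) auto
      also have "\<dots> = (\<integral>\<^sup>+l. ennreal a * (ennreal (1 - exp (- r * l)) * (ennreal (l powr (- 1 - \<alpha>)) * indicator {0<..} l)) \<partial>lborel)"
        using a by (intro nn_integral_cong) (simp add: f_def ennreal_mult ac_simps)
      also have "\<dots> = ennreal a * ennreal (Gamma (1 - \<alpha>) / \<alpha> * r powr \<alpha>)"
        using \<alpha>01 r by (subst nn_integral_cmult) (auto simp only: stable_laplace_exponent, measurable)
      also have "\<dots> = ennreal (c * r powr \<alpha>)"
        using a \<alpha>01 c_pos less_imp_neq[OF \<Gamma>] by (simp add: a_def ennreal_mult[symmetric])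
      finally show ?thesis .
    qed
    then show "(\<integral>\<^sup>+l. ennreal (1 - exp (- r * l)) \<partial>distr (N 0) borel (L 0)) = (\<integral>\<^sup>+l. ennreal (1 - exp (- r * l)) \<partial>density lborel f)"
      "(\<integral>\<^sup>+l. ennreal (1 - exp (- r * l)) \<partial>distr (N 0) borel (L 0)) < \<infinity>" if "0 < r" for r
      using D that by auto
    show "AE l in distr (N 0) borel (L 0). 0 \<le> l"
      using AE_local_time by (subst AE_distr_iff) (auto elim: eventually_mono)
    show "AE l in density lborel f. 0 \<le> l"
      by (subst AE_density) (auto simp: f_def indicator_def)
  qed (use A in auto)
  moreover have "emeasure (distr (N 0) borel (L 0)) A = emeasure (N 0) {w \<in> space (N 0). L 0 w \<in> A}"
    using A(1) by (subst emeasure_distr) (auto intro: arg_cong[where f="emeasure (N 0)"])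
  moreover have "emeasure (density lborel f) A = (\<integral>\<^sup>+l. f l * indicator A l \<partial>lborel)"
    using A(1) by (intro emeasure_density) auto
  moreover have "(\<integral>\<^sup>+l. f l * indicator A l \<partial>lborel) = (\<integral>\<^sup>+l\<in>A. ennreal (a * l powr (- 1 - \<alpha>)) \<partial>lborel)"
    using A(2) by (intro nn_integral_cong) (auto simp: f_def indicator_def)
  ultimately show ?thesis by (simp add: a_def)
qed

section \<open>Positivity of the local time at the origin\<close>

lemma increment_tendsto: "(\<lambda>n. H (real (Suc n) + 1) - H (real (Suc n))) \<longlonglongrightarrow> 0"
proof (rule tendsto_sandwich[where f="\<lambda>_. 0" and h="\<lambda>n. c * real (Suc n) powr (\<alpha> - 1)"])
  have "0 \<le> H (s + 1) - H s \<and> H (s + 1) - H s \<le> c * s powr (\<alpha> - 1)" if s: "1 \<le> s" for s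
  proof
    show "0 \<le> H (s + 1) - H s" using s c_pos \<alpha>01 by (auto simp: H_def intro!: mult_left_mono powr_mono2)
    \<comment> \<open>Because \<alpha> < 1, this bounds (s + 1)^\<alpha> - s^\<alpha> by
      s^(\<alpha>-1), which tends to 0.\<close>
    have "(1 + 1 / s) powr \<alpha> \<le> (1 + 1 / s) powr 1" using s \<alpha>01 by (intro powr_mono) auto
    then have "s powr \<alpha> * (1 + 1 / s) powr \<alpha> \<le> s powr \<alpha> * (1 + 1 / s)" using s by (intro mult_left_mono) auto
    moreover have "s powr \<alpha> * (1 + 1 / s) powr \<alpha> = (s + 1) powr \<alpha>"
      using s by (simp add: powr_mult[symmetric] distrib_left)
    moreover have "s powr \<alpha> * (1 + 1 / s) = s powr \<alpha> + s powr (\<alpha> - 1)"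
      using s by (simp add: powr_diff distrib_left)
    ultimately have "c * (s + 1) powr \<alpha> \<le> c * (s powr \<alpha> + s powr (\<alpha> - 1))"
      using c_pos by (intro mult_left_mono) auto
    then show "H (s + 1) - H s \<le> c * s powr (\<alpha> - 1)" by (simp add: H_def distrib_left)
  qed
  then show "\<forall>\<^sub>F n in sequentially. 0 \<le> H (real (Suc n) + 1) - H (real (Suc n))"
    "\<forall>\<^sub>F n in sequentially. H (real (Suc n) + 1) - H (real (Suc n)) \<le> c * real (Suc n) powr (\<alpha> - 1)"
    by (auto intro!: always_eventually simp del: of_nat_Suc)
  have "(\<lambda>n. real (Suc n) powr (\<alpha> - 1)) \<longlonglongrightarrow> 0"
    using \<alpha>01 by (intro tendsto_neg_powr filterlim_compose[OF filterlim_real_sequentially filterlim_Suc]) auto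
  then show "(\<lambda>n. c * real (Suc n) powr (\<alpha> - 1)) \<longlonglongrightarrow> 0" by (rule tendsto_mult_right_zero)
qed simp

text \<open>The limit, as e tends to 0, of the extra source for \<eta> = 1 restricted to |x| \<ge>
  e; this is why the origin is left out.\<close>

definition weight :: "real \<Rightarrow> ennreal" where
  "weight x = ennreal (1 / (1 + \<bar>x\<bar>) ^ 3) * indicator {x. x \<noteq> 0} x"

lemma borel_measurable_weight [measurable]: "weight \<in> borel_measurable borel"
  unfolding weight_def[abs_def] by measurable

lemma weighted_laplace_le:
  assumes r: "0 < r"
  shows "exponent (\<lambda>w. ennreal (r * L 0 w) + occ weight w) \<le> ennreal (H (r + 1))"
proof (rule nn_integral_le_of_tendsto)
  let ?\<psi> = "\<lambda>n x. ennreal (1 / (1 + \<bar>x\<bar>) ^ 3) * indicator {x. width n \<le> \<bar>x\<bar>} x"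
  have \<psi>m [measurable]: "?\<psi> n \<in> borel_measurable borel" for n by measurable
  show "(\<lambda>w. ennreal (1 - nexp (ennreal r * occ (window (width n)) w + occ (?\<psi> n) w))) \<in> borel_measurable (N 0)" for n
    using measurable_occ[OF \<psi>m] by measurable
  have k: "0 < kap \<beta> (r + 1)" using \<beta> r by (intro kap_pos) auto
  show "\<forall>\<^sub>F n in sequentially. exponent (\<lambda>w. ennreal r * occ (window (width n)) w + occ (?\<psi> n) w)
      \<le> ennreal (amp \<beta> * (kap \<beta> (r + 1) - width n) powr (- 2 / \<beta>) + 1 * width n)"
    using eventually_width_less[OF k]
  proof eventually_elim
    case (elim n)
    then show ?case using window_laplace_le[of "width n" "width n" r 0 1] width(1)[of n] r by simp
  qed
  show "(\<lambda>n. amp \<beta> * (kap \<beta> (r + 1) - width n) powr (- 2 / \<beta>) + 1 * width n) \<longlonglongrightarrow> H (r + 1)"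
    by (rule upper_limit) (use r in auto)
  show "AE w in N 0. (\<lambda>n. ennreal (1 - nexp (ennreal r * occ (window (width n)) w + occ (?\<psi> n) w)))
      \<longlonglongrightarrow> ennreal (1 - nexp (ennreal (r * L 0 w) + occ weight w))"
    using AE_local_time AE_window_tendsto[OF less_imp_le[OF r]]
  proof eventually_elim
    case (elim w)
    then have [measurable]: "(\<lambda>y. L y w) \<in> borel_measurable borel"
      by (auto intro: borel_measurable_continuous_onI)
    have "(\<lambda>n. \<integral>\<^sup>+y. ?\<psi> n y * ennreal (L y w) \<partial>lborel) \<longlonglongrightarrow> (\<integral>\<^sup>+y. weight y * ennreal (L y w) \<partial>lborel)"
    proof (rule nn_integral_LIMSEQ)
      show "incseq (\<lambda>n y. ?\<psi> n y * ennreal (L y w))"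
        using width(3) by (auto simp: incseq_def le_fun_def indicator_def intro!: mult_right_mono dest: order_trans)
      show "(\<lambda>n. ?\<psi> n y * ennreal (L y w)) \<longlonglongrightarrow> weight y * ennreal (L y w)" for y
      proof (rule tendsto_eventually)
        have "\<forall>\<^sub>F n in sequentially. y = 0 \<or> width n < \<bar>y\<bar>"
          using eventually_width_less[of "\<bar>y\<bar>"] by (cases "y = 0") auto
        then show "\<forall>\<^sub>F n in sequentially. ?\<psi> n y * ennreal (L y w) = weight y * ennreal (L y w)"
          by eventually_elim (use width(1) in \<open>auto simp: weight_def indicator_def not_le\<close>)
      qed
    qed measurable
    then have "(\<lambda>n. occ (?\<psi> n) w) \<longlonglongrightarrow> occ weight w" using elim(1) by simp
    with elim(2) show ?case by (intro tendsto_intros)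
  qed
qed

text \<open>On clusters with \<open>L 0 w = 0\<close> the weighted exponent is 1 - exp(-occ weight)
  for every r; elsewhere it is at least 1 - exp(-r L). Subtracting the exact value H r leaves at
  most H (r + 1) - H r, which vanishes for large r. The exact Laplace exponent is essential here, an
  upper bound would not do.\<close>

lemma occ_weight_zero:
  "AE w in N 0. L 0 w = 0 \<longrightarrow> occ weight w = 0"
proof -
  define f where "f w = indicator {w. L 0 w = 0} w * ennreal (1 - nexp (occ weight w))" for w
  have [measurable]: "f \<in> borel_measurable (N 0)"
  proof -
    have "(\<lambda>w. (if L 0 w = 0 then 1 else 0) * ennreal (1 - nexp (occ weight w))) \<in> borel_measurable (N 0)" by measurable
    then show ?thesis unfolding f_def[abs_def] by (rule measurable_eqI) (auto simp: indicator_def)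
  qed
  let ?K = "\<integral>\<^sup>+w. f w \<partial>N 0"
  have le: "(?K) \<le> ennreal (H (r + 1) - H r)" if r: "0 < r" for r
  proof -
    have H0: "0 \<le> H r" using c_pos by (simp add: H_def)
    have "(?K) + ennreal (H r) = (\<integral>\<^sup>+w. f w + ennreal (1 - nexp (ennreal (r * L 0 w))) \<partial>N 0)"
      unfolding G_eq_H[OF r, symmetric] G_def by (intro nn_integral_add[symmetric]) measurable
    also have "\<dots> \<le> exponent (\<lambda>w. ennreal (r * L 0 w) + occ weight w)"
    proof (rule nn_integral_mono)
      fix w
      show "f w + ennreal (1 - nexp (ennreal (r * L 0 w))) \<le> ennreal (1 - nexp (ennreal (r * L 0 w) + occ weight w))"
        by (cases "L 0 w = 0") (auto simp: f_def intro!: ennreal_leI nexp_mono)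
    qed
    also have "\<dots> \<le> ennreal (H (r + 1))" by (rule weighted_laplace_le[OF r])
    finally have "(?K) + ennreal (H r) \<le> ennreal (H (r + 1))" .
    then have "(?K) \<le> ennreal (H (r + 1)) - ennreal (H r)"
      by (simp add: ennreal_le_minus_iff add.commute)
    then show ?thesis using H0 by (simp add: ennreal_minus)
  qed
  have "(?K) \<le> ennreal 0"
  proof (rule LIMSEQ_le_const[OF tendsto_ennrealI[OF increment_tendsto]], intro exI allI impI)
    show "(?K) \<le> ennreal (H (real (Suc n) + 1) - H (real (Suc n)))" for n
      by (rule le) simp
  qed
  then have "AE w in N 0. f w = 0"
    by (simp add: nn_integral_0_iff_AE)
  then show ?thesis
  proof eventually_elim
    case (elim w)
    show ?case
    proof
      assume "L 0 w = 0"
      then have "nexp (occ weight w) = nexp 0" using elim nexp_le_1[of "occ weight w"] by (auto simp: f_def)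
      then show "occ weight w = 0" by (rule nexp_inj)
    qed
  qed
qed

text \<open>A nonzero cluster has positive mass at some time, hence on a whole interval to the right
  of it by right continuity.\<close>

lemma occ_one_pos:
  assumes w: "w \<in> space (N 0)"
  shows "occ (\<lambda>_. 1) w \<noteq> 0"
proof
  let ?m = "\<lambda>s. \<integral>x. (1::real) \<partial>w s"
  assume zero: "occ (\<lambda>_. 1) w = 0"
  have w': "w \<in> space cluster_space" using w space_N by simp
  then obtain t where t: "0 < t" "w t \<noteq> null_measure borel"
    by (auto simp: cluster_space_def space_restrict_space)
  have fin: "finite_measure (w s)" "sets (w s) = sets borel" if "0 < s" for s
    using cluster_space.path_finite_measure[OF w'] cluster_space.path_sets[OF w'] that by auto
  have sp: "space (w s) = UNIV" if "0 < s" for s using sets_eq_imp_space_eq[OF fin(2)[OF that]] by simp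
  have mass: "emeasure (w s) UNIV = ennreal (\<integral>x. 1 \<partial>w s)" if "0 < s" for s
    using finite_measure.emeasure_eq_measure[OF fin(1)[OF that]] sp[OF that] by simp
  have "0 < (?m t)"
  proof (rule ccontr)
    assume "\<not> 0 < (?m t)"
    then have "emeasure (w t) UNIV = 0" using mass[OF t(1)] by (simp add: ennreal_neg)
    then have "emeasure (w t) A = 0" for A
      using emeasure_space[of "w t" A] sp[OF t(1)] by simp
    then have "w t = null_measure borel"
      using fin(2)[OF t(1)] by (intro measure_eqI) auto
    then show False using t(2) by simp
  qed
  moreover have "((\<lambda>s. ?m s) \<longlongrightarrow> (\<integral>x. 1 \<partial>w t)) (at_right t)"
    using t(1) by (intro cluster_space.path_integral_right_limit[OF w']) (auto simp: bounded_def)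
  ultimately have "\<forall>\<^sub>F s in at_right t. 0 < (?m s)"
    by (intro order_tendstoD(1))
  then obtain b where b: "t < b" "\<And>s. t < s \<Longrightarrow> s < b \<Longrightarrow> 0 < (?m s)"
    unfolding eventually_at_right_field by blast
  have "(\<lambda>s. (\<integral>\<^sup>+x. 1 \<partial>w s) * indicator {0<..} s) \<in> borel_measurable lborel"
    by (intro cluster_space.measurable_in_time[OF w']) auto
  then have "AE s in lborel. (\<integral>\<^sup>+x. 1 \<partial>w s) * indicator {0<..} s = 0"
    using zero unfolding occ_def by (simp add: nn_integral_0_iff_AE)
  then have "AE s in lborel. s \<notin> {t<..<b}"
  proof eventually_elim
    case (elim s)
    show ?case
    proof
      assume s: "s \<in> {t<..<b}"
      then have "0 < s" using t by auto
      then show False using elim mass[of s] b(2)[of s] s sp[of s] by (auto simp: ennreal_eq_0_iff)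
    qed
  qed
  then have "{t<..<b} \<in> null_sets lborel"
    by (subst AE_iff_null_sets) auto
  then have "emeasure lborel {t<..<b} = 0" by (rule null_setsD1)
  then show False using b(1) by simp
qed

text \<open>If the local time vanished at 0, the weighted occupation would vanish; as
  \<open>weight\<close> is positive off 0, the local time would be zero almost everywhere,
  contradicting that the total occupation is not zero.\<close>

lemma local_time_pos: "AE w in N 0. 0 < L 0 w"
  using AE_local_time occ_weight_zero AE_space
proof eventually_elim
  case (elim w)
  then have [measurable]: "(\<lambda>y. L y w) \<in> borel_measurable borel"
    by (auto intro: borel_measurable_continuous_onI)
  show ?case
  proof (rule ccontr)
    assume "\<not> 0 < L 0 w"
    then have "L 0 w = 0" using elim(1) by (simp add: order_antisym)
    then have "(\<integral>\<^sup>+y. weight y * ennreal (L y w) \<partial>lborel) = 0" using elim by simp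
    then have "AE y in lborel. weight y * ennreal (L y w) = 0"
      by (subst (asm) nn_integral_0_iff_AE) auto
    then have "AE y in lborel. 1 * ennreal (L y w) = 0"
      using AE_lborel_singleton[of 0]
      by eventually_elim (auto simp: weight_def ennreal_eq_0_iff divide_le_0_iff not_le add_pos_nonneg)
    then have "(\<integral>\<^sup>+y. 1 * ennreal (L y w) \<partial>lborel) = 0"
      by (subst nn_integral_0_iff_AE) auto
    then have "occ (\<lambda>_. 1) w = 0" using elim(1) by simp
    then show False using occ_one_pos elim(3) by blast
  qed
qed

end

theorem corollary1p8:
  fixes \<beta> \<alpha> c :: real
    and P :: "real measure \<Rightarrow> path measure"
    and N :: "real \<Rightarrow> path measure"
    and L :: "real \<Rightarrow> path \<Rightarrow> real"
  assumes "0 < \<beta>" and "\<beta> < 1"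
    and "super_Brownian_motion \<beta> P"
    and "canonical_measure P N"
    and "total_local_time (N 0) L"
    and "\<alpha> = 2 / (2 + \<beta>)"
    and "c = (sqrt (\<beta> + 2) / 2) powr \<alpha>"
  shows "(\<forall>r>0. (\<integral>\<^sup>+w. ennreal (1 - exp (- r * L 0 w)) \<partial>N 0) = ennreal (c * r powr \<alpha>)) \<and>
    (\<forall>A\<in>sets borel. A \<subseteq> {0<..} \<longrightarrow>
       emeasure (N 0) {w \<in> space (N 0). L 0 w \<in> A} =
         (\<integral>\<^sup>+l\<in>A. ennreal (c * \<alpha> / Gamma (1 - \<alpha>) * l powr (- 1 - \<alpha>)) \<partial>lborel)) \<and>
    (AE w in N 0. L 0 w > 0)"
proof -
  interpret cluster_local_time \<beta> \<alpha> c P N L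
    using assms by unfold_locales
  show ?thesis
    using laplace_local_time local_time_law local_time_pos by simp
qed

end
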